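(* Let $i\in[n]$ and $I\in\binom{[n]}{k}$. Suppose $f,s_if,fs_i,s_ifs_i\in\mathbf{B}_{k,n}$ and $\ell(s_ifs_i)=\ell(f)+2$. If $i\in I$ implies $i+1\in I$, then $\Pi^\circ_{f,I}$ admits a decomposition $\Pi^\circ_{f,I}=Z_I\sqcup U_I$, where $Z_I$ is closed, $U_I$ is its open complement, and $$Z_I\cong\Pi^\circ_{s_ifs_i,\,s_iI}\times\mathbb{C},\qquad U_I\cong\Pi^\circ_{s_if,\,s_iI}\times\mathbb{C}^*.$$
   Context: Let $n\ge2$, $0\le k\le n$, $[n]=\{1,\dots,n\}$; indices are read modulo $n$ (so for $i=n$, $i+1$ means $1$ as an element of $[n]$). An $n$-periodic affine permutation is a bijection $f:\mathbb{Z}\to\mathbb{Z}$ with $f(a+n)=f(a)+n$. Products are read left to right: $(fg)(a)=g(f(a))$. $\mathbf{B}_{k,n}$ is the set of those with $\frac1n\sum_{a=1}^n(f(a)-a)=k$ and $a\le f(a)\le a+n$ for all $a$. Length: $\ell(f)=\#\{(a,b):a\in[n],b\in\mathbb{Z},a<b,f(a)>f(b)\}$. $s_i$ exchanges $i+mn$ and $i+1+mn$ for all $m$ and fixes all other integers; $s_iI$ is the image of $I$ under the induced transposition of $[n]$ (exchanging $i$ and $i+1$ mod $n$). For $f\in\mathbf{B}_{k,n}$ and $j\in[n]$ let $\overrightarrow{I_j}(f)=\{f(a):a<j,\ f(a)\ge j\}\bmod n\in\binom{[n]}{k}$ (target Grassmann necklace). Let $\le_j$ be the order $j<_jj+1<_j\dots<_jj-1$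 on $[n]$, and compare $k$-subsets entrywise after sorting with respect to $<_j$. Let $\mathcal{M}(f)=\{J\in\binom{[n]}{k}: J\ge_j\overrightarrow{I_j}(f)\text{ for all }j\in[n]\}$. The open positroid variety is $$\Pi^\circ_f=\{x\in\operatorname{Gr}(k,n):\Delta_J(x)=0\ \forall J\notin\mathcal{M}(f),\ \Delta_{\overrightarrow{I_j}(f)}(x)\ne0\ \forall j\in[n]\},$$ where $\operatorname{Gr}(k,n)$ is the complex Grassmannian of $k$-dimensional subspaces of $\mathbb{C}^n$ and $\Delta_J$ are Plücker coordinates (minors of a $k\times n$ matrix with given row span, in columns $J$). $\Pi^\circ_{f,I}=\Pi^\circ_f\cap\{\Delta_I\ne0\}$ (possibly empty). "$\cong$" means isomorphism of complex algebraic varieties; empty varieties are allowed. *)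

theory Defs
  imports
    "HOL-Analysis.Abstract_Topology"
    "Jordan_Normal_Form.DL_Rank"
    "Jordan_Normal_Form.DL_Submatrix"
begin

section \<open>Complex algebraic varieties as spaces with functions\<close>

text \<open>
  A classical (reduced) complex variety is given by its set of closed points with the Zariski
  topology, together with the complex valued regular functions on every Zariski open set.  A
  function is total in HOL; whether it belongs to \<open>regular X U\<close> depends on its values on \<open>U\<close> only,
  and \<open>regular X U\<close> is meaningful for open \<open>U\<close> only.
\<close>

record 'a function_space =
  zariski :: "'a topology"
  regular :: "'a set \<Rightarrow> ('a \<Rightarrow> complex) set"

definition morphism :: "'a function_space \<Rightarrow> 'b function_space \<Rightarrow> ('a \<Rightarrow> 'b) \<Rightarrow> bool" where
  "morphism X Y \<phi> \<longleftrightarrow>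
     continuous_map (zariski X) (zariski Y) \<phi> \<and>
     (\<forall>V h. openin (zariski Y) V \<longrightarrow> h \<in> regular Y V \<longrightarrow>
        h \<circ> \<phi> \<in> regular X {x \<in> topspace (zariski X). \<phi> x \<in> V})"

definition isomorphic_varieties :: "'a function_space \<Rightarrow> 'b function_space \<Rightarrow> bool"
    (infix "\<cong>\<^sub>v" 50) where
  "X \<cong>\<^sub>v Y \<longleftrightarrow>
     (\<exists>\<phi> \<psi>. morphism X Y \<phi> \<and> morphism Y X \<psi> \<and>
        (\<forall>x \<in> topspace (zariski X). \<psi> (\<phi> x) = x) \<and>
        (\<forall>y \<in> topspace (zariski Y). \<phi> (\<psi> y) = y))"

text \<open>
  The space on \<open>X\<close> determined by a set \<open>F\<close> of pairs (numerator, denominator): the loci where a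
  denominator does not vanish generate the topology, and a function is regular if near every point
  it is a quotient \<open>p / q\<close> with \<open>(p, q) \<in> F\<close>.
\<close>

definition fraction_space ::
    "'a set \<Rightarrow> (('a \<Rightarrow> complex) \<times> ('a \<Rightarrow> complex)) set \<Rightarrow> 'a function_space" where
  "fraction_space X F =
     \<lparr> zariski = topology_generated_by {{x \<in> X. q x \<noteq> 0} |p q. (p, q) \<in> F},
       regular = (\<lambda>U. {h. \<forall>x \<in> U. \<exists>(p, q) \<in> F. q x \<noteq> 0 \<and>
                          (\<forall>y \<in> U. q y \<noteq> 0 \<longrightarrow> h y = p y / q y)}) \<rparr>"

text \<open>The induced structure on a (locally closed) subset \<open>S\<close>: regular functions are those which
  locally extend to regular functions on open subsets of the ambient space.\<close>

definition subvariety :: "'a function_space \<Rightarrow> 'a set \<Rightarrow> 'a function_space" where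
  "subvariety X S =
     \<lparr> zariski = subtopology (zariski X) S,
       regular = (\<lambda>U. {h. \<forall>x \<in> U. \<exists>W g. openin (zariski X) W \<and> x \<in> W \<and> g \<in> regular X W \<and>
                          (\<forall>y \<in> U \<inter> W. h y = g y)}) \<rparr>"

text \<open>
  The product of varieties.  \<open>tensor_functions X Y U V\<close> is the image of
  \<open>regular X U \<otimes> regular Y V\<close> in the functions on \<open>U \<times> V\<close>.  The topology is generated by the
  nonvanishing loci of such functions (it is finer than the product topology), and regular functions
  are locally their quotients.
\<close>

definition tensor_functions ::
    "'a function_space \<Rightarrow> 'b function_space \<Rightarrow> 'a set \<Rightarrow> 'b set \<Rightarrow> ('a \<times> 'b \<Rightarrow> complex) set" where
  "tensor_functions X Y U V =
     {(\<lambda>(x, y). \<Sum>r<m. a r x * b r y) |(m::nat) a b.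
        \<forall>r<m. a r \<in> regular X U \<and> b r \<in> regular Y V}"

definition product_variety ::
    "'a function_space \<Rightarrow> 'b function_space \<Rightarrow> ('a \<times> 'b) function_space" (infixr "\<times>\<^sub>v" 80) where
  "X \<times>\<^sub>v Y =
     \<lparr> zariski = topology_generated_by
         {{z \<in> U \<times> V. q z \<noteq> 0} |U V q.
            openin (zariski X) U \<and> openin (zariski Y) V \<and> q \<in> tensor_functions X Y U V},
       regular = (\<lambda>W. {h. \<forall>z \<in> W. \<exists>U V. openin (zariski X) U \<and> openin (zariski Y) V \<and>
          z \<in> U \<times> V \<and>
          (\<exists>p \<in> tensor_functions X Y U V. \<exists>q \<in> tensor_functions X Y U V. q z \<noteq> 0 \<and>
             (\<forall>w \<in> W \<inter> U \<times> V. q w \<noteq> 0 \<longrightarrow> h w = p w / q w))}) \<rparr>"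

definition affine_line :: "complex function_space" where
  "affine_line = fraction_space UNIV {(poly p, poly q) |p q. True}"

definition punctured_line :: "complex function_space" where
  "punctured_line = subvariety affine_line (UNIV - {0})"

section \<open>The Grassmannian\<close>

text \<open>Elements of \<open>[n]\<close> are integers, so that affine permutations act on the same type.\<close>

definition ksubsets :: "nat \<Rightarrow> nat \<Rightarrow> int set set" where
  "ksubsets k n = {J. J \<subseteq> {1..int n} \<and> card J = k}"

definition grassmannian :: "nat \<Rightarrow> nat \<Rightarrow> complex vec set set" where
  "grassmannian k n =
     {V. VectorSpace.subspace class_ring V (module_vec TYPE(complex) n) \<and>
         vectorspace.dim class_ring ((module_vec TYPE(complex) n)\<lparr>carrier := V\<rparr>) = k}"

definition minor :: "complex mat \<Rightarrow> int set \<Rightarrow> complex" where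
  "minor A J = det (submatrix A UNIV ((\<lambda>j. nat (j - 1)) ` J))"  \<comment> \<open>columns are 0-based in \<open>mat\<close>\<close>

text \<open>
  Pluecker coordinates of a subspace are defined up to a common nonzero factor.  One matrix with the
  given row span is chosen for each subspace; every notion below only uses homogeneous expressions
  and hence does not depend on the choice.
\<close>

definition representative :: "nat \<Rightarrow> nat \<Rightarrow> complex vec set \<Rightarrow> complex mat" where
  "representative k n V = (SOME A. A \<in> carrier_mat k n \<and> vec_space.row_space n A = V)"

definition plucker :: "nat \<Rightarrow> nat \<Rightarrow> int set \<Rightarrow> complex vec set \<Rightarrow> complex" where
  "plucker k n J V = minor (representative k n V) J"

text \<open>\<open>plucker_form k n d P\<close>: \<open>P\<close> is a homogeneous polynomial of degree \<open>d\<close> in the Pluecker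
  coordinates.\<close>

inductive plucker_form :: "nat \<Rightarrow> nat \<Rightarrow> nat \<Rightarrow> (complex vec set \<Rightarrow> complex) \<Rightarrow> bool"
  for k n where
  const: "plucker_form k n 0 (\<lambda>_. c)"
| coord: "J \<in> ksubsets k n \<Longrightarrow> plucker_form k n 1 (plucker k n J)"
| add: "plucker_form k n d P \<Longrightarrow> plucker_form k n d Q \<Longrightarrow> plucker_form k n d (\<lambda>V. P V + Q V)"
| mult: "plucker_form k n d P \<Longrightarrow> plucker_form k n e Q \<Longrightarrow>
    plucker_form k n (d + e) (\<lambda>V. P V * Q V)"

definition Gr :: "nat \<Rightarrow> nat \<Rightarrow> complex vec set function_space" where
  "Gr k n = fraction_space (grassmannian k n)
     {(P, Q). \<exists>d. plucker_form k n d P \<and> plucker_form k n d Q}"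

section \<open>Bounded affine permutations\<close>

definition affine_permutation :: "nat \<Rightarrow> (int \<Rightarrow> int) \<Rightarrow> bool" where
  "affine_permutation n f \<longleftrightarrow> bij f \<and> (\<forall>a. f (a + int n) = f a + int n)"

definition bounded_affine :: "nat \<Rightarrow> nat \<Rightarrow> (int \<Rightarrow> int) set" where
  "bounded_affine k n =
     {f. affine_permutation n f \<and>
         real_of_int (\<Sum>a = 1..int n. f a - a) / real n = real k \<and>
         (\<forall>a. a \<le> f a \<and> f a \<le> a + int n)}"

text \<open>The product is read from left to right.\<close>

definition aff_mult :: "(int \<Rightarrow> int) \<Rightarrow> (int \<Rightarrow> int) \<Rightarrow> int \<Rightarrow> int" (infixl "\<odot>\<^sub>a" 70) where
  "f \<odot>\<^sub>a g = (\<lambda>a. g (f a))"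

definition aff_length :: "nat \<Rightarrow> (int \<Rightarrow> int) \<Rightarrow> nat" where
  "aff_length n f = card {(a, b). a \<in> {1..int n} \<and> a < b \<and> f a > f b}"

definition simple_refl :: "nat \<Rightarrow> int \<Rightarrow> int \<Rightarrow> int" where
  "simple_refl n i a =
     (if a mod int n = i mod int n then a + 1
      else if a mod int n = (i + 1) mod int n then a - 1
      else a)"

definition residue :: "nat \<Rightarrow> int \<Rightarrow> int" where  \<comment> \<open>the representative in \<open>{1..n}\<close>\<close>
  "residue n a = (a - 1) mod int n + 1"

definition refl_set :: "nat \<Rightarrow> int \<Rightarrow> int set \<Rightarrow> int set" where
  "refl_set n i I = (\<lambda>a. residue n (simple_refl n i a)) ` I"

section \<open>Open positroid varieties\<close>

definition necklace :: "nat \<Rightarrow> (int \<Rightarrow> int) \<Rightarrow> int \<Rightarrow> int set" where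
  "necklace n f j = residue n ` {f a |a. a < j \<and> f a \<ge> j}"

text \<open>\<open>cyc_pos n j a\<close> is the position, counted from 0, of \<open>a\<close> in \<open>j <\<^sub>j j + 1 <\<^sub>j \<dots> <\<^sub>j j - 1\<close>.\<close>

definition cyc_pos :: "nat \<Rightarrow> int \<Rightarrow> int \<Rightarrow> int" where
  "cyc_pos n j a = (a - j) mod int n"

definition cyc_le :: "nat \<Rightarrow> int \<Rightarrow> int \<Rightarrow> int \<Rightarrow> bool" where
  "cyc_le n j a b \<longleftrightarrow> cyc_pos n j a \<le> cyc_pos n j b"

definition gale_le :: "nat \<Rightarrow> int \<Rightarrow> int set \<Rightarrow> int set \<Rightarrow> bool" where
  "gale_le n j I J \<longleftrightarrow>
     list_all2 (cyc_le n j)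
       (sorted_key_list_of_set (cyc_pos n j) I) (sorted_key_list_of_set (cyc_pos n j) J)"

definition positroid :: "nat \<Rightarrow> nat \<Rightarrow> (int \<Rightarrow> int) \<Rightarrow> int set set" where
  "positroid k n f =
     {J \<in> ksubsets k n. \<forall>j \<in> {1..int n}. gale_le n j (necklace n f j) J}"

definition open_positroid :: "nat \<Rightarrow> nat \<Rightarrow> (int \<Rightarrow> int) \<Rightarrow> complex vec set set" where
  "open_positroid k n f =
     {V \<in> grassmannian k n.
        (\<forall>J \<in> ksubsets k n - positroid k n f. plucker k n J V = 0) \<and>
        (\<forall>j \<in> {1..int n}. plucker k n (necklace n f j) V \<noteq> 0)}"

definition open_positroid_chart ::
    "nat \<Rightarrow> nat \<Rightarrow> (int \<Rightarrow> int) \<Rightarrow> int set \<Rightarrow> complex vec set set" where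
  "open_positroid_chart k n f I = {V \<in> open_positroid k n f. plucker k n I V \<noteq> 0}"

end

theory Submission
  imports Defs "HOL-Library.Function_Algebras"
begin

text \<open>
  Let \<open>v\<^sub>a\<close> be the columns of a matrix representing a point of the Grassmannian, repeated \<open>n\<close>-periodically.
  The point lies in the open positroid variety of \<open>f\<close> iff for every \<open>b\<close> the largest \<open>j \<le> b\<close> such that
  \<open>v\<^sub>b\<close> is in the span of \<open>v\<^sub>j, \<dots>, v\<^bsub>b-1\<^esub>\<close> is the preimage of \<open>b\<close> under \<open>f\<close>.  The length condition gives
  \<open>f i < f (i + 1)\<close> and the same for the inverse of \<open>f\<close>.  Hence there is a unique \<open>c\<close> with
  \<open>v\<^sub>i - c v\<^bsub>i+1\<^esub>\<close> in the span of \<open>v\<^bsub>i+2\<^esub>, \<dots>, v\<^bsub>f(i)\<^esub>\<close>, and a unique \<open>d\<close> with \<open>v\<^bsub>i+1\<^esub> - d v\<^sub>i\<close> in the span of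
  the columns from the preimage of \<open>i + 1\<close> up to \<open>i - 1\<close>; both are quotients of Pluecker coordinates.
  Put \<open>w\<^sub>i = v\<^bsub>i+1\<^esub>\<close> and \<open>w\<^bsub>i+1\<^esub> = v\<^sub>i - c v\<^bsub>i+1\<^esub>\<close>.  On the closed locus \<open>d = 0\<close> the columns \<open>w\<close> belong to
  \<open>s\<^sub>i f s\<^sub>i\<close> and \<open>c\<close> is a free parameter.  On the locus \<open>d \<noteq> 0\<close> they belong to \<open>s\<^sub>i f\<close>, where \<open>w\<^bsub>i+1\<^esub>\<close> has
  a coefficient \<open>e\<close> along \<open>w\<^sub>i\<close>, and the free parameter is \<open>c + e = 1 / d\<close>.
\<close>

section \<open>Sheaves of regular functions\<close>

text \<open>On the locus \<open>d = 0\<close> the parameter \<open>c\<close> is free as it stands.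
  On the locus \<open>d \<noteq> 0\<close>, for fixed \<open>w\<close>, it runs over the complex
  numbers without -e, a puncture that moves with \<open>w\<close>. Modulo the columns from the
  preimage of i + 1 up to i - 1, the vector v_i = w_(i+1) + c w_i is congruent to (c + e) w_i = (c +
  e) v_(i+1), and v_(i+1) is congruent to d v_i. Hence (c + e) d = 1, and translating by e puts the
  puncture at 0. The condition on I serves to compare Delta_I with Delta of s_i I: apart from the
  swap, passing from w back to v only adds a multiple of w_i = v_(i+1) to the column at i. If i is
  in I, so is i + 1, and the correction is a determinant with a repeated column. On the algebraic
  side the obstacle is that Pluecker coordinates are read off a matrix chosen arbitrarily for each
  subspace, so a single coordinate need not be a regular function; only quotients of forms of equal
  degree are. The criteria for morphisms therefore allow a common nonzero factor of which nothing
  else is known, and points are studied through any matrix with the right row space.\<close>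

locale function_sheaf =
  fixes X :: "'a function_space"
  assumes const: "openin (zariski X) U \<Longrightarrow> (\<lambda>_. c) \<in> regular X U"
    and add: "openin (zariski X) U \<Longrightarrow> g \<in> regular X U \<Longrightarrow> h \<in> regular X U \<Longrightarrow>
      (\<lambda>x. g x + h x) \<in> regular X U"
    and mult: "openin (zariski X) U \<Longrightarrow> g \<in> regular X U \<Longrightarrow> h \<in> regular X U \<Longrightarrow>
      (\<lambda>x. g x * h x) \<in> regular X U"
    and inverse: "openin (zariski X) U \<Longrightarrow> h \<in> regular X U \<Longrightarrow> (\<And>x. x \<in> U \<Longrightarrow> h x \<noteq> 0) \<Longrightarrow>
      (\<lambda>x. inverse (h x)) \<in> regular X U"
    and open_nonzero: "openin (zariski X) U \<Longrightarrow> h \<in> regular X U \<Longrightarrow>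
      openin (zariski X) {x \<in> U. h x \<noteq> 0}"
    and restrict: "openin (zariski X) U \<Longrightarrow> h \<in> regular X U \<Longrightarrow> openin (zariski X) V \<Longrightarrow> V \<subseteq> U \<Longrightarrow>
      h \<in> regular X V"
    and glue: "openin (zariski X) U \<Longrightarrow>
      (\<And>x. x \<in> U \<Longrightarrow> \<exists>W g. openin (zariski X) W \<and> x \<in> W \<and> g \<in> regular X W \<and>
         (\<forall>y \<in> U \<inter> W. h y = g y)) \<Longrightarrow> h \<in> regular X U"
begin

lemma cong:
  assumes "openin (zariski X) U" "g \<in> regular X U" "\<And>x. x \<in> U \<Longrightarrow> h x = g x"
  shows "h \<in> regular X U"
  by (rule glue[OF assms(1)], rule exI[of _ U], rule exI[of _ g]) (use assms in auto)

lemma minus: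
  assumes "openin (zariski X) U" "g \<in> regular X U" "h \<in> regular X U"
  shows "(\<lambda>x. g x - h x) \<in> regular X U"
  using add[OF assms(1,2) mult[OF assms(1) const[OF assms(1), of "-1"] assms(3)]] by simp

lemma divide:
  assumes "openin (zariski X) U" "g \<in> regular X U" "h \<in> regular X U"
    and "\<And>x. x \<in> U \<Longrightarrow> h x \<noteq> 0"
  shows "(\<lambda>x. g x / h x) \<in> regular X U"
  using mult[OF assms(1,2) inverse[OF assms(1,3,4)]] by (simp add: divide_inverse)

end

text \<open>\<open>fraction_space\<close> and \<open>local_fractions\<close> are compared only over
  subsets of the carrier, so agreement is required on open sets alone. That suffices because every
  axiom of the locale speaks of \<open>regular\<close> on open sets only.\<close>

lemma function_sheaf_transfer:
  assumes "function_sheaf X" "zariski Y = zariski X"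
    and "\<And>U. openin (zariski X) U \<Longrightarrow> regular Y U = regular X U"
  shows "function_sheaf Y"
proof -
  interpret function_sheaf X by fact
  show ?thesis
  proof
    fix U h
    assume U: "openin (zariski Y) U"
      and h: "\<And>x. x \<in> U \<Longrightarrow> \<exists>W g. openin (zariski Y) W \<and> x \<in> W \<and> g \<in> regular Y W \<and>
         (\<forall>y \<in> U \<inter> W. h y = g y)"
    have "h \<in> regular X U"
    proof (rule glue)
      show "openin (zariski X) U" using U assms by simp
      fix x assume "x \<in> U"
      then obtain W g where "openin (zariski Y) W" "x \<in> W" "g \<in> regular Y W"
        "\<forall>y \<in> U \<inter> W. h y = g y" using h by blast
      then show "\<exists>W g. openin (zariski X) W \<and> x \<in> W \<and> g \<in> regular X W \<and>
         (\<forall>y \<in> U \<inter> W. h y = g y)" using assms by auto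
    qed
    then show "h \<in> regular Y U" using U assms by simp
  qed (use assms in \<open>auto intro: const add mult inverse open_nonzero restrict\<close>)
qed

text \<open>A common form of \<open>fraction_space\<close>, where every fraction lives on the whole
  carrier, and of products, where a fraction lives on a box of open sets; hence the domain
  \<open>D\<close> is part of the datum. The sheaf axioms are then checked once for both.\<close>

definition local_fractions ::
    "('a set \<times> ('a \<Rightarrow> complex) \<times> ('a \<Rightarrow> complex)) set \<Rightarrow> 'a function_space" where
  "local_fractions B =
     \<lparr> zariski = topology_generated_by {{x \<in> D. q x \<noteq> 0} |D p q. (D, p, q) \<in> B},
       regular = (\<lambda>U. {h. \<forall>x \<in> U. \<exists>(D, p, q) \<in> B. x \<in> D \<and> q x \<noteq> 0 \<and>
                          (\<forall>y \<in> U \<inter> D. q y \<noteq> 0 \<longrightarrow> h y = p y / q y)}) \<rparr>"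

text \<open>Closure under products makes the nonvanishing loci a base of the topology.
  \<open>swap_in\<close> provides inverses and the openness of the locus of a nonzero numerator;
  \<open>diag_in\<close> yields fractions of value 1, which serve to shrink the domain of another
  fraction.\<close>

locale fraction_system =
  fixes B :: "('a set \<times> ('a \<Rightarrow> complex) \<times> ('a \<Rightarrow> complex)) set" and T :: "'a set"
  assumes const_in: "(T, \<lambda>_. c, \<lambda>_. 1) \<in> B"
    and dom_subset: "(D, p, q) \<in> B \<Longrightarrow> D \<subseteq> T"
    and add_in: "(D, p, q) \<in> B \<Longrightarrow> (D', p', q') \<in> B \<Longrightarrow>
      (D \<inter> D', \<lambda>x. p x * q' x + p' x * q x, \<lambda>x. q x * q' x) \<in> B"
    and mult_in: "(D, p, q) \<in> B \<Longrightarrow> (D', p', q') \<in> B \<Longrightarrow>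
      (D \<inter> D', \<lambda>x. p x * p' x, \<lambda>x. q x * q' x) \<in> B"
    and swap_in: "(D, p, q) \<in> B \<Longrightarrow> (D, q, p) \<in> B"
    and diag_in: "(D, p, q) \<in> B \<Longrightarrow> (D, q, q) \<in> B"
begin

abbreviation "L \<equiv> local_fractions B"

lemma openin_base: "(D, p, q) \<in> B \<Longrightarrow> openin (zariski L) {x \<in> D. q x \<noteq> 0}"
  unfolding local_fractions_def by (auto intro!: topology_generated_by_Basis)

lemma topspace_local_fractions: "topspace (zariski L) = T"
proof -
  have "{x \<in> T. (1::complex) \<noteq> 0} \<in> {{x \<in> D. q x \<noteq> 0} |D p q. (D, p, q) \<in> B}"
    unfolding mem_Collect_eq
    by (rule exI[of _ T], rule exI[of _ "\<lambda>_. 0"], rule exI[of _ "\<lambda>_. 1"]) (simp add: const_in)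
  then have "T \<in> {{x \<in> D. q x \<noteq> 0} |D p q. (D, p, q) \<in> B}" by simp
  then have "T \<subseteq> \<Union>{{x \<in> D. q x \<noteq> 0} |D p q. (D, p, q) \<in> B}" by (rule Union_upper)
  moreover have "\<Union>{{x \<in> D. q x \<noteq> 0} |D p q. (D, p, q) \<in> B} \<subseteq> T" using dom_subset by blast
  ultimately show ?thesis
    unfolding local_fractions_def by (simp only: function_space.simps topology_generated_by_topspace)
qed

lemma base_neighbourhood:
  assumes "openin (zariski L) W" "x \<in> W"
  obtains D p q where "(D, p, q) \<in> B" "x \<in> D" "q x \<noteq> 0" "{y \<in> D. q y \<noteq> 0} \<subseteq> W"
proof -
  have "generate_topology_on {{x \<in> D. q x \<noteq> 0} |D p q. (D, p, q) \<in> B} W"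
    using assms(1) by (simp add: local_fractions_def openin_topology_generated_by_iff)
  then have "x \<in> W \<longrightarrow> (\<exists>D p q. (D, p, q) \<in> B \<and> x \<in> D \<and> q x \<noteq> 0 \<and> {y \<in> D. q y \<noteq> 0} \<subseteq> W)"
  proof induction
    case Empty
    then show ?case by simp
  next
    case (Int a b)
    show ?case
    proof
      assume "x \<in> a \<inter> b"
      then obtain D p q D' p' q' where 1: "(D, p, q) \<in> B" "x \<in> D" "q x \<noteq> 0" "{y \<in> D. q y \<noteq> 0} \<subseteq> a"
        "(D', p', q') \<in> B" "x \<in> D'" "q' x \<noteq> 0" "{y \<in> D'. q' y \<noteq> 0} \<subseteq> b"
        using Int by blast
      have "(D \<inter> D', \<lambda>x. p x * p' x, \<lambda>x. q x * q' x) \<in> B" using mult_in 1 by blast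
      moreover have "{y \<in> D \<inter> D'. q y * q' y \<noteq> 0} \<subseteq> a \<inter> b" using 1 by auto
      ultimately show "\<exists>D p q. (D, p, q) \<in> B \<and> x \<in> D \<and> q x \<noteq> 0 \<and> {y \<in> D. q y \<noteq> 0} \<subseteq> a \<inter> b"
        using 1 by (intro exI conjI) (assumption, auto)
    qed
  next
    case (UN K)
    then show ?case by (meson Sup_upper UnionE subset_trans)
  next
    case (Basis s)
    then show ?case by blast
  qed
  then show ?thesis using assms(2) that by blast
qed

lemma regular_local_fractionsE:
  assumes "h \<in> regular L U" "x \<in> U"
  obtains D p q where "(D, p, q) \<in> B" "x \<in> D" "q x \<noteq> 0"
    "\<forall>y\<in>U \<inter> D. q y \<noteq> 0 \<longrightarrow> h y = p y / q y"
proof -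
  have "\<exists>z\<in>B. case z of (D, p, q) \<Rightarrow> x \<in> D \<and> q x \<noteq> 0 \<and> (\<forall>y\<in>U \<inter> D. q y \<noteq> 0 \<longrightarrow> h y = p y / q y)"
    using assms unfolding local_fractions_def function_space.simps mem_Collect_eq by (rule bspec)
  then obtain z where z: "z \<in> B"
    "case z of (D, p, q) \<Rightarrow> x \<in> D \<and> q x \<noteq> 0 \<and> (\<forall>y\<in>U \<inter> D. q y \<noteq> 0 \<longrightarrow> h y = p y / q y)" ..
  obtain D p q where "z = (D, p, q)" by (cases z)
  then show ?thesis using z that[of D p q] by simp
qed

lemma function_sheaf_local_fractions: "function_sheaf L"
proof
  note reg = local_fractions_def
  {
    fix U c assume U: "openin (zariski L) U"
    then have "U \<subseteq> T" using openin_subset[OF U] topspace_local_fractions by simp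
    then show "(\<lambda>_. c) \<in> regular L U"
      unfolding reg function_space.simps mem_Collect_eq
      by (intro ballI bexI[OF _ const_in[of c]]) auto
  next
    fix U g h
    assume U: "openin (zariski L) U" and g: "g \<in> regular L U" and h: "h \<in> regular L U"
    show "(\<lambda>x. g x + h x) \<in> regular L U"
      unfolding reg function_space.simps mem_Collect_eq
    proof
      fix x assume x: "x \<in> U"
      obtain D p q where 1: "(D, p, q) \<in> B" "x \<in> D" "q x \<noteq> 0"
        "\<forall>y\<in>U \<inter> D. q y \<noteq> 0 \<longrightarrow> g y = p y / q y"
        using regular_local_fractionsE[OF g x] .
      obtain D' p' q' where 2: "(D', p', q') \<in> B" "x \<in> D'" "q' x \<noteq> 0"
        "\<forall>y\<in>U \<inter> D'. q' y \<noteq> 0 \<longrightarrow> h y = p' y / q' y"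
        using regular_local_fractionsE[OF h x] .
      show "\<exists>(D, p, q)\<in>B. x \<in> D \<and> q x \<noteq> 0 \<and> (\<forall>y\<in>U \<inter> D. q y \<noteq> 0 \<longrightarrow> g y + h y = p y / q y)"
        by (rule bexI[OF _ add_in[OF 1(1) 2(1)]]) (use 1 2 in \<open>auto simp: add_frac_eq\<close>)
    qed
    show "(\<lambda>x. g x * h x) \<in> regular L U"
      unfolding reg function_space.simps mem_Collect_eq
    proof
      fix x assume x: "x \<in> U"
      obtain D p q where 1: "(D, p, q) \<in> B" "x \<in> D" "q x \<noteq> 0"
        "\<forall>y\<in>U \<inter> D. q y \<noteq> 0 \<longrightarrow> g y = p y / q y"
        using regular_local_fractionsE[OF g x] .
      obtain D' p' q' where 2: "(D', p', q') \<in> B" "x \<in> D'" "q' x \<noteq> 0"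
        "\<forall>y\<in>U \<inter> D'. q' y \<noteq> 0 \<longrightarrow> h y = p' y / q' y"
        using regular_local_fractionsE[OF h x] .
      show "\<exists>(D, p, q)\<in>B. x \<in> D \<and> q x \<noteq> 0 \<and> (\<forall>y\<in>U \<inter> D. q y \<noteq> 0 \<longrightarrow> g y * h y = p y / q y)"
        by (rule bexI[OF _ mult_in[OF 1(1) 2(1)]]) (use 1 2 in auto)
    qed
  next
    fix U h
    assume U: "openin (zariski L) U" and h: "h \<in> regular L U"
    show "(\<lambda>x. inverse (h x)) \<in> regular L U" if nz: "\<And>x. x \<in> U \<Longrightarrow> h x \<noteq> 0"
      unfolding reg function_space.simps mem_Collect_eq
    proof
      fix x assume x: "x \<in> U"
      then have "x \<in> U" by simp
      then obtain D p q where 1: "(D, p, q) \<in> B" "x \<in> D" "q x \<noteq> 0"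
          "\<forall>y\<in>U \<inter> D. q y \<noteq> 0 \<longrightarrow> h y = p y / q y"
        using regular_local_fractionsE[OF h] by metis
      have p: "p x \<noteq> 0" using 1 x nz[OF x] by auto
      show "\<exists>(D, p, q)\<in>B. x \<in> D \<and> q x \<noteq> 0 \<and> (\<forall>y\<in>U \<inter> D. q y \<noteq> 0 \<longrightarrow> inverse (h y) = p y / q y)"
        \<comment> \<open>The inverse is written q * q / (q * p): the formula for \<open>h\<close>
          is known only where q is nonzero, so q has to stay in the denominator.\<close>
        by (rule bexI[OF _ mult_in[OF diag_in[OF 1(1)] swap_in[OF 1(1)]]])
          (use 1 p in auto)
    qed
    show "openin (zariski L) {x \<in> U. h x \<noteq> 0}"
    proof (subst openin_subopen, intro ballI)
      fix x assume x: "x \<in> {x \<in> U. h x \<noteq> 0}"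
      then have "x \<in> U" by simp
      then obtain D p q where 1: "(D, p, q) \<in> B" "x \<in> D" "q x \<noteq> 0"
          "\<forall>y\<in>U \<inter> D. q y \<noteq> 0 \<longrightarrow> h y = p y / q y"
        using regular_local_fractionsE[OF h] by metis
      show "\<exists>T. openin (zariski L) T \<and> x \<in> T \<and> T \<subseteq> {x \<in> U. h x \<noteq> 0}"
        by (rule exI[of _ "U \<inter> ({x \<in> D. q x \<noteq> 0} \<inter> {x \<in> D. p x \<noteq> 0})"])
          (use x 1 in \<open>auto intro!: openin_Int U openin_base[OF 1(1)] openin_base[OF swap_in[OF 1(1)]]\<close>)
    qed
  next
    fix U V h
    assume h: "h \<in> regular L U" and V: "V \<subseteq> U"
    show "h \<in> regular L V"
      unfolding reg function_space.simps mem_Collect_eq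
    proof
      fix x assume x: "x \<in> V"
      obtain D p q where 1: "(D, p, q) \<in> B" "x \<in> D" "q x \<noteq> 0"
        "\<forall>y\<in>U \<inter> D. q y \<noteq> 0 \<longrightarrow> h y = p y / q y"
        using regular_local_fractionsE[OF h subsetD[OF V x]] .
      then show "\<exists>(D, p, q)\<in>B. x \<in> D \<and> q x \<noteq> 0 \<and> (\<forall>y\<in>V \<inter> D. q y \<noteq> 0 \<longrightarrow> h y = p y / q y)"
        using V by (intro bexI[OF _ 1(1)]) auto
    qed
  next
    fix U h
    assume U: "openin (zariski L) U" and loc: "\<And>x. x \<in> U \<Longrightarrow>
      \<exists>W g. openin (zariski L) W \<and> x \<in> W \<and> g \<in> regular L W \<and> (\<forall>y \<in> U \<inter> W. h y = g y)"
    show "h \<in> regular L U"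
      unfolding reg function_space.simps mem_Collect_eq
    proof
      fix x assume x: "x \<in> U"
      then obtain W g where W: "openin (zariski L) W" "x \<in> W" and g: "g \<in> regular L W"
        "\<forall>y \<in> U \<inter> W. h y = g y" using loc by blast
      obtain D p q where 1: "(D, p, q) \<in> B" "x \<in> D" "q x \<noteq> 0"
          "\<forall>y\<in>W \<inter> D. q y \<noteq> 0 \<longrightarrow> g y = p y / q y"
        using regular_local_fractionsE[OF g(1) W(2)] .
      obtain D' p' q' where 2: "(D', p', q') \<in> B" "x \<in> D'" "q' x \<noteq> 0" "{y \<in> D'. q' y \<noteq> 0} \<subseteq> W"
        using base_neighbourhood[OF W] .
      \<comment> \<open>Multiplying by q' / q' keeps the value and confines the new denominator to
        be nonzero only inside \<open>W\<close>, where \<open>g\<close> is given by p / q and agrees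
        with \<open>h\<close> on \<open>U\<close>.\<close>
      have "w \<in> W" if "w \<in> D'" "q' w \<noteq> 0" for w using 2(4) that by blast
      then show "\<exists>(D, p, q)\<in>B. x \<in> D \<and> q x \<noteq> 0 \<and> (\<forall>y\<in>U \<inter> D. q y \<noteq> 0 \<longrightarrow> h y = p y / q y)"
        using g(2) 1(2-4) 2(2,3) by (intro bexI[OF _ mult_in[OF 1(1) diag_in[OF 2(1)]]]) simp
    qed
  }
qed

end

lemma fraction_space_sheaf:
  assumes "\<And>c. (\<lambda>_. c, \<lambda>_. 1) \<in> F"
    and "\<And>p q p' q'. (p, q) \<in> F \<Longrightarrow> (p', q') \<in> F \<Longrightarrow>
      (\<lambda>x. p x * q' x + p' x * q x, \<lambda>x. q x * q' x) \<in> F \<and> (\<lambda>x. p x * p' x, \<lambda>x. q x * q' x) \<in> F"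
    and "\<And>p q. (p, q) \<in> F \<Longrightarrow> (q, p) \<in> F \<and> (q, q) \<in> F"
  shows "function_sheaf (fraction_space X F)" "topspace (zariski (fraction_space X F)) = X"
proof -
  let ?B = "(\<lambda>(p, q). (X, p, q)) ` F"
  interpret fraction_system ?B X
    by unfold_locales (use assms in \<open>auto simp: image_iff\<close>)
  have z: "zariski (fraction_space X F) = zariski L"
    unfolding fraction_space_def local_fractions_def function_space.simps
    by (rule arg_cong[where f = topology_generated_by]) auto
  show "topspace (zariski (fraction_space X F)) = X"
    unfolding z by (rule topspace_local_fractions)
  show "function_sheaf (fraction_space X F)"
  proof (rule function_sheaf_transfer[OF function_sheaf_local_fractions z])
    fix U assume "openin (zariski L) U"
    then have "U \<subseteq> X" using openin_subset topspace_local_fractions by metis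
    then show "regular (fraction_space X F) U = regular L U"
      unfolding fraction_space_def local_fractions_def function_space.simps
      by (intro Collect_cong ball_cong refl) (simp add: Bex_def split_beta image_iff, blast)
  qed
qed

section \<open>Subvarieties and products\<close>

lemma topspace_subvariety [simp]: "topspace (zariski (subvariety X S)) = topspace (zariski X) \<inter> S"
  by (simp add: subvariety_def)

lemma function_sheaf_subvariety:
  assumes "function_sheaf X"
  shows "function_sheaf (subvariety X S)"
proof -
  interpret function_sheaf X by fact
  let ?Y = "subvariety X S"
  note reg = subvariety_def
  have regE: "\<exists>W g. openin (zariski X) W \<and> x \<in> W \<and> g \<in> regular X W \<and> (\<forall>y \<in> U \<inter> W. h y = g y)"
    if "h \<in> regular ?Y U" "x \<in> U" for h U x using that unfolding reg by simp
  have op: "openin (zariski ?Y) U \<longleftrightarrow> (\<exists>T. openin (zariski X) T \<and> U = T \<inter> S)" for U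
    unfolding reg by (simp add: openin_subtopology)
  show ?thesis
  proof
    fix U c assume U: "openin (zariski ?Y) U"
    then show "(\<lambda>_. c) \<in> regular ?Y U"
      unfolding reg function_space.simps mem_Collect_eq
      by (intro ballI exI[of _ "topspace (zariski X)"] exI[of _ "\<lambda>_. c"])
        (use openin_subset[OF U] in \<open>auto intro: const\<close>)
  next
    fix U g h
    assume U: "openin (zariski ?Y) U" and g: "g \<in> regular ?Y U" and h: "h \<in> regular ?Y U"
    {
      fix x assume x: "x \<in> U"
      obtain W g' where 1: "openin (zariski X) W" "x \<in> W" "g' \<in> regular X W" "\<forall>y \<in> U \<inter> W. g y = g' y"
        using regE[OF g x] by blast
      obtain W' h' where 2: "openin (zariski X) W'" "x \<in> W'" "h' \<in> regular X W'" "\<forall>y \<in> U \<inter> W'. h y = h' y"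
        using regE[OF h x] by blast
      have "\<exists>W g' h'. openin (zariski X) W \<and> x \<in> W \<and> g' \<in> regular X W \<and> h' \<in> regular X W \<and>
        (\<forall>y \<in> U \<inter> W. g y = g' y) \<and> (\<forall>y \<in> U \<inter> W. h y = h' y)"
        by (rule exI[of _ "W \<inter> W'"], rule exI[of _ g'], rule exI[of _ h'])
          (use 1 2 in \<open>auto intro: restrict\<close>)
    } note common = this
    show "(\<lambda>x. g x + h x) \<in> regular ?Y U"
      unfolding reg function_space.simps mem_Collect_eq
    proof
      fix x assume "x \<in> U"
      then obtain W g' h' where 1: "openin (zariski X) W" "x \<in> W" "g' \<in> regular X W" "h' \<in> regular X W"
        "\<forall>y \<in> U \<inter> W. g y = g' y" "\<forall>y \<in> U \<inter> W. h y = h' y" using common by metis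
      show "\<exists>W k. openin (zariski X) W \<and> x \<in> W \<and> k \<in> regular X W \<and> (\<forall>y\<in>U \<inter> W. g y + h y = k y)"
        using 1 add[OF 1(1,3,4)] by (intro exI[of _ W] exI[of _ "\<lambda>x. g' x + h' x"]) auto
    qed
    show "(\<lambda>x. g x * h x) \<in> regular ?Y U"
      unfolding reg function_space.simps mem_Collect_eq
    proof
      fix x assume "x \<in> U"
      then obtain W g' h' where 1: "openin (zariski X) W" "x \<in> W" "g' \<in> regular X W" "h' \<in> regular X W"
        "\<forall>y \<in> U \<inter> W. g y = g' y" "\<forall>y \<in> U \<inter> W. h y = h' y" using common by metis
      show "\<exists>W k. openin (zariski X) W \<and> x \<in> W \<and> k \<in> regular X W \<and> (\<forall>y\<in>U \<inter> W. g y * h y = k y)"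
        using 1 mult[OF 1(1,3,4)] by (intro exI[of _ W] exI[of _ "\<lambda>x. g' x * h' x"]) auto
    qed
  next
    fix U h
    assume U: "openin (zariski ?Y) U" and h: "h \<in> regular ?Y U"
    show "(\<lambda>x. inverse (h x)) \<in> regular ?Y U" if nz: "\<And>x. x \<in> U \<Longrightarrow> h x \<noteq> 0"
      unfolding reg function_space.simps mem_Collect_eq
    proof
      fix x assume x: "x \<in> U"
      obtain W g where 1: "openin (zariski X) W" "x \<in> W" "g \<in> regular X W" "\<forall>y \<in> U \<inter> W. h y = g y"
        using regE[OF h x] by blast
      \<comment> \<open>The extension \<open>g\<close> may vanish at points of \<open>W\<close>
        outside \<open>U\<close>, so \<open>W\<close> is shrunk before inverting.\<close>
      let ?W = "{x \<in> W. g x \<noteq> 0}"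
      have W: "openin (zariski X) ?W" using open_nonzero 1 by blast
      have "(\<lambda>x. inverse (g x)) \<in> regular X ?W"
        by (rule inverse[OF W restrict[OF 1(1,3) W]]) auto
      moreover have "x \<in> ?W" using 1 x nz[OF x] by auto
      ultimately show "\<exists>W k. openin (zariski X) W \<and> x \<in> W \<and> k \<in> regular X W \<and>
          (\<forall>y\<in>U \<inter> W. inverse (h y) = k y)"
        using 1 W by (intro exI[of _ ?W] exI[of _ "\<lambda>x. inverse (g x)"]) auto
    qed
    show "openin (zariski ?Y) {x \<in> U. h x \<noteq> 0}"
    proof (subst openin_subopen, intro ballI)
      fix x assume x: "x \<in> {x \<in> U. h x \<noteq> 0}"
      obtain W g where 1: "openin (zariski X) W" "x \<in> W" "g \<in> regular X W" "\<forall>y \<in> U \<inter> W. h y = g y"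
        using regE[OF h] x by blast
      obtain T where T: "openin (zariski X) T" "U = T \<inter> S" using U op by blast
      have "openin (zariski ?Y) (T \<inter> {x \<in> W. g x \<noteq> 0} \<inter> S)"
        unfolding op using open_nonzero[OF 1(1,3)] T(1) by blast
      then show "\<exists>T. openin (zariski ?Y) T \<and> x \<in> T \<and> T \<subseteq> {x \<in> U. h x \<noteq> 0}"
        using x 1 T by (intro exI[of _ "T \<inter> {x \<in> W. g x \<noteq> 0} \<inter> S"]) auto
    qed
  next
    fix U V h
    assume h: "h \<in> regular ?Y U" and V: "V \<subseteq> U"
    show "h \<in> regular ?Y V"
      unfolding reg function_space.simps mem_Collect_eq
    proof
      fix x assume "x \<in> V"
      then have "x \<in> U" using V by blast
      from regE[OF h this] obtain W g where "openin (zariski X) W" "x \<in> W" "g \<in> regular X W"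
        "\<forall>y \<in> U \<inter> W. h y = g y" by blast
      then show "\<exists>W g. openin (zariski X) W \<and> x \<in> W \<and> g \<in> regular X W \<and> (\<forall>y\<in>V \<inter> W. h y = g y)"
        using V by (intro exI[of _ W] exI[of _ g]) auto
    qed
  next
    fix U h
    assume U: "openin (zariski ?Y) U" and loc: "\<And>x. x \<in> U \<Longrightarrow>
      \<exists>W g. openin (zariski ?Y) W \<and> x \<in> W \<and> g \<in> regular ?Y W \<and> (\<forall>y \<in> U \<inter> W. h y = g y)"
    show "h \<in> regular ?Y U"
      unfolding reg function_space.simps mem_Collect_eq
    proof
      fix x assume x: "x \<in> U"
      then obtain W g where W: "openin (zariski ?Y) W" "x \<in> W" and g: "g \<in> regular ?Y W"
        "\<forall>y \<in> U \<inter> W. h y = g y" using loc by blast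
      obtain W' g' where 1: "openin (zariski X) W'" "x \<in> W'" "g' \<in> regular X W'" "\<forall>y \<in> W \<inter> W'. g y = g' y"
        using regE[OF g(1) W(2)] by blast
      obtain T where T: "openin (zariski X) T" "W = T \<inter> S" using W op by blast
      have US: "U \<subseteq> S" using U op by blast
      \<comment> \<open>\<open>g\<close> lives on the relatively open set \<open>W\<close>. Since
        \<open>U\<close> lies in \<open>S\<close>, its ambient extension \<open>g'\<close> computes
        \<open>h\<close> on all of \<open>U\<close> inside \<open>T \<inter> W'\<close>.\<close>
      have o: "openin (zariski X) (T \<inter> W')" using T 1 by blast
      have r: "g' \<in> regular X (T \<inter> W')" using restrict[OF 1(1,3) o] by blast
      show "\<exists>W k. openin (zariski X) W \<and> x \<in> W \<and> k \<in> regular X W \<and> (\<forall>y\<in>U \<inter> W. h y = k y)"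
        by (rule exI[of _ "T \<inter> W'"], rule exI[of _ g'], use o r US W 1 T g in auto)
    qed
  qed
qed

section \<open>Finite sums of elementary tensors\<close>

context
  fixes X :: "'a function_space" and Y :: "'b function_space"
begin

lemma tensor_zero: "(\<lambda>_. 0) \<in> tensor_functions X Y U V"
  unfolding tensor_functions_def mem_Collect_eq by (rule exI[of _ 0]) auto

lemma tensor_snoc:
  assumes "f \<in> tensor_functions X Y U V" "a \<in> regular X U" "b \<in> regular Y V"
  shows "(\<lambda>z. f z + a (fst z) * b (snd z)) \<in> tensor_functions X Y U V"
proof -
  obtain m :: nat and a' b' where f: "f = (\<lambda>(x, y). \<Sum>r<m. a' r x * b' r y)"
    and r: "\<forall>r<m. a' r \<in> regular X U \<and> b' r \<in> regular Y V"
    using assms(1) unfolding tensor_functions_def by blast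
  have "(\<lambda>z. f z + a (fst z) * b (snd z)) =
      (\<lambda>(x, y). \<Sum>r<Suc m. (a'(m := a)) r x * (b'(m := b)) r y)"
    by (auto simp: f fun_eq_iff)
  moreover have "\<forall>r<Suc m. (a'(m := a)) r \<in> regular X U \<and> (b'(m := b)) r \<in> regular Y V"
    using r assms by (auto simp: less_Suc_eq)
  ultimately show ?thesis unfolding tensor_functions_def by blast
qed

text \<open>Induction on the number of summands; closure under sums, products and restriction then
  needs no handling of index sets.\<close>

lemma tensor_induct [consumes 1, case_names zero snoc]:
  assumes "f \<in> tensor_functions X Y U V"
    and zero: "P (\<lambda>_. 0)"
    and snoc: "\<And>f a b. f \<in> tensor_functions X Y U V \<Longrightarrow> P f \<Longrightarrow> a \<in> regular X U \<Longrightarrow>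
      b \<in> regular Y V \<Longrightarrow> P (\<lambda>z. f z + a (fst z) * b (snd z))"
  shows "P f"
proof -
  obtain m :: nat and a b where f: "f = (\<lambda>(x, y). \<Sum>r<m. a r x * b r y)"
    and r: "\<forall>r<m. a r \<in> regular X U \<and> b r \<in> regular Y V"
    using assms(1) unfolding tensor_functions_def by blast
  have "l \<le> m \<Longrightarrow> P (\<lambda>(x, y). \<Sum>r<l. a r x * b r y)" for l
  proof (induction l)
    case 0
    then show ?case using zero by (simp add: case_prod_unfold)
  next
    case (Suc l)
    have "(\<lambda>(x, y). \<Sum>r<l. a r x * b r y) \<in> tensor_functions X Y U V"
      unfolding tensor_functions_def mem_Collect_eq
      by (rule exI[of _ l], rule exI[of _ a], rule exI[of _ b]) (use r Suc.prems in auto)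
    from snoc[OF this Suc.IH, of "a l" "b l"] show ?case
      using r Suc.prems by (simp add: case_prod_unfold)
  qed
  then show ?thesis unfolding f by blast
qed

lemma tensor_elementary:
  assumes "a \<in> regular X U" "b \<in> regular Y V"
  shows "(\<lambda>z. a (fst z) * b (snd z)) \<in> tensor_functions X Y U V"
  using tensor_snoc[OF tensor_zero assms] by simp

lemma tensor_add:
  assumes "f \<in> tensor_functions X Y U V" "g \<in> tensor_functions X Y U V"
  shows "(\<lambda>z. f z + g z) \<in> tensor_functions X Y U V"
  using assms(2)
proof (induction rule: tensor_induct)
  case zero
  then show ?case using assms by simp
next
  case (snoc g a b)
  show ?case using tensor_snoc[OF snoc.IH snoc.hyps(2,3)] by (simp add: add.assoc)
qed

end

locale sheaf_pair = X: function_sheaf X + Y: function_sheaf Y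
  for X :: "'a function_space" and Y :: "'b function_space"
begin

lemma tensor_mult:
  assumes U: "openin (zariski X) U" and V: "openin (zariski Y) V"
    and f: "f \<in> tensor_functions X Y U V" and g: "g \<in> tensor_functions X Y U V"
  shows "(\<lambda>z. f z * g z) \<in> tensor_functions X Y U V"
  using f
proof (induction rule: tensor_induct)
  case zero
  then show ?case by (simp add: tensor_zero)
next
  case (snoc f a b)
  have "(\<lambda>z. a (fst z) * b (snd z) * g z) \<in> tensor_functions X Y U V"
    using g
  proof (induction rule: tensor_induct)
    case zero
    then show ?case by (simp add: tensor_zero)
  next
    case (snoc g a' b')
    have "(\<lambda>z. a (fst z) * b (snd z) * g z + a (fst z) * a' (fst z) * (b (snd z) * b' (snd z)))
        \<in> tensor_functions X Y U V"
      using snoc \<open>a \<in> _\<close> \<open>b \<in> _\<close> by (intro tensor_snoc X.mult Y.mult U V)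
    then show ?case by (simp add: algebra_simps)
  qed
  from tensor_add[OF snoc.IH this] show ?case by (simp add: algebra_simps)
qed

lemma tensor_restrict:
  assumes "openin (zariski X) U" "openin (zariski Y) V" "openin (zariski X) U'" "openin (zariski Y) V'"
    and "U' \<subseteq> U" "V' \<subseteq> V" "f \<in> tensor_functions X Y U V"
  shows "f \<in> tensor_functions X Y U' V'"
  using assms(7)
  by (induction rule: tensor_induct)
    (use assms in \<open>auto intro!: tensor_zero tensor_snoc intro: X.restrict Y.restrict\<close>)

lemma tensor_const:
  assumes "openin (zariski X) U" "openin (zariski Y) V"
  shows "(\<lambda>_. c) \<in> tensor_functions X Y U V"
  using tensor_elementary[OF X.const[OF assms(1), of c] Y.const[OF assms(2), of 1]] by simp

text \<open>Presents the product as \<open>local_fractions\<close>: boxes intersect in boxes and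
  tensor functions restrict to smaller boxes, which gives the closure conditions of
  \<open>fraction_system\<close>.\<close>

definition "fractions = {(U \<times> V, p, q) |U V p q. openin (zariski X) U \<and> openin (zariski Y) V \<and>
  p \<in> tensor_functions X Y U V \<and> q \<in> tensor_functions X Y U V}"

lemma fractionsI:
  assumes "openin (zariski X) U" "openin (zariski Y) V"
    and "p \<in> tensor_functions X Y U V" "q \<in> tensor_functions X Y U V"
  shows "(U \<times> V, p, q) \<in> fractions"
  unfolding fractions_def using assms by blast

lemma fractionsE:
  assumes "(D, p, q) \<in> fractions"
  obtains U V where "D = U \<times> V" "openin (zariski X) U" "openin (zariski Y) V"
    "p \<in> tensor_functions X Y U V" "q \<in> tensor_functions X Y U V"
  using assms unfolding fractions_def by blast

lemma product_variety_fractions: "X \<times>\<^sub>v Y = local_fractions fractions"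
proof -
  have 1: "{{z \<in> U \<times> V. q z \<noteq> 0} |U V q.
      openin (zariski X) U \<and> openin (zariski Y) V \<and> q \<in> tensor_functions X Y U V} =
    {{z \<in> D. q z \<noteq> 0} |D p q. (D, p, q) \<in> fractions}" (is "?l = ?r")
  proof (intro equalityI subsetI)
    fix S assume "S \<in> ?l"
    then obtain U V q where "S = {z \<in> U \<times> V. q z \<noteq> 0}" "openin (zariski X) U"
      "openin (zariski Y) V" "q \<in> tensor_functions X Y U V" by blast
    then show "S \<in> ?r" using fractionsI[of U V q q] by blast
  next
    fix S assume "S \<in> ?r"
    then obtain D p q where S: "S = {z \<in> D. q z \<noteq> 0}" "(D, p, q) \<in> fractions" by blast
    from S(2) show "S \<in> ?l" by (rule fractionsE) (use S in blast)
  qed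
  have 2: "(\<exists>U V. openin (zariski X) U \<and> openin (zariski Y) V \<and> z \<in> U \<times> V \<and>
          (\<exists>p \<in> tensor_functions X Y U V. \<exists>q \<in> tensor_functions X Y U V. q z \<noteq> 0 \<and>
             (\<forall>w \<in> W \<inter> U \<times> V. q w \<noteq> 0 \<longrightarrow> h w = p w / q w))) \<longleftrightarrow>
    (\<exists>(D, p, q) \<in> fractions. z \<in> D \<and> q z \<noteq> 0 \<and> (\<forall>w \<in> W \<inter> D. q w \<noteq> 0 \<longrightarrow> h w = p w / q w))"
    (is "?l \<longleftrightarrow> ?r") for z W h
  proof
    assume ?l
    then obtain U V p q where 1: "openin (zariski X) U" "openin (zariski Y) V" "z \<in> U \<times> V"
      "p \<in> tensor_functions X Y U V" "q \<in> tensor_functions X Y U V" "q z \<noteq> 0"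
      "\<forall>w \<in> W \<inter> U \<times> V. q w \<noteq> 0 \<longrightarrow> h w = p w / q w" by blast
    show ?r by (rule bexI[OF _ fractionsI[OF 1(1,2,4,5)]]) (use 1 in blast)
  next
    assume ?r
    then obtain D p q where 1: "(D, p, q) \<in> fractions" "z \<in> D" "q z \<noteq> 0"
      "\<forall>w \<in> W \<inter> D. q w \<noteq> 0 \<longrightarrow> h w = p w / q w" by blast
    from 1(1) show ?l
      by (rule fractionsE) (use 1 in blast)
  qed
  show ?thesis unfolding product_variety_def local_fractions_def 1 2 ..
qed

sublocale frac: fraction_system fractions "topspace (zariski X) \<times> topspace (zariski Y)"
proof
  fix c show "(topspace (zariski X) \<times> topspace (zariski Y), \<lambda>_. c, \<lambda>_. 1) \<in> fractions"
    by (intro fractionsI tensor_const) auto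
next
  fix D p q assume "(D, p, q) \<in> fractions"
  then obtain U V where 1: "D = U \<times> V" "openin (zariski X) U" "openin (zariski Y) V"
    "p \<in> tensor_functions X Y U V" "q \<in> tensor_functions X Y U V" by (rule fractionsE)
  show "D \<subseteq> topspace (zariski X) \<times> topspace (zariski Y)"
    using openin_subset[OF 1(2)] openin_subset[OF 1(3)] 1(1) by auto
  show "(D, q, p) \<in> fractions" "(D, q, q) \<in> fractions" unfolding 1(1) using 1 by (auto intro: fractionsI)
  fix D' p' q' assume "(D', p', q') \<in> fractions"
  then obtain U' V' where 2: "D' = U' \<times> V'" "openin (zariski X) U'" "openin (zariski Y) V'"
    "p' \<in> tensor_functions X Y U' V'" "q' \<in> tensor_functions X Y U' V'" by (rule fractionsE)
  have D: "D \<inter> D' = (U \<inter> U') \<times> (V \<inter> V')" unfolding 1 2 by auto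
  have o: "openin (zariski X) (U \<inter> U')" "openin (zariski Y) (V \<inter> V')" using 1 2 by auto
  have r: "p \<in> tensor_functions X Y (U \<inter> U') (V \<inter> V')" "q \<in> tensor_functions X Y (U \<inter> U') (V \<inter> V')"
    "p' \<in> tensor_functions X Y (U \<inter> U') (V \<inter> V')" "q' \<in> tensor_functions X Y (U \<inter> U') (V \<inter> V')"
    using tensor_restrict[OF 1(2,3) o] tensor_restrict[OF 2(2,3) o] 1 2 by auto
  show "(D \<inter> D', \<lambda>x. p x * q' x + p' x * q x, \<lambda>x. q x * q' x) \<in> fractions"
    "(D \<inter> D', \<lambda>x. p x * p' x, \<lambda>x. q x * q' x) \<in> fractions"
    unfolding D by (intro fractionsI o tensor_add tensor_mult r)+
qed

lemma function_sheaf_product: "function_sheaf (X \<times>\<^sub>v Y)"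
  unfolding product_variety_fractions by (rule frac.function_sheaf_local_fractions)

lemma topspace_product [simp]:
  "topspace (zariski (X \<times>\<^sub>v Y)) = topspace (zariski X) \<times> topspace (zariski Y)"
  unfolding product_variety_fractions by (rule frac.topspace_local_fractions)

lemma regular_product_tensor:
  assumes "openin (zariski X) U" "openin (zariski Y) V" "f \<in> tensor_functions X Y U V"
  shows "f \<in> regular (X \<times>\<^sub>v Y) (U \<times> V)"
  unfolding product_variety_fractions local_fractions_def function_space.simps mem_Collect_eq
  by (intro ballI bexI[OF _ fractionsI[OF assms tensor_const[OF assms(1,2), of 1]]]) auto

lemma regular_product_fst:
  assumes "h \<in> regular X (topspace (zariski X))"
  shows "(\<lambda>z. h (fst z)) \<in> regular (X \<times>\<^sub>v Y) (topspace (zariski (X \<times>\<^sub>v Y)))"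
  using regular_product_tensor[OF _ _ tensor_elementary[OF assms Y.const, of _ 1]]
  by simp

lemma regular_product_snd:
  assumes "h \<in> regular Y (topspace (zariski Y))"
  shows "(\<lambda>z. h (snd z)) \<in> regular (X \<times>\<^sub>v Y) (topspace (zariski (X \<times>\<^sub>v Y)))"
  using regular_product_tensor[OF _ _ tensor_elementary[OF X.const assms, of _ 1]]
  by simp

end

section \<open>Constructing morphisms\<close>

context function_sheaf
begin

text \<open>A tensor function pulls back to a finite sum of products of regular functions. Openness
  of preimages and regularity of quotients both follow from this.\<close>

lemma morphism_pair:
  assumes "function_sheaf Y" "function_sheaf Z" and \<phi>: "morphism X Y \<phi>" and \<psi>: "morphism X Z \<psi>"
  shows "morphism X (Y \<times>\<^sub>v Z) (\<lambda>x. (\<phi> x, \<psi> x))"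
proof -
  interpret P: sheaf_pair Y Z using assms(1,2) by (simp add: sheaf_pair_def)
  let ?T = "topspace (zariski X)" and ?\<theta> = "\<lambda>x. (\<phi> x, \<psi> x)"
  have c: "continuous_map (zariski X) (zariski Y) \<phi>" "continuous_map (zariski X) (zariski Z) \<psi>"
    using \<phi> \<psi> unfolding morphism_def by auto
  have pull: "openin (zariski X) {x \<in> ?T. ?\<theta> x \<in> U \<times> V}"
      "(\<lambda>x. q (?\<theta> x)) \<in> regular X {x \<in> ?T. ?\<theta> x \<in> U \<times> V}"
    if U: "openin (zariski Y) U" and V: "openin (zariski Z) V" and q: "q \<in> tensor_functions Y Z U V"
    for U V q
  proof -
    have o: "openin (zariski X) {x \<in> ?T. \<phi> x \<in> U}" "openin (zariski X) {x \<in> ?T. \<psi> x \<in> V}"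
      using c U V by (auto intro: openin_continuous_map_preimage)
    have "{x \<in> ?T. ?\<theta> x \<in> U \<times> V} = {x \<in> ?T. \<phi> x \<in> U} \<inter> {x \<in> ?T. \<psi> x \<in> V}" by auto
    then show o': "openin (zariski X) {x \<in> ?T. ?\<theta> x \<in> U \<times> V}" using o by auto
    from q show "(\<lambda>x. q (?\<theta> x)) \<in> regular X {x \<in> ?T. ?\<theta> x \<in> U \<times> V}"
    proof (induction rule: tensor_induct)
      case zero
      then show ?case using const[OF o'] by simp
    next
      case (snoc f a b)
      have "(a \<circ> \<phi>) \<in> regular X {x \<in> ?T. \<phi> x \<in> U}" "(b \<circ> \<psi>) \<in> regular X {x \<in> ?T. \<psi> x \<in> V}"
        using \<phi> \<psi> snoc U V unfolding morphism_def by blast+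
      then have "(a \<circ> \<phi>) \<in> regular X {x \<in> ?T. ?\<theta> x \<in> U \<times> V}"
        "(b \<circ> \<psi>) \<in> regular X {x \<in> ?T. ?\<theta> x \<in> U \<times> V}"
        using restrict[OF o(1) _ o'] restrict[OF o(2) _ o'] by auto
      from add[OF o' snoc.IH mult[OF o' this]] show ?case by simp
    qed
  qed
  have "continuous_map (zariski X) (zariski (Y \<times>\<^sub>v Z)) ?\<theta>"
    unfolding product_variety_def function_space.simps
  proof (rule continuous_on_generated_topo)
    fix S assume "S \<in> {{z \<in> U \<times> V. q z \<noteq> 0} |U V q.
            openin (zariski Y) U \<and> openin (zariski Z) V \<and> q \<in> tensor_functions Y Z U V}"
    then obtain U V q where S: "S = {z \<in> U \<times> V. q z \<noteq> 0}"
      and 1: "openin (zariski Y) U" "openin (zariski Z) V" "q \<in> tensor_functions Y Z U V" by blast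
    have "?\<theta> -` S \<inter> ?T = {x \<in> {x \<in> ?T. ?\<theta> x \<in> U \<times> V}. q (?\<theta> x) \<noteq> 0}"
      unfolding S by auto
    then show "openin (zariski X) (?\<theta> -` S \<inter> ?T)" using open_nonzero[OF pull[OF 1]] by simp
  next
    have "?\<theta> ` ?T \<subseteq> topspace (zariski (Y \<times>\<^sub>v Z))"
      using c by (auto simp: continuous_map_def)
    then show "?\<theta> ` ?T \<subseteq> \<Union>{{z \<in> U \<times> V. q z \<noteq> 0} |U V q.
            openin (zariski Y) U \<and> openin (zariski Z) V \<and> q \<in> tensor_functions Y Z U V}"
      unfolding product_variety_def function_space.simps topology_generated_by_topspace .
  qed
  moreover have "h \<circ> ?\<theta> \<in> regular X {x \<in> ?T. ?\<theta> x \<in> W}"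
    if W: "openin (zariski (Y \<times>\<^sub>v Z)) W" and h: "h \<in> regular (Y \<times>\<^sub>v Z) W" for W h
  proof (rule glue)
    show "openin (zariski X) {x \<in> ?T. ?\<theta> x \<in> W}"
      using calculation W by (rule openin_continuous_map_preimage)
    fix x assume x: "x \<in> {x \<in> ?T. ?\<theta> x \<in> W}"
    obtain D p q where 1: "(D, p, q) \<in> P.fractions" "?\<theta> x \<in> D" "q (?\<theta> x) \<noteq> 0"
      "\<forall>y\<in>W \<inter> D. q y \<noteq> 0 \<longrightarrow> h y = p y / q y"
      using P.frac.regular_local_fractionsE[of h W "?\<theta> x"] h x
      unfolding P.product_variety_fractions by blast
    obtain U V where 2: "D = U \<times> V" "openin (zariski Y) U" "openin (zariski Z) V"
      "p \<in> tensor_functions Y Z U V" "q \<in> tensor_functions Y Z U V"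
      using 1(1) by (rule P.fractionsE)
    let ?D = "{x \<in> ?T. ?\<theta> x \<in> U \<times> V}"
    let ?N = "{x \<in> ?D. q (?\<theta> x) \<noteq> 0}"
    have D: "openin (zariski X) ?D" and p: "(\<lambda>x. p (?\<theta> x)) \<in> regular X ?D"
      and q: "(\<lambda>x. q (?\<theta> x)) \<in> regular X ?D" using pull 2 by blast+
    have N: "openin (zariski X) ?N" by (rule open_nonzero[OF D q])
    have "(\<lambda>x. p (?\<theta> x) / q (?\<theta> x)) \<in> regular X ?N"
      by (intro divide N restrict[OF D p N] restrict[OF D q N]) auto
    then show "\<exists>N g. openin (zariski X) N \<and> x \<in> N \<and> g \<in> regular X N \<and>
        (\<forall>y \<in> {x \<in> ?T. ?\<theta> x \<in> W} \<inter> N. (h \<circ> ?\<theta>) y = g y)"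
      using N 1 2(1) x by (intro exI[of _ ?N] exI[of _ "\<lambda>x. p (?\<theta> x) / q (?\<theta> x)"]) auto
  qed
  ultimately show ?thesis unfolding morphism_def by blast
qed

lemma morphism_into_subvariety:
  assumes "function_sheaf Y" "morphism X Y \<phi>" "\<phi> ` topspace (zariski X) \<subseteq> S"
  shows "morphism X (subvariety Y S) \<phi>"
proof -
  let ?T = "topspace (zariski X)"
  have c: "continuous_map (zariski X) (zariski Y) \<phi>" using assms unfolding morphism_def by blast
  then have c': "continuous_map (zariski X) (zariski (subvariety Y S)) \<phi>"
    using assms by (auto simp: subvariety_def continuous_map_in_subtopology)
  moreover have "h \<circ> \<phi> \<in> regular X {x \<in> ?T. \<phi> x \<in> W}"
    if W: "openin (zariski (subvariety Y S)) W" and h: "h \<in> regular (subvariety Y S) W" for W h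
  proof (rule glue)
    show "openin (zariski X) {x \<in> ?T. \<phi> x \<in> W}"
      using c' W by (rule openin_continuous_map_preimage)
    fix x assume x: "x \<in> {x \<in> ?T. \<phi> x \<in> W}"
    then have xW: "\<phi> x \<in> W" by simp
    have "\<forall>x \<in> W. \<exists>V g. openin (zariski Y) V \<and> x \<in> V \<and> g \<in> regular Y V \<and> (\<forall>y \<in> W \<inter> V. h y = g y)"
      using h unfolding subvariety_def by simp
    then obtain V g where V: "openin (zariski Y) V" "\<phi> x \<in> V" "g \<in> regular Y V"
      "\<forall>y \<in> W \<inter> V. h y = g y" using xW by meson
    have "openin (zariski X) {x \<in> ?T. \<phi> x \<in> V}"
      using c V(1) by (rule openin_continuous_map_preimage)
    moreover have "g \<circ> \<phi> \<in> regular X {x \<in> ?T. \<phi> x \<in> V}"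
      using assms(2) V unfolding morphism_def by blast
    ultimately show "\<exists>N k. openin (zariski X) N \<and> x \<in> N \<and> k \<in> regular X N \<and>
        (\<forall>y \<in> {x \<in> ?T. \<phi> x \<in> W} \<inter> N. (h \<circ> \<phi>) y = k y)"
      using x V by (intro exI[of _ "{x \<in> ?T. \<phi> x \<in> V}"] exI[of _ "g \<circ> \<phi>"]) auto
  qed
  ultimately show ?thesis unfolding morphism_def by blast
qed

text \<open>The factor \<open>l\<close> is an arbitrary nonvanishing function: it multiplies
  numerator and denominator alike and changes neither their quotient nor the locus where the
  denominator is nonzero. It absorbs the arbitrary choice of a matrix for each subspace.\<close>

lemma morphism_into_fraction_space:
  fixes \<psi> :: "'a \<Rightarrow> 'b"
  assumes im: "\<psi> ` topspace (zariski X) \<subseteq> Y"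
    and one: "(\<lambda>_. 1, \<lambda>_. 1) \<in> F"
    and lift: "\<And>p q. (p, q) \<in> F \<Longrightarrow> \<exists>l P Q. P \<in> regular X (topspace (zariski X)) \<and>
      Q \<in> regular X (topspace (zariski X)) \<and>
      (\<forall>x \<in> topspace (zariski X). l x \<noteq> 0 \<and> p (\<psi> x) = l x * P x \<and> q (\<psi> x) = l x * Q x)"
  shows "morphism X (fraction_space Y F) \<psi>"
proof -
  let ?T = "topspace (zariski X)"
  have c: "continuous_map (zariski X) (zariski (fraction_space Y F)) \<psi>"
    unfolding fraction_space_def function_space.simps
  proof (rule continuous_on_generated_topo)
    fix S assume "S \<in> {{x \<in> Y. q x \<noteq> 0} |p q. (p, q) \<in> F}"
    then obtain p q where S: "S = {x \<in> Y. q x \<noteq> 0}" and pq: "(p, q) \<in> F" by blast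
    obtain l P Q where 1: "P \<in> regular X ?T" "Q \<in> regular X ?T"
      "\<forall>x \<in> ?T. l x \<noteq> 0 \<and> p (\<psi> x) = l x * P x \<and> q (\<psi> x) = l x * Q x" using lift[OF pq] by blast
    have "\<psi> -` S \<inter> ?T = {x \<in> ?T. Q x \<noteq> 0}" unfolding S using 1(3) im by auto
    then show "openin (zariski X) (\<psi> -` S \<inter> ?T)" using open_nonzero[OF _ 1(2)] by simp
  next
    have "{x \<in> Y. (1::complex) \<noteq> 0} \<in> {{x \<in> Y. q x \<noteq> 0} |p q. (p, q) \<in> F}"
      unfolding mem_Collect_eq
      by (rule exI[of _ "\<lambda>_. 1"], rule exI[of _ "\<lambda>_. 1"]) (simp add: one)
    then have "Y \<in> {{x \<in> Y. q x \<noteq> 0} |p q. (p, q) \<in> F}" by simp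
    then show "\<psi> ` ?T \<subseteq> \<Union>{{x \<in> Y. q x \<noteq> 0} |p q. (p, q) \<in> F}"
      using im by (meson Union_upper order_trans)
  qed
  moreover have "h \<circ> \<psi> \<in> regular X {x \<in> ?T. \<psi> x \<in> W}"
    if W: "openin (zariski (fraction_space Y F)) W" and h: "h \<in> regular (fraction_space Y F) W" for W h
  proof (rule glue)
    show "openin (zariski X) {x \<in> ?T. \<psi> x \<in> W}"
      using c W by (rule openin_continuous_map_preimage)
    fix x assume x: "x \<in> {x \<in> ?T. \<psi> x \<in> W}"
    then have "\<exists>(p, q) \<in> F. q (\<psi> x) \<noteq> 0 \<and> (\<forall>y \<in> W. q y \<noteq> 0 \<longrightarrow> h y = p y / q y)"
      using h unfolding fraction_space_def by simp
    then obtain p q where pq: "(p, q) \<in> F" "q (\<psi> x) \<noteq> 0" "\<forall>y \<in> W. q y \<noteq> 0 \<longrightarrow> h y = p y / q y"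
      by blast
    obtain l P Q where 1: "P \<in> regular X ?T" "Q \<in> regular X ?T"
      "\<forall>x \<in> ?T. l x \<noteq> 0 \<and> p (\<psi> x) = l x * P x \<and> q (\<psi> x) = l x * Q x" using lift[OF pq(1)] by blast
    let ?N = "{x \<in> ?T. Q x \<noteq> 0}"
    have N: "openin (zariski X) ?N" by (rule open_nonzero[OF _ 1(2)]) simp
    have "(\<lambda>x. P x / Q x) \<in> regular X ?N"
      by (intro divide N restrict[OF _ 1(1) N] restrict[OF _ 1(2) N]) auto
    then show "\<exists>N k. openin (zariski X) N \<and> x \<in> N \<and> k \<in> regular X N \<and>
        (\<forall>y \<in> {x \<in> ?T. \<psi> x \<in> W} \<inter> N. (h \<circ> \<psi>) y = k y)"
      using N x pq 1(3) by (intro exI[of _ ?N] exI[of _ "\<lambda>x. P x / Q x"]) auto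
  qed
  ultimately show ?thesis unfolding morphism_def by blast
qed

lemma morphism_affine_line:
  assumes h: "h \<in> regular X (topspace (zariski X))"
  shows "morphism X affine_line h"
proof -
  have *: "(\<lambda>x. poly p (h x)) \<in> regular X (topspace (zariski X))" for p
    by (induction p) (auto intro!: const add mult h)
  show ?thesis unfolding affine_line_def
  proof (rule morphism_into_fraction_space)
    have 1: "(\<lambda>_. 1) = poly (1 :: complex poly)" by (simp add: fun_eq_iff)
    show "(\<lambda>_. 1, \<lambda>_. 1) \<in> {(poly p, poly q) |(p :: complex poly) (q :: complex poly). True}"
      unfolding 1 by blast
    fix p q assume "(p, q) \<in> {(poly p, poly q) |(p :: complex poly) (q :: complex poly). True}"
    then obtain p' q' where "p = poly p'" "q = poly q'" by blast
    then show "\<exists>l P Q. P \<in> regular X (topspace (zariski X)) \<and> Q \<in> regular X (topspace (zariski X)) \<and>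
      (\<forall>x \<in> topspace (zariski X). l x \<noteq> 0 \<and> p (h x) = l x * P x \<and> q (h x) = l x * Q x)"
      using *[of p'] *[of q']
      by (intro exI[of _ "\<lambda>_. 1"] exI[of _ "\<lambda>x. poly p' (h x)"] exI[of _ "\<lambda>x. poly q' (h x)"]) auto
  qed simp
qed

end

lemma regular_subvariety:
  assumes "h \<in> regular X (topspace (zariski X))" "U \<subseteq> topspace (zariski X)"
  shows "h \<in> regular (subvariety X S) U"
  unfolding subvariety_def function_space.simps mem_Collect_eq
  by (intro ballI exI[of _ "topspace (zariski X)"] exI[of _ h]) (use assms in auto)

lemma function_sheaf_affine_line: "function_sheaf affine_line"
  and topspace_affine_line [simp]: "topspace (zariski affine_line) = UNIV"
proof -
  let ?F = "{(poly p, poly q) |(p :: complex poly) (q :: complex poly). True}"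
  have 1: "(\<lambda>_. c, \<lambda>_. 1) \<in> ?F" for c
    unfolding mem_Collect_eq by (rule exI[of _ "[:c:]"], rule exI[of _ 1]) (auto simp: fun_eq_iff)
  have 2: "(\<lambda>x. p x * q' x + p' x * q x, \<lambda>x. q x * q' x) \<in> ?F \<and> (\<lambda>x. p x * p' x, \<lambda>x. q x * q' x) \<in> ?F"
    if pq: "(p, q) \<in> ?F" "(p', q') \<in> ?F" for p q p' q'
  proof -
    obtain P Q P' Q' where *: "p = poly P" "q = poly Q" "p' = poly P'" "q' = poly Q'" using pq by blast
    show ?thesis unfolding mem_Collect_eq *
      by (intro conjI exI[of _ "P * Q' + P' * Q"] exI[of _ "Q * Q'"] exI[of _ "P * P'"])
        (auto simp: fun_eq_iff)
  qed
  have 3: "(q, p) \<in> ?F \<and> (q, q) \<in> ?F" if "(p, q) \<in> ?F" for p q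
    using that by blast
  show "function_sheaf affine_line" "topspace (zariski affine_line) = UNIV"
    unfolding affine_line_def using fraction_space_sheaf[OF 1 2 3] by auto
qed

lemma regular_affine_line_id: "(\<lambda>t. t) \<in> regular affine_line UNIV"
  unfolding affine_line_def fraction_space_def function_space.simps mem_Collect_eq
proof
  fix x :: complex
  have "(poly [:0, 1:], poly 1) \<in> {(poly p, poly q) |(p :: complex poly) (q :: complex poly). True}" by blast
  then show "\<exists>(p, q) \<in> {(poly p, poly q) |p q. True}. q x \<noteq> 0 \<and> (\<forall>y \<in> UNIV. q y \<noteq> 0 \<longrightarrow> y = p y / q y)"
    by (rule bexI[rotated]) simp
qed

section \<open>Periodic vector configurations\<close>

lemma simple_refl_shift: "simple_refl n i (a + int n) = simple_refl n i a + int n"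
  by (simp add: simple_refl_def)

lemma Suc_mod_neq:
  assumes "n \<ge> 2"
  shows "(i + 1) mod int n \<noteq> i mod int n"
proof
  assume "(i + 1) mod int n = i mod int n"
  then have "int n dvd (i + 1) - i" by (simp add: mod_eq_dvd_iff)
  then show False using assms by simp
qed

lemma Suc_Suc_mod_neq:
  assumes "n \<ge> 2"
  shows "(i + 2) mod int n \<noteq> (i + 1) mod int n"
  using Suc_mod_neq[OF assms, of "i + 1"] by (simp add: add.assoc)

lemma simple_refl_i [simp]: "simple_refl n i i = i + 1"
  by (simp add: simple_refl_def)

lemma simple_refl_Suc [simp]: "n \<ge> 2 \<Longrightarrow> simple_refl n i (i + 1) = i"
  using Suc_mod_neq[of n i] by (simp add: simple_refl_def)

lemma simple_refl_other:
  "a mod int n \<noteq> i mod int n \<Longrightarrow> a mod int n \<noteq> (i + 1) mod int n \<Longrightarrow> simple_refl n i a = a"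
  by (simp add: simple_refl_def)

lemma simple_refl_cong_i: "a mod int n = i mod int n \<Longrightarrow> simple_refl n i a = a + 1"
  by (simp add: simple_refl_def)

lemma simple_refl_cong_Suc:
  "n \<ge> 2 \<Longrightarrow> a mod int n = (i + 1) mod int n \<Longrightarrow> simple_refl n i a = a - 1"
  using Suc_mod_neq[of n i] by (simp add: simple_refl_def)

lemma Suc_cong: "a mod int n = i mod int n \<Longrightarrow> (a + 1) mod int n = (i + 1) mod int n"
  by (metis mod_add_left_eq)

lemma pred_cong: "a mod int n = (i + 1) mod int n \<Longrightarrow> (a - 1) mod int n = i mod int n"
  by (metis add_diff_cancel_right' mod_diff_left_eq)

lemma simple_refl_cases:
  assumes "n \<ge> 2"
  obtains (i) "a mod int n = i mod int n" "a mod int n \<noteq> (i + 1) mod int n"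
      "simple_refl n i a = a + 1" "(a + 1) mod int n = (i + 1) mod int n"
      "(a + 1) mod int n \<noteq> i mod int n" "simple_refl n i (a + 1) = a"
    | (Suc) "a mod int n = (i + 1) mod int n" "a mod int n \<noteq> i mod int n"
      "simple_refl n i a = a - 1" "(a - 1) mod int n = i mod int n"
      "(a - 1) mod int n \<noteq> (i + 1) mod int n" "simple_refl n i (a - 1) = a"
    | (other) "a mod int n \<noteq> i mod int n" "a mod int n \<noteq> (i + 1) mod int n"
      "simple_refl n i a = a"
proof -
  have neq: "(i + 1) mod int n \<noteq> i mod int n" by (rule Suc_mod_neq[OF assms])
  consider "a mod int n = i mod int n" | "a mod int n = (i + 1) mod int n"
    | "a mod int n \<noteq> i mod int n" "a mod int n \<noteq> (i + 1) mod int n" by blast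
  then show ?thesis
  proof cases
    case 1
    note 2 = Suc_cong[OF 1]
    show ?thesis
      by (rule that(1)) (use 1 2 neq in
        \<open>auto simp: simple_refl_cong_i[OF 1] simple_refl_cong_Suc[OF assms 2]\<close>)
  next
    case 2
    note 1 = pred_cong[OF 2]
    show ?thesis
      by (rule that(2)) (use 1 2 neq in
        \<open>auto simp: simple_refl_cong_i[OF 1] simple_refl_cong_Suc[OF assms 2]\<close>)
  next
    case 3
    then show ?thesis using that(3) simple_refl_other by blast
  qed
qed

lemma simple_refl_invol [simp]:
  assumes "n \<ge> 2"
  shows "simple_refl n i (simple_refl n i a) = a"
  by (cases rule: simple_refl_cases[OF assms, of a i]) (simp_all add: assms)

lemma simple_refl_bounds: "a - 1 \<le> simple_refl n i a" "simple_refl n i a \<le> a + 1"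
  by (auto simp: simple_refl_def)

text \<open>The reflection only moves numbers between a number congruent to i and its successor, so
  the thresholds that it can carry a number across are exactly those congruent to i + 1.\<close>

lemma le_simple_refl_iff:
  assumes "j mod int n \<noteq> (i + 1) mod int n"
  shows "j \<le> simple_refl n i a \<longleftrightarrow> j \<le> a"
proof -
  have "j \<noteq> a + 1" if "a mod int n = i mod int n"
    using assms that by (metis mod_add_left_eq)
  moreover have "j \<noteq> a" if "a mod int n = (i + 1) mod int n"
    using assms that by auto
  ultimately show ?thesis by (auto simp: simple_refl_def)
qed

lemma mod_eq_shift: "\<exists>m. b = i + m * int n" if "b mod int n = i mod int n"
proof -
  have "int n dvd b - i" using that by (simp add: mod_eq_dvd_iff)
  then obtain m where "b - i = int n * m" ..
  then have "b = i + m * int n" by (simp add: algebra_simps)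
  then show ?thesis ..
qed

lemma not_cong_between:
  assumes "i < b" "b < i + int n"
  shows "b mod int n \<noteq> i mod int n"
proof
  assume "b mod int n = i mod int n"
  then have "int n dvd b - i" by (simp add: mod_eq_dvd_iff)
  then have "int n \<le> b - i" using assms by (intro zdvd_imp_le) auto
  then show False using assms by simp
qed

lemma shift_periodic:
  assumes "\<And>a :: int. h (a + int n) = h a"
  shows "h (a + m * int n) = h a"
proof -
  have 1: "h (a + int k * int n) = h a" for k a
  proof (induction k)
    case (Suc k)
    have "h (a + int (Suc k) * int n) = h ((a + int k * int n) + int n)" by (simp add: algebra_simps)
    then show ?case using assms Suc by simp
  qed simp
  show ?thesis
  proof (cases "m \<ge> 0")
    case True
    then show ?thesis using 1[of a "nat m"] by simp
  next
    case False
    then show ?thesis using 1[of "a + m * int n" "nat (- m)"] by simp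
  qed
qed

lemma shift_equivariant:
  assumes "\<And>a :: int. h (a + int n) = h a + int n"
  shows "h (a + m * int n) = h a + m * int n"
proof -
  have "h (a + m * int n) - (a + m * int n) = h a - a"
    using shift_periodic[of "\<lambda>a. h a - a" n a m] assms by simp
  then show ?thesis by simp
qed

locale configuration_space = vector_space scale
  for scale :: "'a :: field \<Rightarrow> 'b :: ab_group_add \<Rightarrow> 'b" (infixr "*s" 75)
begin

text \<open>The function \<open>h\<close> plays the role of the inverse of a bounded affine permutation.\<close>

definition config :: "nat \<Rightarrow> (int \<Rightarrow> int) \<Rightarrow> (int \<Rightarrow> 'b) \<Rightarrow> bool" where
  "config n h v \<longleftrightarrow> (\<forall>a. v (a + int n) = v a) \<and>
     (\<forall>j b. j \<le> b \<longrightarrow> (v b \<in> span (v ` {j..<b}) \<longleftrightarrow> j \<le> h b))"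

text \<open>The place \<open>x\<close> is \<open>i + 1\<close> or \<open>i\<close>. With
  \<open>x = i + 1\<close> and \<open>t = - c\<close> this is the passage from v to w; with
  \<open>x = i\<close> it is the way back. The added multiple is of the old vector at the same
  place, that is, of the one which the reflection has moved away.\<close>

definition twist :: "nat \<Rightarrow> int \<Rightarrow> int \<Rightarrow> 'a \<Rightarrow> (int \<Rightarrow> 'b) \<Rightarrow> int \<Rightarrow> 'b" where
  "twist n i x t v a = v (simple_refl n i a) + (if a mod int n = x mod int n then t *s v a else 0)"

lemma configD: "config n h v \<Longrightarrow> j \<le> b \<Longrightarrow> v b \<in> span (v ` {j..<b}) \<longleftrightarrow> j \<le> h b"
  unfolding config_def by blast

lemma config_periodic: "config n h v \<Longrightarrow> v (a + int n) = v a"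
  unfolding config_def by blast

lemma image_shift:
  assumes "\<And>a. w (a + int n) = w a"
  shows "w ` {j + m * int n..<b + m * int n} = w ` {j..<b}"
proof -
  have "w (a + m * int n) = w a" for a
    by (rule shift_periodic) (rule assms)
  then show ?thesis
    unfolding image_add_atLeastLessThan'[symmetric] image_image by simp
qed

lemma twist_periodic:
  assumes "\<And>a. v (a + int n) = v a"
  shows "twist n i x t v (a + int n) = twist n i x t v a"
  using assms by (simp add: twist_def simple_refl_shift)

lemma twist_twist:
  assumes "n \<ge> 2"
  shows "twist n i i t (twist n i (i + 1) (- t) v) = v"
    and "twist n i (i + 1) (- t) (twist n i i t v) = v"
proof -
  have "twist n i i t (twist n i (i + 1) (- t) v) a = v a"
    "twist n i (i + 1) (- t) (twist n i i t v) a = v a" for a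
    by (cases rule: simple_refl_cases[OF assms, of a i]; simp add: twist_def assms)+
  then show "twist n i i t (twist n i (i + 1) (- t) v) = v"
    "twist n i (i + 1) (- t) (twist n i i t v) = v" by (simp_all add: fun_eq_iff)
qed

lemma span_image_mono: "a \<in> span (v ` S) \<Longrightarrow> S \<subseteq> T \<Longrightarrow> a \<in> span (v ` T)"
  by (meson image_mono span_mono subsetD)

text \<open>When neither \<open>j\<close> nor the excluded end \<open>b\<close> is congruent to i +
  1, the interval contains, with each position congruent to i, its successor, and with each position
  congruent to i + 1, its predecessor. So the whole plane of the two vectors is available.\<close>

lemma span_images_agree:
  assumes n: "n \<ge> 2"
    and v: "\<And>a. v (a + int n) = v a" and w: "\<And>a. w (a + int n) = w a"
    and eq: "\<And>a. a mod int n \<noteq> i mod int n \<Longrightarrow> a mod int n \<noteq> (i + 1) mod int n \<Longrightarrow> w a = v a"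
    and pair: "w i \<in> span {v i, v (i + 1)}" "w (i + 1) \<in> span {v i, v (i + 1)}"
    and j: "j mod int n \<noteq> (i + 1) mod int n" and b: "b mod int n \<noteq> (i + 1) mod int n"
  shows "w ` {j..<b} \<subseteq> span (v ` {j..<b})"
proof
  fix y assume "y \<in> w ` {j..<b}"
  then obtain x where x: "j \<le> x" "x < b" "y = w x" by auto
  consider "x mod int n = i mod int n" | "x mod int n = (i + 1) mod int n"
    | "x mod int n \<noteq> i mod int n" "x mod int n \<noteq> (i + 1) mod int n" by blast
  then show "y \<in> span (v ` {j..<b})"
  proof cases
    case 1
    obtain m where m: "x = i + m * int n" using mod_eq_shift[OF 1] by blast
    have vm: "v (a + m * int n) = v a" "w (a + m * int n) = w a" for a
      by (rule shift_periodic, rule v) (rule shift_periodic, rule w)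
    have "x + 1 \<noteq> b" using 1 b by (metis mod_add_left_eq)
    then have "v x \<in> v ` {j..<b}" "v (x + 1) \<in> v ` {j..<b}" using x by auto
    moreover have "v x = v i" "v (x + 1) = v (i + 1)" "w x = w i"
      using vm[of i] vm[of "i + 1"] unfolding m by (simp_all add: algebra_simps)
    ultimately have sub: "{v i, v (i + 1)} \<subseteq> v ` {j..<b}" by simp
    show ?thesis using pair(1) span_mono[OF sub] \<open>w x = w i\<close> x by auto
  next
    case 2
    obtain m where m: "x = i + 1 + m * int n" using mod_eq_shift[OF 2] by blast
    have vm: "v (a + m * int n) = v a" "w (a + m * int n) = w a" for a
      by (rule shift_periodic, rule v) (rule shift_periodic, rule w)
    have "x \<noteq> j" using 2 j by auto
    then have "v x \<in> v ` {j..<b}" "v (x - 1) \<in> v ` {j..<b}" using x by auto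
    moreover have "v x = v (i + 1)" "v (x - 1) = v i" "w x = w (i + 1)"
      using vm[of i] vm[of "i + 1"] unfolding m by (simp_all add: algebra_simps)
    ultimately have sub: "{v i, v (i + 1)} \<subseteq> v ` {j..<b}" by simp
    then show ?thesis using pair(2) span_mono[OF sub] \<open>w x = w (i + 1)\<close> x by auto
  next
    case 3
    then show ?thesis using eq[of x] x by (auto intro: span_base)
  qed
qed

text \<open>When only the plane spanned by the entries \<open>i\<close> and \<open>i + 1\<close> is rearranged, the spans of the
  intervals that do not separate \<open>i\<close> from \<open>i + 1\<close> are unchanged.  It remains to control the intervals
  which start at \<open>i + 1\<close> and the vectors at \<open>i\<close> and \<open>i + 1\<close>.\<close>

lemma config_transfer:
  assumes n: "n \<ge> 2" and v: "config n h v" and w: "\<And>a. w (a + int n) = w a"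
    and eq: "\<And>a. a mod int n \<noteq> i mod int n \<Longrightarrow> a mod int n \<noteq> (i + 1) mod int n \<Longrightarrow> w a = v a"
    and wv: "w i \<in> span {v i, v (i + 1)}" "w (i + 1) \<in> span {v i, v (i + 1)}"
    and vw: "v i \<in> span {w i, w (i + 1)}" "v (i + 1) \<in> span {w i, w (i + 1)}"
    and shift: "\<And>b. h' (b + int n) = h' b + int n" and lower: "\<And>b. b - int n \<le> h' b"
    and E: "\<And>b j. b mod int n \<noteq> i mod int n \<Longrightarrow> b mod int n \<noteq> (i + 1) mod int n \<Longrightarrow>
      j mod int n \<noteq> (i + 1) mod int n \<Longrightarrow> j \<le> h' b \<longleftrightarrow> j \<le> h b"
    and L: "\<And>b. i + 1 < b \<Longrightarrow> b < i + int n \<Longrightarrow>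
      w b \<in> span (insert (w (i + 1)) (v ` {i + 2..<b})) \<longleftrightarrow> i + 1 \<le> h' b"
    and R1: "\<And>j. i + 2 - int n \<le> j \<Longrightarrow> j \<le> i \<Longrightarrow> w i \<in> span (v ` {j..<i}) \<longleftrightarrow> j \<le> h' i"
    and R2: "\<And>j. i + 2 - int n \<le> j \<Longrightarrow> j \<le> i \<Longrightarrow>
      w (i + 1) \<in> span (insert (w i) (v ` {j..<i})) \<longleftrightarrow> j \<le> h' (i + 1)"
    and h'i: "i + 2 - int n \<le> h' i" and h'Suc: "h' (i + 1) < i"
  shows "config n h' w"
proof -
  have vp: "\<And>a. v (a + int n) = v a" using v by (simp add: config_periodic)
  have agree: "w a = v a" if "i + 2 - int n \<le> a" "a < i" for a
  proof (rule eq)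
    show "a mod int n \<noteq> i mod int n" "a mod int n \<noteq> (i + 1) mod int n"
      using not_cong_between[of "i - int n" a n] not_cong_between[of "i + 1 - int n" a n] that
      by (auto simp: mod_diff_right_eq[of _ "int n", symmetric])
  qed
  have agree2: "w a = v a" if "i + 2 \<le> a" "a < i + int n" for a
  proof (rule eq)
    show "a mod int n \<noteq> i mod int n" "a mod int n \<noteq> (i + 1) mod int n"
      using not_cong_between[of "i" a n] not_cong_between[of "i + 1" a n] that by auto
  qed
  have img: "w ` {j..<i} = v ` {j..<i}" if "i + 2 - int n \<le> j" for j
    using that agree by (intro image_cong) auto
  have key: "w b \<in> span (w ` {j..<b}) \<longleftrightarrow> j \<le> h' b" if jb: "j \<le> b" for j b
  proof (cases "j \<le> b - int n")
    case True
    \<comment> \<open>An interval of full length contains a periodic copy of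
      \<open>w b\<close>.\<close>
    have "w b = w (b - int n)" using w[of "b - int n"] by simp
    moreover have "w (b - int n) \<in> w ` {j..<b}" using True n by auto
    ultimately have "w b \<in> span (w ` {j..<b})" by (simp add: span_base)
    moreover have "j \<le> h' b" using True lower[of b] by linarith
    ultimately show ?thesis by blast
  next
    case False
    \<comment> \<open>Both sides are invariant under a simultaneous shift by a multiple of n. So
      \<open>b\<close>, or \<open>j\<close> when it is the end that is congruent to i + 1, can be
      moved to a standard place.\<close>
    have shifted: "w b \<in> span (w ` {j..<b}) \<longleftrightarrow> j \<le> h' b"
      if "w (b + m * int n) \<in> span (w ` {j + m * int n..<b + m * int n}) \<longleftrightarrow> j + m * int n \<le> h' (b + m * int n)"
      for m
      using that image_shift[of w n, OF w] shift_periodic[of w n b m, OF w]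
        shift_equivariant[of h' n b m, OF shift] by simp
    consider "b mod int n = i mod int n" | "b mod int n = (i + 1) mod int n"
      | "b mod int n \<noteq> i mod int n" "b mod int n \<noteq> (i + 1) mod int n" "j mod int n = (i + 1) mod int n"
      | "b mod int n \<noteq> i mod int n" "b mod int n \<noteq> (i + 1) mod int n" "j mod int n \<noteq> (i + 1) mod int n"
      by blast
    then show ?thesis
    proof cases
      case 1
      then obtain m where b: "b = i + m * int n" using mod_eq_shift by blast
      have "w i \<in> span (w ` {j'..<i}) \<longleftrightarrow> j' \<le> h' i" if "i - int n < j'" "j' \<le> i" for j'
      proof (cases "i + 2 - int n \<le> j'")
        case True
        then show ?thesis using R1[OF True] img[OF True] that by simp
      next
        \<comment> \<open>Here \<open>j' = i + 1 - int n\<close>: the interval starts between the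
          two columns of the previous period. Membership follows by monotonicity from the interval
          starting one step later.\<close>
        case False
        have "w i \<in> span (w ` {i + 2 - int n..<i})" using R1[of "i + 2 - int n"] img h'i n by auto
        then have "w i \<in> span (w ` {j'..<i})" by (rule span_image_mono) (use False in auto)
        then show ?thesis using False h'i by auto
      qed
      from this[of "j - m * int n"] show ?thesis
        using shifted[of "- m"] False jb b by simp
    next
      case 2
      then obtain m where b: "b = i + 1 + m * int n" using mod_eq_shift by blast
      have "w (i + 1) \<in> span (w ` {j'..<i + 1}) \<longleftrightarrow> j' \<le> h' (i + 1)"
        if "i + 1 - int n < j'" "j' \<le> i + 1" for j'
      proof (cases "j' \<le> i")
        case True
        have "{j'..<i + 1} = insert i {j'..<i}" using True by auto
        then show ?thesis using R2[of j'] True img[of j'] that by simp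
      next
        \<comment> \<open>Here \<open>j' = i + 1\<close> and the interval is empty: it remains to
          see that \<open>w (i + 1)\<close> is nonzero, which follows from
          \<open>h' (i + 1) < i\<close>.\<close>
        case False
        have "w (i + 1) \<notin> span (insert (w i) (v ` {i..<i}))" using R2[of i] h'Suc n by auto
        then have "w (i + 1) \<notin> span {}" using span_mono[of "{}"] by blast
        then show ?thesis using False h'Suc that by auto
      qed
      from this[of "j - m * int n"] show ?thesis
        using shifted[of "- m"] False jb b by simp
    next
      case 3
      then obtain m where j: "j = i + 1 + m * int n" using mod_eq_shift by blast
      have "w b' \<in> span (w ` {i + 1..<b'}) \<longleftrightarrow> i + 1 \<le> h' b'" if "i + 1 < b'" "b' < i + int n" for b'
      proof -
        have "{i + 1..<b'} = insert (i + 1) {i + 2..<b'}" using that by auto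
        moreover have "w ` {i + 2..<b'} = v ` {i + 2..<b'}"
          using agree2 that by (intro image_cong) auto
        ultimately show ?thesis using L[OF that] by simp
      qed
      \<comment> \<open>As \<open>b\<close> is congruent neither to i nor to i + 1, after the shift
        it lies strictly between i + 1 and i + n, where \<open>L\<close> applies.\<close>
      moreover have "b \<noteq> i + int n + m * int n" "b \<noteq> j" using 3 by auto
      ultimately show ?thesis using False jb shifted[of "- m"] unfolding j by auto
    next
      case 4
      have "w ` {j..<b} \<subseteq> span (v ` {j..<b})"
        by (rule span_images_agree[where i = i and n = n]) (use n vp w eq wv 4 in auto)
      moreover have "v ` {j..<b} \<subseteq> span (w ` {j..<b})"
        by (rule span_images_agree[where i = i and n = n]) (use n vp w eq vw 4 in auto)
      ultimately have "span (w ` {j..<b}) = span (v ` {j..<b})" by (simp add: span_eq)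
      then show ?thesis using configD[OF v jb] E[OF 4] eq[OF 4(1,2)] by simp
    qed
  qed
  then show ?thesis unfolding config_def using w by blast
qed

end

text \<open>Here \<open>h\<close> is the inverse of the affine permutation \<open>f\<close>, and \<open>p = f i\<close>, \<open>q = f (i + 1)\<close>.\<close>

locale exchange = configuration_space scale
  for scale :: "'a :: field \<Rightarrow> 'b :: ab_group_add \<Rightarrow> 'b" (infixr "*s" 75) +
  fixes n :: nat and i p q a\<^sub>0 b\<^sub>0 :: int and h :: "int \<Rightarrow> int"
  assumes n2: "n \<ge> 2"
    and h_shift: "h (b + int n) = h b + int n" and h_lower: "b - int n \<le> h b"
    and h_p: "h b = i \<longleftrightarrow> b = p" and h_q: "h b = i + 1 \<longleftrightarrow> b = q"
    and pq: "i + 2 \<le> p" "p < q" "q < i + int n"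
    and h_i: "h i = a\<^sub>0" and h_Suc: "h (i + 1) = b\<^sub>0"
    and ab: "i + 2 - int n \<le> a\<^sub>0" "a\<^sub>0 < b\<^sub>0" "b\<^sub>0 < i"
begin

abbreviation "s \<equiv> simple_refl n i"

lemma window: "a mod int n \<noteq> i mod int n" "a mod int n \<noteq> (i + 1) mod int n"
  if "i + 2 - int n \<le> a" "a < i"
  using not_cong_between[of "i - int n" a n] not_cong_between[of "i + 1 - int n" a n] that
  by (auto simp: mod_diff_right_eq[of _ "int n", symmetric])

lemma s_window: "s a\<^sub>0 = a\<^sub>0" "s b\<^sub>0 = b\<^sub>0"
  using window[of a\<^sub>0] window[of b\<^sub>0] ab by (auto intro!: simple_refl_other)

lemma window2: "a mod int n \<noteq> i mod int n" "a mod int n \<noteq> (i + 1) mod int n"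
  if "i + 1 < a" "a < i + int n"
  using not_cong_between[of i a n] not_cong_between[of "i + 1" a n] that by auto

text \<open>The inverses of \<open>s\<^sub>i f\<close> and of \<open>s\<^sub>i f s\<^sub>i\<close>, products being read from left to right.\<close>

definition swap_left :: "int \<Rightarrow> int" where "swap_left b = s (h b)"
definition swap_both :: "int \<Rightarrow> int" where "swap_both b = s (h (s b))"

lemma swap_left_values: "swap_left i = a\<^sub>0" "swap_left (i + 1) = b\<^sub>0"
  and swap_both_values: "swap_both i = b\<^sub>0" "swap_both (i + 1) = a\<^sub>0"
  by (simp_all add: swap_left_def swap_both_def h_i h_Suc s_window n2)

lemma swap_shift: "swap_left (b + int n) = swap_left b + int n"
    "swap_both (b + int n) = swap_both b + int n"
  by (simp_all add: swap_left_def swap_both_def h_shift simple_refl_shift)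

lemma swap_other:
  assumes "b mod int n \<noteq> i mod int n" "b mod int n \<noteq> (i + 1) mod int n"
  shows "swap_left b = s (h b)" "swap_both b = s (h b)"
  using assms by (simp_all add: swap_left_def swap_both_def simple_refl_other)

lemma twist_values:
  "twist n i (i + 1) c v i = v (i + 1)"
  "twist n i (i + 1) c v (i + 1) = v i + c *s v (i + 1)"
  "twist n i i c v i = v (i + 1) + c *s v i"
  "twist n i i c v (i + 1) = v i"
  using Suc_mod_neq[OF n2, of i] n2 by (auto simp: twist_def)

lemma twist_other:
  assumes "a mod int n \<noteq> i mod int n" "a mod int n \<noteq> (i + 1) mod int n"
  shows "twist n i (i + 1) c v a = v a" "twist n i i c v a = v a"
  using assms by (simp_all add: twist_def simple_refl_other)

lemma in_span_pair: "c *s x + d *s y \<in> span {x, y}"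
  by (intro span_add span_scale) (auto intro: span_base)

lemma interval_Suc: "{j..<i + 1} = insert i {j..<i}" if "j \<le> i"
  using that by auto

text \<open>Exchange: \<open>h p = i\<close> says that \<open>v p\<close> depends on the vectors
  from i on, but not on those from i + 1 on. So \<open>v i\<close> lies in the span of the vectors
  from i + 1 up to p; splitting off \<open>v (i + 1)\<close> gives c.\<close>

lemma coefficient_c:
  assumes v: "config n h v"
  obtains c where "v i - c *s v (i + 1) \<in> span (v ` {i + 2..<p + 1})"
proof -
  let ?G = "v ` {i + 1..<p}"
  have "v p \<in> span (v ` {i..<p})" using configD[OF v, of i p] h_p[of p] pq by simp
  moreover have "{i..<p} = insert i {i + 1..<p}" using pq by auto
  ultimately have "v p \<in> span (insert (v i) ?G)" by simp
  moreover have "v p \<notin> span ?G" using configD[OF v, of "i + 1" p] h_p[of p] pq by simp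
  ultimately have "v i \<in> span (insert (v p) ?G)" by (rule in_span_insert)
  moreover have "insert (v p) ?G = insert (v (i + 1)) (v ` {i + 2..<p + 1})"
  proof -
    have "insert p {i + 1..<p} = insert (i + 1) {i + 2..<p + 1}" using pq by auto
    then show ?thesis by (metis image_insert)
  qed
  ultimately show ?thesis using that by (auto simp: span_breakdown_eq)
qed

text \<open>Otherwise \<open>v i\<close> could be dropped from the relation for \<open>v p\<close>,
  against \<open>h p = i\<close>.\<close>

lemma v_i_notin:
  assumes v: "config n h v"
  shows "v i \<notin> span (v ` {i + 1..<p})"
proof
  assume "v i \<in> span (v ` {i + 1..<p})"
  then have "span (insert (v i) (v ` {i + 1..<p})) = span (v ` {i + 1..<p})" by (rule span_redundant)
  moreover have "{i..<p} = insert i {i + 1..<p}" using pq by auto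
  moreover have "v p \<in> span (v ` {i..<p})" using configD[OF v, of i p] h_p[of p] pq by simp
  ultimately have "v p \<in> span (v ` {i + 1..<p})" by simp
  then show False using configD[OF v, of "i + 1" p] h_p[of p] pq by simp
qed

text \<open>With u = v_i - c v_(i+1) standing at place i + 1, the roles of p and q are exchanged.
  For \<open>b = p\<close>, u can replace v_i, so \<open>v p\<close> now depends on vectors from i +
  1 on. For \<open>b = q\<close>, u already lies in the span of the vectors from i + 2 up to p, and
  p < q, so it cannot make up for the missing v_(i+1). Every other b is insensitive to the
  change.\<close>

lemma left_condition:
  assumes v: "config n h v" and c: "v i - c *s v (i + 1) \<in> span (v ` {i + 2..<p + 1})"
    and b: "i + 1 < b" "b < i + int n"
  shows "v b \<in> span (insert (v i - c *s v (i + 1)) (v ` {i + 2..<b})) \<longleftrightarrow> i + 1 \<le> s (h b)"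
proof -
  let ?u = "v i - c *s v (i + 1)"
  let ?F = "\<lambda>b. v ` {i + 2..<b}"
  have "?u \<notin> span (?F p)"
  proof
    assume "?u \<in> span (?F p)"
    then have "?u \<in> span (v ` {i + 1..<p})" by (rule span_image_mono) auto
    moreover have "c *s v (i + 1) \<in> span (v ` {i + 1..<p})"
      by (rule span_scale[OF span_base]) (use pq in auto)
    ultimately have "?u + c *s v (i + 1) \<in> span (v ` {i + 1..<p})" by (rule span_add)
    then show False using v_i_notin[OF v] by simp
  qed
  moreover have "{i + 2..<p + 1} = insert p {i + 2..<p}" using pq by auto
  then have "?u \<in> span (insert (v p) (?F p))" using c by simp
  ultimately have vp: "v p \<in> span (insert ?u (?F p))" using in_span_insert by blast
  consider "h b \<ge> i + 2" | "h b = i + 1" | "h b = i" | "h b < i" by linarith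
  then show ?thesis
  proof cases
    case 1
    then have "v b \<in> span (?F b)" using configD[OF v, of "i + 2" b] b by simp
    then have "v b \<in> span (insert ?u (?F b))" using span_mono[of "?F b" "insert ?u (?F b)"] by blast
    then show ?thesis using 1 simple_refl_bounds(1)[of "h b" n i] by simp
  next
    case 2
    then have bq: "b = q" using h_q by simp
    have "?u \<in> span (?F q)" by (rule span_image_mono[OF c]) (use pq in auto)
    then have "span (insert ?u (?F q)) = span (?F q)" by (rule span_redundant)
    moreover have "v q \<notin> span (?F q)" using configD[OF v, of "i + 2" q] 2 bq b by simp
    ultimately show ?thesis using 2 bq n2 by simp
  next
    case 3
    then have "b = p" using h_p by simp
    then show ?thesis using vp 3 by simp
  next
    case 4
    have "v b \<notin> span (v ` {i..<b})" using configD[OF v, of i b] 4 b by simp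
    moreover have "insert ?u (?F b) \<subseteq> span (v ` {i..<b})"
    proof -
      have "v i \<in> span (v ` {i..<b})" "v (i + 1) \<in> span (v ` {i..<b})"
        using b by (auto intro!: span_base)
      then have "?u \<in> span (v ` {i..<b})" by (intro span_diff span_scale)
      moreover have "?F b \<subseteq> span (v ` {i..<b})" by (auto intro!: span_base)
      ultimately show ?thesis by simp
    qed
    then have "span (insert ?u (?F b)) \<subseteq> span (v ` {i..<b})" by (simp add: span_minimal subspace_span)
    ultimately show ?thesis using 4 simple_refl_bounds(2)[of n i "h b"] by auto
  qed
qed

text \<open>The way back from \<open>left_condition\<close>, with \<open>h'\<close> prescribed only
  off the classes of i and i + 1, so that it serves \<open>swap_left\<close> and
  \<open>swap_both\<close> alike. Now \<open>h' p = i + 1\<close> and \<open>h' q = i\<close>; the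
  former puts \<open>w (i + 1)\<close> into the span of the vectors from i + 2 up to p and makes it
  redundant in the interval for q.\<close>

lemma left_condition_converse:
  assumes w: "config n h' w"
    and h': "\<And>b. b mod int n \<noteq> i mod int n \<Longrightarrow> b mod int n \<noteq> (i + 1) mod int n \<Longrightarrow> h' b = s (h b)"
  shows "w (i + 1) \<in> span (w ` {i + 2..<p + 1})"
    and "i + 1 < b \<Longrightarrow> b < i + int n \<Longrightarrow>
      w b \<in> span (insert (w i) (w ` {i + 2..<b})) \<longleftrightarrow> i + 1 \<le> h b"
proof -
  let ?F = "\<lambda>b. w ` {i + 2..<b}"
  have h'p: "h' p = i + 1" and h'q: "h' q = i"
    using h'[of p] h'[of q] window2[of p] window2[of q] h_p[of p] h_q[of q] pq n2 by auto
  have "w p \<in> span (w ` {i + 1..<p})" using configD[OF w, of "i + 1" p] h'p pq by simp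
  moreover have "{i + 1..<p} = insert (i + 1) {i + 2..<p}" using pq by auto
  ultimately have "w p \<in> span (insert (w (i + 1)) (?F p))" by simp
  moreover have wp: "w p \<notin> span (?F p)" using configD[OF w, of "i + 2" p] h'p pq by simp
  ultimately have "w (i + 1) \<in> span (insert (w p) (?F p))" by (rule in_span_insert)
  moreover have ins_p: "{i + 2..<p + 1} = insert p {i + 2..<p}" using pq by auto
  ultimately show Suc: "w (i + 1) \<in> span (?F (p + 1))" by simp
  then have Sucq: "w (i + 1) \<in> span (?F q)" by (rule span_image_mono) (use pq in auto)
  have ins_q: "{i..<q} = insert i (insert (i + 1) {i + 2..<q})" using pq by auto
  assume b: "i + 1 < b" "b < i + int n"
  have h'b: "h' b = s (h b)" using h'[of b] window2[of b] b by simp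
  have i2: "(i + 2) mod int n \<noteq> (i + 1) mod int n" by (rule Suc_Suc_mod_neq[OF n2])
  have i1: "i mod int n \<noteq> (i + 1) mod int n" using Suc_mod_neq[OF n2, of i] by simp
  consider "h b \<ge> i + 2" | "h b = i + 1" | "h b = i" | "h b < i" by linarith
  then show "w b \<in> span (insert (w i) (?F b)) \<longleftrightarrow> i + 1 \<le> h b"
  proof cases
    case 1
    then have "i + 2 \<le> h' b" unfolding h'b using le_simple_refl_iff[OF i2] by simp
    then have "w b \<in> span (?F b)" using configD[OF w, of "i + 2" b] b by simp
    then have "w b \<in> span (insert (w i) (?F b))" using span_mono[of "?F b" "insert (w i) (?F b)"] by blast
    then show ?thesis using 1 by simp
  next
    case 2
    then have bq: "b = q" using h_q by simp
    have "w q \<in> span (w ` {i..<q})" using configD[OF w, of i q] h'q pq by simp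
    then have "w q \<in> span (insert (w (i + 1)) (insert (w i) (?F q)))"
      unfolding ins_q by (simp add: insert_commute)
    moreover have "w (i + 1) \<in> span (insert (w i) (?F q))"
      using Sucq span_mono[of "?F q" "insert (w i) (?F q)"] by blast
    ultimately show ?thesis using 2 bq by (simp add: span_redundant)
  next
    case 3
    then have bp: "b = p" using h_p by simp
    \<comment> \<open>Otherwise \<open>w i\<close> would lie in the span of the vectors from i + 2
      up to p. As \<open>w (i + 1)\<close> is redundant too, \<open>w q\<close> would depend on
      vectors from i + 2 on, against \<open>h' q = i\<close>.\<close>
    have "w p \<notin> span (insert (w i) (?F p))"
    proof
      assume "w p \<in> span (insert (w i) (?F p))"
      then have "w i \<in> span (insert (w p) (?F p))" using wp by (rule in_span_insert)
      then have "w i \<in> span (?F (p + 1))" unfolding ins_p by simp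
      then have "w i \<in> span (?F q)" by (rule span_image_mono) (use pq in auto)
      moreover have "w q \<in> span (w ` {i..<q})" using configD[OF w, of i q] h'q pq by simp
      ultimately have "w q \<in> span (?F q)"
        unfolding ins_q using Sucq by (simp add: span_redundant insert_commute)
      then show False using configD[OF w, of "i + 2" q] h'q pq by simp
    qed
    then show ?thesis using 3 bp by simp
  next
    case 4
    then have "\<not> i \<le> h' b" unfolding h'b using le_simple_refl_iff[OF i1] by simp
    then have "w b \<notin> span (w ` {i..<b})" using configD[OF w, of i b] b by simp
    moreover have "insert (w i) (?F b) \<subseteq> w ` {i..<b}" using b by auto
    ultimately show ?thesis using 4 span_mono[of "insert (w i) (?F b)" "w ` {i..<b}"] by auto
  qed
qed

text \<open>The rearranged vector at \<open>i\<close> has a nonzero component along the old one: the closing points of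
  \<open>i\<close> and \<open>i + 1\<close> are unchanged.\<close>

lemma right_condition_generic:
  assumes x: "config n g x" and g: "g i = a\<^sub>0" "g (i + 1) = b\<^sub>0"
    and \<delta>: "\<delta> \<noteq> 0" and z: "y\<^sub>1 - \<delta> *s x i \<in> span (x ` {b\<^sub>0..<i})"
    and xy: "x i \<in> span {y\<^sub>1, y\<^sub>2}" "x (i + 1) \<in> span {y\<^sub>1, y\<^sub>2}"
    and yx: "y\<^sub>2 \<in> span {x i, x (i + 1)}"
    and j: "j \<le> i"
  shows "y\<^sub>1 \<in> span (x ` {j..<i}) \<longleftrightarrow> j \<le> a\<^sub>0"
    and "y\<^sub>2 \<in> span (insert y\<^sub>1 (x ` {j..<i})) \<longleftrightarrow> j \<le> b\<^sub>0"
proof -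
  let ?F = "\<lambda>j. x ` {j..<i}"
  have xi: "x i \<in> span (?F j) \<longleftrightarrow> j \<le> a\<^sub>0" if "j \<le> i" for j using configD[OF x that] g by simp
  have xS: "x (i + 1) \<in> span (insert (x i) (?F j)) \<longleftrightarrow> j \<le> b\<^sub>0" if "j \<le> i" for j
    using configD[OF x, of j "i + 1"] g interval_Suc[OF that] that by simp
  have inv: "x i = inverse \<delta> *s (y\<^sub>1 - (y\<^sub>1 - \<delta> *s x i))" using \<delta> by simp
  \<comment> \<open>The congruence \<open>z\<close> holds modulo the interval starting at
    \<open>b\<^sub>0\<close>. For every start up to \<open>b\<^sub>0\<close>, \<open>x i\<close> and
    \<open>y\<^sub>1\<close> are therefore interchangeable, \<open>\<delta>\<close> being
    invertible.\<close>
  have sw: "x i \<in> span (insert y\<^sub>1 (?F j'))" "y\<^sub>1 \<in> span (insert (x i) (?F j'))" if "j' \<le> b\<^sub>0" for j'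
  proof -
    have z': "y\<^sub>1 - \<delta> *s x i \<in> span (?F j')" using span_image_mono[OF z] that by auto
    then have "y\<^sub>1 - \<delta> *s x i \<in> span (insert y\<^sub>1 (?F j'))" "y\<^sub>1 - \<delta> *s x i \<in> span (insert (x i) (?F j'))"
      using span_mono[of "?F j'" "insert _ (?F j')"] by blast+
    moreover have "y\<^sub>1 \<in> span (insert y\<^sub>1 (?F j'))" "x i \<in> span (insert (x i) (?F j'))"
      by (auto intro: span_base)
    ultimately have "inverse \<delta> *s (y\<^sub>1 - (y\<^sub>1 - \<delta> *s x i)) \<in> span (insert y\<^sub>1 (?F j'))"
      "y\<^sub>1 - \<delta> *s x i + \<delta> *s x i \<in> span (insert (x i) (?F j'))"
      by (blast intro: span_scale span_diff span_add)+
    then show "x i \<in> span (insert y\<^sub>1 (?F j'))" "y\<^sub>1 \<in> span (insert (x i) (?F j'))"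
      using inv by simp_all
  qed
  show "y\<^sub>1 \<in> span (?F j) \<longleftrightarrow> j \<le> a\<^sub>0"
  proof
    assume "j \<le> a\<^sub>0"
    then have "x i \<in> span (?F j)" "y\<^sub>1 \<in> span (insert (x i) (?F j))" using xi sw[of j] ab by auto
    then show "y\<^sub>1 \<in> span (?F j)" by (simp add: span_redundant)
  next
    assume y: "y\<^sub>1 \<in> span (?F j)"
    \<comment> \<open>Moving the start down to \<open>b\<^sub>0\<close> makes \<open>sw\<close>
      applicable and loses nothing: since \<open>a\<^sub>0 < b\<^sub>0\<close>, the conditions
      \<open>min j b\<^sub>0 \<le> a\<^sub>0\<close> and \<open>j \<le> a\<^sub>0\<close> are
      equivalent.\<close>
    let ?j = "min j b\<^sub>0"
    have "y\<^sub>1 \<in> span (?F ?j)" by (rule span_image_mono[OF y]) auto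
    then have "x i \<in> span (?F ?j)" using sw(1)[of ?j] by (simp add: span_redundant)
    then show "j \<le> a\<^sub>0" using xi[of ?j] ab j by auto
  qed
  show "y\<^sub>2 \<in> span (insert y\<^sub>1 (?F j)) \<longleftrightarrow> j \<le> b\<^sub>0"
  proof
    assume jb: "j \<le> b\<^sub>0"
    then have "x (i + 1) \<in> span (insert (x i) (?F j))" using xS j by simp
    also have "span (insert (x i) (?F j)) \<subseteq> span (insert y\<^sub>1 (?F j))"
      using sw(1)[OF jb] span_mono[of "?F j" "insert y\<^sub>1 (?F j)"] span_superset[of "?F j"]
      by (intro span_minimal subspace_span) blast
    finally have "{x i, x (i + 1)} \<subseteq> span (insert y\<^sub>1 (?F j))" using sw(1)[OF jb] by simp
    then show "y\<^sub>2 \<in> span (insert y\<^sub>1 (?F j))"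
      using yx span_minimal[OF _ subspace_span] by blast
  next
    assume y: "y\<^sub>2 \<in> span (insert y\<^sub>1 (?F j))"
    show "j \<le> b\<^sub>0"
    proof (rule ccontr)
      assume jb: "\<not> j \<le> b\<^sub>0"
      let ?E = "insert y\<^sub>1 (?F j)"
      have "{y\<^sub>1, y\<^sub>2} \<subseteq> span ?E" using y by (simp add: span_base)
      then have "x i \<in> span ?E" "x (i + 1) \<in> span ?E"
        using xy span_minimal[OF _ subspace_span] by blast+
      \<comment> \<open>Beyond \<open>b\<^sub>0\<close>, hence beyond \<open>a\<^sub>0\<close>,
        \<open>x i\<close> is new to the interval and can be exchanged with
        \<open>y\<^sub>1\<close>. Then \<open>x (i + 1)\<close> would depend on an interval that
        starts after \<open>b\<^sub>0\<close>.\<close>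
      moreover have "x i \<notin> span (?F j)" using xi[OF j] jb ab by simp
      ultimately have "y\<^sub>1 \<in> span (insert (x i) (?F j))" using in_span_insert by blast
      then have "?E \<subseteq> span (insert (x i) (?F j))"
        using span_superset[of "insert (x i) (?F j)"] by blast
      then have "span ?E \<subseteq> span (insert (x i) (?F j))" by (rule span_minimal[OF _ subspace_span])
      then show False using \<open>x (i + 1) \<in> span ?E\<close> xS[OF j] jb by blast
    qed
  qed
qed

lemma swap_left_E:
  assumes "b mod int n \<noteq> i mod int n" "b mod int n \<noteq> (i + 1) mod int n" "j mod int n \<noteq> (i + 1) mod int n"
  shows "j \<le> swap_left b \<longleftrightarrow> j \<le> h b" "j \<le> swap_both b \<longleftrightarrow> j \<le> h b"
  using swap_other[OF assms(1,2)] le_simple_refl_iff[OF assms(3)] by simp_all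

text \<open>\<open>le_simple_refl_iff\<close> settles every \<open>b\<close> whose threshold
  \<open>b - int n\<close> is not congruent to i + 1. In the remaining classes the values are known
  explicitly from \<open>a\<^sub>0\<close> and \<open>b\<^sub>0\<close>.\<close>

lemma swap_lower:
  "b - int n \<le> swap_left b" "b - int n \<le> swap_both b"
proof -
  have *: "b - int n \<le> s (h b)" if "b mod int n \<noteq> (i + 1) mod int n" for b
    using le_simple_refl_iff[of "b - int n" n i "h b"] h_lower[of b] that by (simp add: mod_diff_right_eq[of _ "int n", symmetric])
  show "b - int n \<le> swap_left b"
  proof (cases "b mod int n = (i + 1) mod int n")
    case True
    then obtain m where b: "b = i + 1 + m * int n" using mod_eq_shift by blast
    have "swap_left b = b\<^sub>0 + m * int n"
      unfolding b using shift_equivariant[of swap_left n "i + 1" m] swap_shift swap_left_values by simp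
    then show ?thesis using ab b by simp
  next
    case False
    then show ?thesis using * swap_left_def by simp
  qed
  show "b - int n \<le> swap_both b"
  proof -
    consider (i) "b mod int n = i mod int n" | (Suc) "b mod int n = (i + 1) mod int n"
      | (other) "b mod int n \<noteq> i mod int n" "b mod int n \<noteq> (i + 1) mod int n" by blast
    then show ?thesis
    proof cases
      case i
      then obtain m where b: "b = i + m * int n" using mod_eq_shift by blast
      have "swap_both b = b\<^sub>0 + m * int n"
        unfolding b using shift_equivariant[of swap_both n i m] swap_shift swap_both_values by simp
      then show ?thesis using ab b by simp
    next
      case Suc
      then obtain m where b: "b = i + 1 + m * int n" using mod_eq_shift by blast
      have "swap_both b = a\<^sub>0 + m * int n"
        unfolding b using shift_equivariant[of swap_both n "i + 1" m] swap_shift swap_both_values by simp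
      then show ?thesis using ab b by simp
    next
      case other
      then show ?thesis using *[of b] by (simp add: swap_other)
    qed
  qed
qed

text \<open>From here on \<open>v\<close> belongs to \<open>f\<close>, and \<open>w\<close> is the configuration in which the column \<open>i\<close>,
  reduced modulo the column \<open>i + 1\<close>, has been moved past the latter.\<close>

lemma config_swap_both:
  assumes v: "config n h v" and c: "v i - c *s v (i + 1) \<in> span (v ` {i + 2..<p + 1})"
    and d: "v (i + 1) \<in> span (v ` {b\<^sub>0..<i})"
  shows "config n swap_both (twist n i (i + 1) (- c) v)" (is "config n _ ?w")
proof (rule config_transfer[OF n2 v])
  let ?F = "\<lambda>j. v ` {j..<i}"
  have wi: "?w i = v (i + 1)" "?w (i + 1) = v i - c *s v (i + 1)" by (simp_all add: twist_values)
  show "?w (a + int n) = ?w a" for a by (rule twist_periodic) (rule config_periodic[OF v])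
  show "?w a = v a" if "a mod int n \<noteq> i mod int n" "a mod int n \<noteq> (i + 1) mod int n" for a
    using that by (rule twist_other)
  show "?w i \<in> span {v i, v (i + 1)}" "?w (i + 1) \<in> span {v i, v (i + 1)}"
    using in_span_pair[of 0 "v i" 1 "v (i + 1)"] in_span_pair[of 1 "v i" "- c" "v (i + 1)"]
    by (simp_all add: wi)
  show "v i \<in> span {?w i, ?w (i + 1)}" "v (i + 1) \<in> span {?w i, ?w (i + 1)}"
    using in_span_pair[of c "?w i" 1 "?w (i + 1)"] in_span_pair[of 1 "?w i" 0 "?w (i + 1)"]
    by (simp_all add: wi)
  show "swap_both (b + int n) = swap_both b + int n" "b - int n \<le> swap_both b" for b
    by (rule swap_shift swap_lower)+
  show "j \<le> swap_both b \<longleftrightarrow> j \<le> h b"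
    if "b mod int n \<noteq> i mod int n" "b mod int n \<noteq> (i + 1) mod int n" "j mod int n \<noteq> (i + 1) mod int n"
    for b j using that by (rule swap_left_E)
  show "?w b \<in> span (insert (?w (i + 1)) (v ` {i + 2..<b})) \<longleftrightarrow> i + 1 \<le> swap_both b"
    if "i + 1 < b" "b < i + int n" for b
    using left_condition[OF v c that] twist_other[OF window2[OF that]] swap_other[OF window2[OF that]] wi
    by simp
  have vi: "v i \<in> span (?F j) \<longleftrightarrow> j \<le> a\<^sub>0" if "j \<le> i" for j using configD[OF v that] h_i by simp
  show "?w i \<in> span (?F j) \<longleftrightarrow> j \<le> swap_both i" if j: "j \<le> i" for j
  proof
    assume "?w i \<in> span (?F j)"
    then have "v (i + 1) \<in> span (v ` {j..<i + 1})"
      unfolding wi by (rule span_image_mono) auto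
    then show "j \<le> swap_both i" using configD[OF v, of j "i + 1"] j h_Suc swap_both_values by simp
  next
    assume "j \<le> swap_both i"
    then show "?w i \<in> span (?F j)"
      unfolding wi swap_both_values by (intro span_image_mono[OF d]) auto
  qed
  show "?w (i + 1) \<in> span (insert (?w i) (?F j)) \<longleftrightarrow> j \<le> swap_both (i + 1)" if j: "j \<le> i" for j
  proof
    assume y: "?w (i + 1) \<in> span (insert (?w i) (?F j))"
    \<comment> \<open>From starts up to \<open>b\<^sub>0\<close>, the vector
      \<open>v (i + 1)\<close> is absorbed by the interval because of \<open>d\<close>. Adding its
      multiple back leaves a statement about \<open>v i\<close> alone.\<close>
    let ?j = "min j b\<^sub>0"
    have "insert (v (i + 1)) (?F j) \<subseteq> span (?F ?j)"
      using span_image_mono[OF d, of "{?j..<i}"] by (auto intro!: span_base)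
    then have sub: "span (insert (v (i + 1)) (?F j)) \<subseteq> span (?F ?j)"
      by (rule span_minimal[OF _ subspace_span])
    have "?w (i + 1) + c *s v (i + 1) \<in> span (insert (v (i + 1)) (?F j))"
      using y unfolding wi(1) by (intro span_add span_scale) (auto intro: span_base)
    then have "v i \<in> span (?F ?j)" using sub wi by auto
    then show "j \<le> swap_both (i + 1)" using vi[of ?j] ab j swap_both_values by auto
  next
    assume "j \<le> swap_both (i + 1)"
    then have "v i \<in> span (?F j)" using vi j swap_both_values by simp
    then have "v i \<in> span (insert (v (i + 1)) (?F j))" using span_mono[of "?F j" "insert _ (?F j)"] by blast
    then show "?w (i + 1) \<in> span (insert (?w i) (?F j))"
      unfolding wi by (intro span_diff span_scale) (auto intro: span_base)
  qed
qed (use ab swap_both_values in auto)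

text \<open>Modulo the interval from \<open>b\<^sub>0\<close>, \<open>v (i + 1)\<close> is a nonzero
  multiple of \<open>v i\<close>. Hence at place i it closes where \<open>v i\<close> did, and the
  closing points \<open>a\<^sub>0\<close> and \<open>b\<^sub>0\<close> of the two places survive;
  only p and q are affected.\<close>

lemma config_swap_left:
  assumes v: "config n h v" and c: "v i - c *s v (i + 1) \<in> span (v ` {i + 2..<p + 1})"
    and d: "v (i + 1) \<notin> span (v ` {b\<^sub>0..<i})"
  shows "config n swap_left (twist n i (i + 1) (- c) v)" (is "config n _ ?w")
proof (rule config_transfer[OF n2 v])
  let ?F = "\<lambda>j. v ` {j..<i}"
  have wi: "?w i = v (i + 1)" "?w (i + 1) = v i - c *s v (i + 1)" by (simp_all add: twist_values)
  show "?w (a + int n) = ?w a" for a by (rule twist_periodic) (rule config_periodic[OF v])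
  show "?w a = v a" if "a mod int n \<noteq> i mod int n" "a mod int n \<noteq> (i + 1) mod int n" for a
    using that by (rule twist_other)
  show wv: "?w i \<in> span {v i, v (i + 1)}" "?w (i + 1) \<in> span {v i, v (i + 1)}"
    using in_span_pair[of 0 "v i" 1 "v (i + 1)"] in_span_pair[of 1 "v i" "- c" "v (i + 1)"]
    by (simp_all add: wi)
  show vw: "v i \<in> span {?w i, ?w (i + 1)}" "v (i + 1) \<in> span {?w i, ?w (i + 1)}"
    using in_span_pair[of c "?w i" 1 "?w (i + 1)"] in_span_pair[of 1 "?w i" 0 "?w (i + 1)"]
    by (simp_all add: wi)
  show "swap_left (b + int n) = swap_left b + int n" "b - int n \<le> swap_left b" for b
    by (rule swap_shift swap_lower)+
  show "j \<le> swap_left b \<longleftrightarrow> j \<le> h b"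
    if "b mod int n \<noteq> i mod int n" "b mod int n \<noteq> (i + 1) mod int n" "j mod int n \<noteq> (i + 1) mod int n"
    for b j using that by (rule swap_left_E)
  show "?w b \<in> span (insert (?w (i + 1)) (v ` {i + 2..<b})) \<longleftrightarrow> i + 1 \<le> swap_left b"
    if "i + 1 < b" "b < i + int n" for b
    using left_condition[OF v c that] twist_other[OF window2[OF that]] swap_other[OF window2[OF that]] wi
    by simp
  have "v (i + 1) \<in> span (v ` {b\<^sub>0..<i + 1})" using configD[OF v, of b\<^sub>0 "i + 1"] h_Suc ab by simp
  then obtain \<delta> where \<delta>: "v (i + 1) - \<delta> *s v i \<in> span (?F b\<^sub>0)"
    using interval_Suc[of b\<^sub>0] ab by (auto simp: span_breakdown_eq)
  have nz: "\<delta> \<noteq> 0"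
  proof
    assume "\<delta> = 0"
    then show False using \<delta> d by simp
  qed
  note R = right_condition_generic[OF v h_i h_Suc nz \<delta>, of "?w (i + 1)"]
  show "?w i \<in> span (?F j) \<longleftrightarrow> j \<le> swap_left i" if j: "j \<le> i" for j
    using R(1)[OF _ _ _ j] vw wv(2) unfolding swap_left_values wi by blast
  show "?w (i + 1) \<in> span (insert (?w i) (?F j)) \<longleftrightarrow> j \<le> swap_left (i + 1)" if j: "j \<le> i" for j
    using R(2)[OF _ _ _ j] vw wv(2) unfolding swap_left_values wi by blast
qed (use ab swap_left_values in auto)

text \<open>\<open>t\<close> is arbitrary: \<open>w i\<close> depends on vectors from
  \<open>b\<^sub>0\<close> on, while \<open>w (i + 1)\<close> reaches back to
  \<open>a\<^sub>0 < b\<^sub>0\<close>, so adding a multiple of the former to the latter moves no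
  closing point. The second conclusion identifies \<open>t\<close> as the coefficient c of the
  result, the third puts the result on the closed locus.\<close>

lemma config_of_swap_both:
  fixes t :: 'a
  assumes w: "config n swap_both w"
  defines "v \<equiv> twist n i i t w"
  shows "config n h v" "v i - t *s v (i + 1) \<in> span (v ` {i + 2..<p + 1})"
    "v (i + 1) \<in> span (v ` {b\<^sub>0..<i})"
proof -
  have vi: "v i = w (i + 1) + t *s w i" "v (i + 1) = w i" by (simp_all add: v_def twist_values)
  have other: "v a = w a" if "a mod int n \<noteq> i mod int n" "a mod int n \<noteq> (i + 1) mod int n" for a
    using that unfolding v_def by (rule twist_other)
  have img1: "v ` {j..<i} = w ` {j..<i}" if "i + 2 - int n \<le> j" for j
    using that by (intro image_cong other window) auto
  have img2: "v ` {i + 2..<b} = w ` {i + 2..<b}" if "b \<le> i + int n" for b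
    using that by (intro image_cong other window2) auto
  note L = left_condition_converse[OF w swap_other(2)]
  show "v i - t *s v (i + 1) \<in> span (v ` {i + 2..<p + 1})"
    using L(1) img2 pq by (simp add: vi)
  have wb: "w i \<in> span (w ` {b\<^sub>0..<i})" using configD[OF w, of b\<^sub>0 i] swap_both_values ab by simp
  then show "v (i + 1) \<in> span (v ` {b\<^sub>0..<i})" using img1 ab by (simp add: vi)
  show "config n h v"
  proof (rule config_transfer[OF n2 w])
    let ?F = "\<lambda>j. w ` {j..<i}"
    show "v (a + int n) = v a" for a
      unfolding v_def by (rule twist_periodic) (rule config_periodic[OF w])
    show "v i \<in> span {w i, w (i + 1)}" "v (i + 1) \<in> span {w i, w (i + 1)}"
      using in_span_pair[of t "w i" 1 "w (i + 1)"] in_span_pair[of 1 "w i" 0 "w (i + 1)"]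
      by (simp_all add: vi add.commute[of "w (i + 1)" "t *s w i"])
    show "w i \<in> span {v i, v (i + 1)}" "w (i + 1) \<in> span {v i, v (i + 1)}"
      using in_span_pair[of 0 "v i" 1 "v (i + 1)"] in_span_pair[of 1 "v i" "- t" "v (i + 1)"]
      by (simp_all add: vi)
    show "j \<le> h b \<longleftrightarrow> j \<le> swap_both b"
      if "b mod int n \<noteq> i mod int n" "b mod int n \<noteq> (i + 1) mod int n" "j mod int n \<noteq> (i + 1) mod int n"
      for b j using swap_left_E(2)[OF that] by simp
    show "v b \<in> span (insert (v (i + 1)) (w ` {i + 2..<b})) \<longleftrightarrow> i + 1 \<le> h b"
      if "i + 1 < b" "b < i + int n" for b
      using L(2)[OF _ _ that] other[OF window2[OF that]] vi by simp
    have wS: "w (i + 1) \<in> span (insert (w i) (?F j)) \<longleftrightarrow> j \<le> a\<^sub>0" if "j \<le> i" for j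
      using configD[OF w, of j "i + 1"] that swap_both_values interval_Suc[OF that] by simp
    have le_a: "j \<le> a\<^sub>0" if "v i \<in> span (insert (w i) (?F j))" "j \<le> i" for j
    proof -
      have "v i - t *s w i \<in> span (insert (w i) (?F j))"
        using that(1) by (intro span_diff span_scale) (auto intro: span_base)
      then show ?thesis using wS[OF that(2)] vi by simp
    qed
    show "v i \<in> span (?F j) \<longleftrightarrow> j \<le> h i" if j: "j \<le> i" for j
    proof
      assume "v i \<in> span (?F j)"
      then have "v i \<in> span (insert (w i) (?F j))" using span_mono[of "?F j" "insert _ (?F j)"] by blast
      then show "j \<le> h i" using le_a j h_i by simp
    next
      assume ja: "j \<le> h i"
      then have "w i \<in> span (?F j)" using h_i ab by (intro span_image_mono[OF wb]) auto
      moreover from this have "w (i + 1) \<in> span (?F j)"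
        using wS[OF j] ja h_i by (simp add: span_redundant)
      ultimately show "v i \<in> span (?F j)" unfolding vi by (intro span_add span_scale)
    qed
    show "v (i + 1) \<in> span (insert (v i) (?F j)) \<longleftrightarrow> j \<le> h (i + 1)" if j: "j \<le> i" for j
    proof
      assume y: "v (i + 1) \<in> span (insert (v i) (?F j))"
      show "j \<le> h (i + 1)"
      proof (rule ccontr)
        assume jb: "\<not> j \<le> h (i + 1)"
        then have "w i \<notin> span (?F j)"
          using configD[OF w j] swap_both_values h_Suc by simp
        then have "v i \<in> span (insert (w i) (?F j))" using in_span_insert y unfolding vi(2) by blast
        then show False using le_a[OF _ j] jb ab h_Suc by simp
      qed
    next
      assume "j \<le> h (i + 1)"
      then have "w i \<in> span (?F j)" using h_Suc by (intro span_image_mono[OF wb]) auto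
      then show "v (i + 1) \<in> span (insert (v i) (?F j))"
        unfolding vi(2) using span_mono[of "?F j" "insert _ (?F j)"] by blast
    qed
  qed (use ab h_i h_Suc other h_shift h_lower in auto)
qed

text \<open>Modulo the interval from \<open>b\<^sub>0\<close>, \<open>v i\<close> is congruent to (t
  + e) w_i, so \<open>te\<close> is the condition for \<open>v i\<close> to take over the role of
  \<open>w i\<close> at place i. The last two conclusions say that the result has coefficient c = t
  and lies on the open locus.\<close>

lemma config_of_swap_left:
  fixes t :: 'a
  assumes w: "config n swap_left w" and e: "w (i + 1) - e *s w i \<in> span (w ` {b\<^sub>0..<i})"
    and te: "t + e \<noteq> 0"
  defines "v \<equiv> twist n i i t w"
  shows "config n h v" "v i - t *s v (i + 1) \<in> span (v ` {i + 2..<p + 1})"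
    "v (i + 1) \<notin> span (v ` {b\<^sub>0..<i})"
proof -
  have vi: "v i = w (i + 1) + t *s w i" "v (i + 1) = w i" by (simp_all add: v_def twist_values)
  have other: "v a = w a" if "a mod int n \<noteq> i mod int n" "a mod int n \<noteq> (i + 1) mod int n" for a
    using that unfolding v_def by (rule twist_other)
  have img1: "v ` {j..<i} = w ` {j..<i}" if "i + 2 - int n \<le> j" for j
    using that by (intro image_cong other window) auto
  have img2: "v ` {i + 2..<b} = w ` {i + 2..<b}" if "b \<le> i + int n" for b
    using that by (intro image_cong other window2) auto
  note L = left_condition_converse[OF w swap_other(1)]
  show "v i - t *s v (i + 1) \<in> span (v ` {i + 2..<p + 1})"
    using L(1) img2 pq by (simp add: vi)
  have "w i \<notin> span (w ` {b\<^sub>0..<i})" using configD[OF w, of b\<^sub>0 i] swap_left_values ab by simp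
  then show "v (i + 1) \<notin> span (v ` {b\<^sub>0..<i})" using img1 ab by (simp add: vi)
  have z: "v i - (t + e) *s w i \<in> span (w ` {b\<^sub>0..<i})"
    using e by (simp add: vi scale_left_distrib)
  show "config n h v"
  proof (rule config_transfer[OF n2 w])
    let ?F = "\<lambda>j. w ` {j..<i}"
    show "v (a + int n) = v a" for a
      unfolding v_def by (rule twist_periodic) (rule config_periodic[OF w])
    show vw: "v i \<in> span {w i, w (i + 1)}" "v (i + 1) \<in> span {w i, w (i + 1)}"
      using in_span_pair[of t "w i" 1 "w (i + 1)"] in_span_pair[of 1 "w i" 0 "w (i + 1)"]
      by (simp_all add: vi add.commute[of "w (i + 1)" "t *s w i"])
    show wv: "w i \<in> span {v i, v (i + 1)}" "w (i + 1) \<in> span {v i, v (i + 1)}"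
      using in_span_pair[of 0 "v i" 1 "v (i + 1)"] in_span_pair[of 1 "v i" "- t" "v (i + 1)"]
      by (simp_all add: vi)
    show "j \<le> h b \<longleftrightarrow> j \<le> swap_left b"
      if "b mod int n \<noteq> i mod int n" "b mod int n \<noteq> (i + 1) mod int n" "j mod int n \<noteq> (i + 1) mod int n"
      for b j using swap_left_E(1)[OF that] by simp
    show "v b \<in> span (insert (v (i + 1)) (w ` {i + 2..<b})) \<longleftrightarrow> i + 1 \<le> h b"
      if "i + 1 < b" "b < i + int n" for b
      using L(2)[OF _ _ that] other[OF window2[OF that]] vi by simp
    note R = right_condition_generic[OF w swap_left_values te z wv vw(2)]
    show "v i \<in> span (?F j) \<longleftrightarrow> j \<le> h i" if j: "j \<le> i" for j
      using R(1)[OF j] h_i by simp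
    show "v (i + 1) \<in> span (insert (v i) (?F j)) \<longleftrightarrow> j \<le> h (i + 1)" if j: "j \<le> i" for j
      using R(2)[OF j] h_Suc by simp
  qed (use ab h_i h_Suc other h_shift h_lower in auto)
qed

text \<open>If c + e were 0, \<open>v i\<close> would lie in the span of the vectors from
  \<open>b\<^sub>0\<close> up to i - 1, but its closing point \<open>a\<^sub>0\<close> is
  smaller.\<close>

lemma coefficient_e_neq:
  fixes c :: 'a
  assumes v: "config n h v"
  defines "w \<equiv> twist n i (i + 1) (- c) v"
  assumes e: "w (i + 1) - e *s w i \<in> span (w ` {b\<^sub>0..<i})"
  shows "c + e \<noteq> 0"
proof
  assume ce: "c + e = 0"
  have wi: "w i = v (i + 1)" "w (i + 1) = v i - c *s v (i + 1)" by (simp_all add: w_def twist_values)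
  have img: "w ` {b\<^sub>0..<i} = v ` {b\<^sub>0..<i}"
    unfolding w_def using ab by (intro image_cong twist_other window) auto
  have "v i - (c + e) *s v (i + 1) \<in> span (v ` {b\<^sub>0..<i})"
    using e unfolding img wi by (simp add: scale_left_distrib algebra_simps)
  then have "v i \<in> span (v ` {b\<^sub>0..<i})" using ce by simp
  then show False using configD[OF v, of b\<^sub>0 i] h_i ab by simp
qed

end

section \<open>Minors and column configurations\<close>

text \<open>Vectors are functions with pointwise operations, so that spans and independence refer to
  a whole type instead of a carrier; vectors of length k are those supported in the first k
  coordinates.\<close>

interpretation cv: configuration_space "\<lambda>(c :: complex) (x :: nat \<Rightarrow> complex) r. c * x r"
  by unfold_locales (auto simp: fun_eq_iff algebra_simps)

text \<open>The vectors are entered as rows, the transpose of a matrix with these columns. In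
  contrast to \<open>minor\<close> the argument is a sequence, unordered and possibly with
  repetitions, as multilinear expansion produces it.\<close>

definition coldet :: "nat \<Rightarrow> (nat \<Rightarrow> nat \<Rightarrow> complex) \<Rightarrow> complex" where
  "coldet k u = det (mat k k (\<lambda>(l, r). u l r))"

lemma coldet_cong: "(\<And>l r. l < k \<Longrightarrow> r < k \<Longrightarrow> u l r = u' l r) \<Longrightarrow> coldet k u = coldet k u'"
  unfolding coldet_def by (rule arg_cong[where f = det]) (auto intro!: eq_matI)

text \<open>Laplace expansion along row l, whose cofactors do not see that row.\<close>

lemma coldet_linear:
  assumes l: "l < k"
  shows "coldet k (u(l := \<lambda>r. a * x r + b * y r)) = a * coldet k (u(l := x)) + b * coldet k (u(l := y))"
proof -
  let ?M = "\<lambda>z. mat k k (\<lambda>(m, r). (u(l := z)) m r)"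
  have cof: "cofactor (?M z) l j = cofactor (?M 0) l j" if "j < k" for z j
  proof -
    have "mat_delete (?M z) l j = mat_delete (?M 0) l j"
      by (rule eq_matI) (auto simp: mat_delete_def)
    then show ?thesis by (simp add: cofactor_def)
  qed
  have exp: "coldet k (u(l := z)) = (\<Sum>j<k. z j * cofactor (?M 0) l j)" for z
  proof -
    have "det (?M z) = (\<Sum>j<k. ?M z $$ (l, j) * cofactor (?M z) l j)"
      by (rule laplace_expansion_row) (use l in auto)
    also have "\<dots> = (\<Sum>j<k. z j * cofactor (?M 0) l j)"
    proof (rule sum.cong[OF refl])
      fix j assume "j \<in> {..<k}"
      then have j: "j < k" by simp
      have "?M z $$ (l, j) = z j" using l j by simp
      then show "?M z $$ (l, j) * cofactor (?M z) l j = z j * cofactor (?M 0) l j"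
        by (simp only: cof[OF j, of z])
    qed
    finally show ?thesis unfolding coldet_def .
  qed
  show ?thesis unfolding exp by (simp add: sum.distrib sum_distrib_left algebra_simps)
qed

lemma coldet_dup:
  assumes "l < k" "m < k" "l \<noteq> m" "\<And>r. r < k \<Longrightarrow> u l r = u m r"
  shows "coldet k u = 0"
  unfolding coldet_def
  by (rule det_identical_rows[of _ k l m]) (use assms in \<open>auto intro!: eq_vecI\<close>)

lemma coldet_permute:
  assumes "p permutes {0..<k}"
  shows "coldet k (\<lambda>l. u (p l)) = signof p * coldet k u"
proof -
  have "p l < k" if "l < k" for l using permutes_in_image[OF assms, of l] that by simp
  then have "mat k k (\<lambda>(l, r). mat k k (\<lambda>(l, r). u l r) $$ (p l, r)) = mat k k (\<lambda>(l, r). u (p l) r)"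
    by (intro eq_matI) auto
  then show ?thesis
    unfolding coldet_def using det_permute_rows[OF _ assms, of "mat k k (\<lambda>(l, r). u l r)"] by simp
qed

text \<open>By linearity in slot l, the vectors for which the determinant vanishes form a
  subspace.\<close>

lemma coldet_span:
  assumes l: "l < k" and x: "x \<in> cv.span S" and S: "\<And>y. y \<in> S \<Longrightarrow> coldet k (u(l := y)) = 0"
  shows "coldet k (u(l := x)) = 0"
proof -
  have "cv.subspace {y. coldet k (u(l := y)) = 0}"
  proof (rule cv.subspaceI)
    have "coldet k (u(l := \<lambda>r. 0)) = 0"
      using coldet_linear[OF l, of u 0 0 0 0] by (simp add: zero_fun_def)
    then show "0 \<in> {y. coldet k (u(l := y)) = 0}" by (simp add: zero_fun_def)
  next
    fix y z assume "y \<in> {y. coldet k (u(l := y)) = 0}" "z \<in> {y. coldet k (u(l := y)) = 0}"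
    then show "y + z \<in> {y. coldet k (u(l := y)) = 0}"
      using coldet_linear[OF l, of u 1 y 1 z] by (simp add: plus_fun_def)
  next
    fix c y assume "y \<in> {y. coldet k (u(l := y)) = 0}"
    then show "(\<lambda>r. c * y r) \<in> {y. coldet k (u(l := y)) = 0}"
      using coldet_linear[OF l, of u c y 0 y] by simp
  qed
  then have "cv.span S \<subseteq> {y. coldet k (u(l := y)) = 0}"
    by (intro cv.span_minimal) (use S in auto)
  then show ?thesis using x by blast
qed

lemma coldet_nonzero_notin_span:
  assumes "coldet k u \<noteq> 0" "l < k"
  shows "u l \<notin> cv.span (u ` ({..<k} - {l}))"
proof
  assume "u l \<in> cv.span (u ` ({..<k} - {l}))"
  then have "coldet k (u(l := u l)) = 0"
  proof (rule coldet_span[OF assms(2)])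
    fix y assume "y \<in> u ` ({..<k} - {l})"
    then obtain m where "m < k" "m \<noteq> l" "y = u m" by auto
    then show "coldet k (u(l := y)) = 0" using assms(2) by (intro coldet_dup[of l k m]) auto
  qed
  then show False using assms(1) by simp
qed

lemma coldet_nonzero_inj: 
  assumes "coldet k u \<noteq> 0"
  shows "inj_on u {..<k}"
proof (rule inj_onI, rule ccontr)
  fix l m assume "l \<in> {..<k}" "m \<in> {..<k}" "u l = u m" "l \<noteq> m"
  then show False using coldet_dup[of l k m u] assms by simp
qed

lemma coldet_nonzero_independent:
  assumes "coldet k u \<noteq> 0"
  shows "cv.independent (u ` {..<k})"
  unfolding cv.dependent_def
proof
  assume "\<exists>a\<in>u ` {..<k}. a \<in> cv.span (u ` {..<k} - {a})"
  then obtain l where l: "l < k" "u l \<in> cv.span (u ` {..<k} - {u l})" by auto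
  have "u ` {..<k} - {u l} \<subseteq> u ` ({..<k} - {l})" by auto
  then show False using l coldet_nonzero_notin_span[OF assms l(1)] cv.span_mono by blast
qed

lemma sum_fun_apply: "(\<Sum>x\<in>S. f x) r = (\<Sum>x\<in>S. f x r)" for f :: "'c \<Rightarrow> nat \<Rightarrow> complex"
  by (induction S rule: infinite_finite_induct) auto

text \<open>A kernel vector of the transposed matrix is a linear relation in the first k
  coordinates; the support condition extends it to all coordinates. Dividing by a nonzero
  coefficient isolates one vector.\<close>

lemma coldet_zero_in_span:
  assumes "coldet k u = 0" and supp: "\<And>l r. l < k \<Longrightarrow> k \<le> r \<Longrightarrow> u l r = 0"
  obtains l where "l < k" "u l \<in> cv.span (u ` ({..<k} - {l}))"
proof -
  let ?M = "mat k k (\<lambda>(l, r). u l r)"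
  have "det (transpose_mat ?M) = 0"
    using assms(1) unfolding coldet_def by (subst det_transpose[of _ k]) auto
  then obtain y where y: "y \<in> carrier_vec k" "y \<noteq> 0\<^sub>v k" "transpose_mat ?M *\<^sub>v y = 0\<^sub>v k"
    using det_0_iff_vec_prod_zero_field[of "transpose_mat ?M" k] by auto
  then obtain l where l: "l < k" "y $ l \<noteq> 0"
    by (metis carrier_vecD eq_vecI index_zero_vec(1) index_zero_vec(2))
  have "(\<Sum>m<k. u m r * y $ m) = 0" if "r < k" for r
  proof -
    have "(transpose_mat ?M *\<^sub>v y) $ r = (\<Sum>m<k. u m r * y $ m)"
      using that y(1) by (auto simp: scalar_prod_def atLeast0LessThan intro!: sum.cong)
    then show ?thesis using y(3) that by simp
  qed
  moreover have "(\<Sum>m<k. u m r * y $ m) = 0" if "\<not> r < k" for r using supp that by simp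
  ultimately have 0: "(\<Sum>m<k. u m r * y $ m) = 0" for r by blast
  have "u l = (\<Sum>m\<in>{..<k} - {l}. (\<lambda>r. (- y $ m / y $ l) * u m r))"
  proof
    fix r
    have "(\<Sum>m<k. u m r * y $ m) = u l r * y $ l + (\<Sum>m\<in>{..<k} - {l}. u m r * y $ m)"
      using l by (simp add: sum.remove)
    then have "u l r = (\<Sum>m\<in>{..<k} - {l}. - y $ m * u m r) / y $ l"
      using 0[of r] l(2) by (simp add: field_simps sum_negf eq_neg_iff_add_eq_0)
    also have "\<dots> = (\<Sum>m\<in>{..<k} - {l}. (- y $ m / y $ l) * u m r)"
      unfolding sum_divide_distrib by simp
    finally show "u l r = (\<Sum>m\<in>{..<k} - {l}. (\<lambda>r. (- y $ m / y $ l) * u m r)) r"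
      unfolding sum_fun_apply .
  qed
  also have "\<dots> \<in> cv.span (u ` ({..<k} - {l}))"
    by (intro cv.span_sum cv.span_scale cv.span_base) auto
  finally show ?thesis using that l by blast
qed

lemma independent_supported_card:
  assumes "cv.independent S" "\<And>x r. x \<in> S \<Longrightarrow> k \<le> r \<Longrightarrow> x r = 0"
  shows "finite S" "card S \<le> k"
proof -
  let ?E = "(\<lambda>l r. if r = l then 1 else 0 :: complex) ` {..<k}"
  have "S \<subseteq> cv.span ?E"
  proof
    fix x assume x: "x \<in> S"
    have "x = (\<Sum>l<k. (\<lambda>r. x l * (if r = l then 1 else 0)))"
    proof
      fix r
      show "x r = (\<Sum>l<k. (\<lambda>r. x l * (if r = l then 1 else 0))) r"
        unfolding sum_fun_apply using assms(2)[OF x, of r]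
        by (cases "r < k") (auto simp: if_distrib cong: if_cong)
    qed
    also have "\<dots> \<in> cv.span ?E"
      by (intro cv.span_sum cv.span_scale cv.span_base) auto
    finally show "x \<in> cv.span ?E" .
  qed
  from cv.independent_span_bound[OF _ assms(1) this] have "finite S \<and> card S \<le> card ?E" by simp
  then show "finite S" "card S \<le> k" using card_image_le[of "{..<k}" "\<lambda>l r. if r = l then 1 else 0 :: complex"]
    by auto
qed

text \<open>Otherwise there would be k + 1 independent vectors supported in k coordinates.\<close>

lemma coldet_nonzero_span:
  assumes "coldet k u \<noteq> 0" and supp: "\<And>l r. l < k \<Longrightarrow> k \<le> r \<Longrightarrow> u l r = 0"
    and x: "\<And>r. k \<le> r \<Longrightarrow> x r = 0"
  shows "x \<in> cv.span (u ` {..<k})"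
proof (rule ccontr)
  assume n: "x \<notin> cv.span (u ` {..<k})"
  then have "cv.independent (insert x (u ` {..<k}))"
    using coldet_nonzero_independent[OF assms(1)] by (simp add: cv.independent_insert)
  then have "card (insert x (u ` {..<k})) \<le> k"
    by (rule independent_supported_card(2)) (use supp x in auto)
  moreover have "x \<notin> u ` {..<k}"
  proof
    assume "x \<in> u ` {..<k}"
    then have "x \<in> cv.span (u ` {..<k})" by (rule cv.span_base)
    then show False using n by simp
  qed
  moreover have "card (u ` {..<k}) = k" using card_image[OF coldet_nonzero_inj[OF assms(1)]] by simp
  ultimately show False by simp
qed

text \<open>Positions count from 1 and matrix columns from 0, whence the shift by one before the
  reduction modulo n.\<close>

definition columns :: "complex mat \<Rightarrow> int \<Rightarrow> nat \<Rightarrow> complex" where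
  "columns A a r = (if r < dim_row A then A $$ (r, nat ((a - 1) mod int (dim_col A))) else 0)"

lemma residue_range: "n > 0 \<Longrightarrow> residue n a \<in> {1..int n}"
  using pos_mod_bound[of "int n" "a - 1"] pos_mod_sign[of "int n" "a - 1"]
  unfolding residue_def by (simp del: pos_mod_bound)

lemma residue_mod: "residue n a mod int n = a mod int n"
  by (simp add: residue_def mod_simps)

lemma residue_eq_iff: "residue n a = residue n b \<longleftrightarrow> a mod int n = b mod int n"
proof
  assume "residue n a = residue n b"
  then show "a mod int n = b mod int n" by (metis residue_mod)
next
  assume "a mod int n = b mod int n"
  then have "(a - 1) mod int n = (b - 1) mod int n" by (metis mod_diff_left_eq)
  then show "residue n a = residue n b" by (simp add: residue_def)
qed

lemma residue_id: "a \<in> {1..int n} \<Longrightarrow> residue n a = a"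
  by (simp add: residue_def)

lemma residue_periodic:
  assumes "\<And>a. w (a + int n) = w a"
  shows "w (residue n a) = w a"
proof -
  obtain m where "residue n a = a + m * int n" using mod_eq_shift[OF residue_mod] by blast
  then show ?thesis using shift_periodic[of w n a m, OF assms] by simp
qed

lemma columns_periodic: "A \<in> carrier_mat k n \<Longrightarrow> columns A (a + int n) = columns A a"
proof -
  assume A: "A \<in> carrier_mat k n"
  have "(a + int n - 1) mod int n = (a - 1) mod int n"
    using mod_add_self2[of "a - 1" "int n"] by (simp add: algebra_simps)
  then show ?thesis using A by (auto simp: columns_def)
qed

lemma columns_supp: "A \<in> carrier_mat k n \<Longrightarrow> k \<le> r \<Longrightarrow> columns A a r = 0"
  by (simp add: columns_def)

lemma ksubsets_finite: "J \<in> ksubsets k n \<Longrightarrow> finite J"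
  unfolding ksubsets_def using finite_subset by blast

lemma inj_on_pred:
  assumes "J \<subseteq> {1..int n}"
  shows "inj_on (\<lambda>j. nat (j - 1)) J"
proof (rule inj_onI)
  fix x y assume "x \<in> J" "y \<in> J" and eq: "nat (x - 1) = nat (y - 1)"
  then have "x \<ge> 1" "y \<ge> 1" using assms by auto
  then show "x = y" using eq by simp
qed

text \<open>The enumeration by which \<open>submatrix\<close> selects columns, translated to
  positions counted from 1; with it \<open>minor\<close> becomes a \<open>coldet\<close> without a
  sign.\<close>

definition enum :: "int set \<Rightarrow> nat \<Rightarrow> int" where
  "enum J l = int (pick ((\<lambda>j. nat (j - 1)) ` J) l) + 1"

lemma enum_bij:
  assumes J: "J \<in> ksubsets k n"
  shows "bij_betw (enum J) {..<k} J"
proof -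
  let ?J = "(\<lambda>j. nat (j - 1)) ` J"
  have sub: "J \<subseteq> {1..int n}" "card J = k" using J by (auto simp: ksubsets_def)
  have fin: "finite J" using ksubsets_finite[OF J] .
  have inj: "inj_on (\<lambda>j. nat (j - 1)) J" using inj_on_pred[OF sub(1)] .
  have c: "card ?J = k" using card_image[OF inj] sub by simp
  have "inj_on (enum J) {..<k}"
  proof (rule inj_onI)
    fix l m assume lm: "l \<in> {..<k}" "m \<in> {..<k}" "enum J l = enum J m"
    then have "pick ?J l = pick ?J m" by (simp add: enum_def)
    then show "l = m" using pick_mono_le[of l ?J m] pick_mono_le[of m ?J l] lm c
      by (metis lessThan_iff less_irrefl linorder_neqE_nat)
  qed
  moreover have "enum J l \<in> J" if "l < k" for l
  proof -
    have "pick ?J l \<in> ?J" using pick_in_set_le[of l ?J] c that by simp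
    then obtain j where "j \<in> J" "pick ?J l = nat (j - 1)" by blast
    then show ?thesis using sub by (auto simp: enum_def)
  qed
  then have "enum J ` {..<k} \<subseteq> J" by auto
  ultimately show ?thesis
    unfolding bij_betw_def using card_subset_eq[OF fin] sub card_image by (metis card_lessThan)
qed

lemma minor_coldet:
  assumes A: "A \<in> carrier_mat k n" and J: "J \<in> ksubsets k n"
  shows "minor A J = coldet k (\<lambda>l. columns A (enum J l))"
proof -
  let ?J = "(\<lambda>j. nat (j - 1)) ` J"
  have sub: "J \<subseteq> {1..int n}" "card J = k" using J by (auto simp: ksubsets_def)
  have "{j. j < n \<and> j \<in> ?J} = ?J" using sub(1) by force
  moreover have "inj_on (\<lambda>j. nat (j - 1)) J" using inj_on_pred[OF sub(1)] .
  ultimately have c: "card {j. j < n \<and> j \<in> ?J} = k" using sub by (simp add: card_image)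
  have pl: "pick ?J l < n" if "l < k" for l using pick_le[of l n ?J] c that by simp
  have "submatrix A UNIV ?J = transpose_mat (mat k k (\<lambda>(l, r). columns A (enum J l) r))"
  proof (rule eq_matI)
    fix r l assume rl: "r < dim_row (transpose_mat (mat k k (\<lambda>(l, r). columns A (enum J l) r)))"
      "l < dim_col (transpose_mat (mat k k (\<lambda>(l, r). columns A (enum J l) r)))"
    then have "r < k" "l < k" by auto
    then show "submatrix A UNIV ?J $$ (r, l) = transpose_mat (mat k k (\<lambda>(l, r). columns A (enum J l) r)) $$ (r, l)"
      using A c pl[of l] by (simp add: submatrix_def pick_UNIV columns_def enum_def)
  qed (use A c in \<open>auto simp: dim_submatrix\<close>)
  then show ?thesis
    unfolding minor_def coldet_def by (simp add: det_transpose[of _ k])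
qed

text \<open>\<open>det\<close> is 0 on non-square matrices, so a nonzero minor forces the
  cardinality k. This yields the size of a necklace wherever its coordinate does not vanish.\<close>

lemma minor_nonzero_ksubset:
  assumes A: "A \<in> carrier_mat k n" and J: "J \<subseteq> {1..int n}" and "minor A J \<noteq> 0"
  shows "J \<in> ksubsets k n"
proof -
  let ?J = "(\<lambda>j. nat (j - 1)) ` J"
  have "{j. j < n \<and> j \<in> ?J} = ?J" using J by force
  moreover have "inj_on (\<lambda>j. nat (j - 1)) J" using inj_on_pred[OF J] .
  ultimately have c: "card {j. j < n \<and> j \<in> ?J} = card J" by (simp add: card_image)
  have "dim_row (submatrix A UNIV ?J) = dim_col (submatrix A UNIV ?J)"
  proof (rule ccontr)
    assume "dim_row (submatrix A UNIV ?J) \<noteq> dim_col (submatrix A UNIV ?J)"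
    then have "minor A J = 0" by (simp add: minor_def det_def)
    then show False using assms(3) by simp
  qed
  then show ?thesis using A J c by (simp add: dim_submatrix ksubsets_def)
qed

text \<open>The scalar is the sign of the permutation that sorts \<open>c\<close>. It is the same
  for all periodic \<open>w\<close>, hence a constant when the point varies.\<close>

lemma coldet_reorder:
  assumes J: "J \<in> ksubsets k n"
    and c: "inj_on (\<lambda>l. residue n (c l)) {..<k}" "(\<lambda>l. residue n (c l)) ` {..<k} = J"
  obtains s :: complex where "s \<noteq> 0"
    "\<And>w. (\<And>a. w (a + int n) = w a) \<Longrightarrow> coldet k (\<lambda>l. w (c l)) = s * coldet k (\<lambda>l. w (enum J l))"
proof -
  let ?c = "\<lambda>l. residue n (c l)"
  note bij = enum_bij[OF J]
  define p where "p l = (if l < k then the_inv_into {..<k} (enum J) (?c l) else l)" for l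
  have p1: "enum J (p l) = ?c l" if "l < k" for l
    using that bij c(2) f_the_inv_into_f_bij_betw[OF bij] by (auto simp: p_def)
  have "bij_betw ?c {..<k} J" using c by (simp add: bij_betw_def)
  then have "bij_betw (the_inv_into {..<k} (enum J) \<circ> ?c) {..<k} {..<k}"
    using bij_betw_the_inv_into[OF bij] by (rule bij_betw_trans)
  then have "bij_betw p {..<k} {..<k}"
    by (rule bij_betw_cong[THEN iffD1, rotated]) (simp add: p_def)
  then have p: "p permutes {0..<k}"
    unfolding atLeast0LessThan by (rule bij_imp_permutes) (simp add: p_def)
  have "coldet k (\<lambda>l. w (c l)) = signof p * coldet k (\<lambda>l. w (enum J l))"
    if w: "\<And>a. w (a + int n) = w a" for w
  proof -
    have "coldet k (\<lambda>l. w (c l)) = coldet k (\<lambda>l. w (enum J (p l)))"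
      by (rule coldet_cong) (simp add: p1 residue_periodic[of w n, OF w])
    also have "\<dots> = signof p * coldet k (\<lambda>l. w (enum J l))"
      by (rule coldet_permute[OF p])
    finally show ?thesis .
  qed
  moreover have "signof p \<noteq> (0 :: complex)" by (simp add: sign_def)
  ultimately show ?thesis using that by blast
qed

lemma ksubsets_nonempty: "k \<le> n \<Longrightarrow> {1..int k} \<in> ksubsets k n"
  by (auto simp: ksubsets_def)

text \<open>If two positions of \<open>c\<close> agree modulo n, \<open>s = 0\<close> is taken with
  a dummy subset. As before, \<open>s\<close> and \<open>J\<close> do not depend on the
  matrix.\<close>

lemma coldet_columns_form:
  assumes "k \<le> n" "n > 0"
  obtains s J where "J \<in> ksubsets k n"
    "\<And>A. A \<in> carrier_mat k n \<Longrightarrow> coldet k (\<lambda>l. columns A (c l)) = s * minor A J"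
proof (cases "inj_on (\<lambda>l. residue n (c l)) {..<k}")
  case True
  let ?J = "(\<lambda>l. residue n (c l)) ` {..<k}"
  have J: "?J \<in> ksubsets k n"
    using residue_range[OF assms(2)] card_image[OF True] by (auto simp: ksubsets_def)
  from coldet_reorder[OF J True refl] obtain s :: complex where
    s: "\<And>w. (\<And>a. w (a + int n) = w a) \<Longrightarrow> coldet k (\<lambda>l. w (c l)) = s * coldet k (\<lambda>l. w (enum ?J l))"
    by blast
  have "coldet k (\<lambda>l. columns A (c l)) = s * minor A ?J" if "A \<in> carrier_mat k n" for A
    using s[of "columns A", OF columns_periodic[OF that]] minor_coldet[OF that J] by simp
  then show ?thesis using J that by blast
next
  case False
  then obtain l m where lm: "l < k" "m < k" "l \<noteq> m" "residue n (c l) = residue n (c m)"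
    unfolding inj_on_def by blast
  have "coldet k (\<lambda>l. columns A (c l)) = 0 * minor A {1..int k}" if "A \<in> carrier_mat k n" for A
  proof -
    have "columns A (c l) = columns A (c m)"
      using residue_periodic[of "columns A" n, OF columns_periodic[OF that]] lm(4) by metis
    then show ?thesis using coldet_dup[OF lm(1-3)] by simp
  qed
  then show ?thesis using ksubsets_nonempty[OF assms(1)] that by blast
qed

text \<open>Both sides are linear in x, so it suffices to check the vectors \<open>u m\<close>, for
  which all determinants but one have a repeated row.\<close>

lemma cramer:
  assumes D: "coldet k u \<noteq> 0" and x: "x \<in> cv.span (u ` {..<k})"
  shows "x = (\<Sum>l<k. (\<lambda>r. coldet k (u(l := x)) / coldet k u * u l r))"
proof -
  let ?S = "{x. \<forall>r. x r = (\<Sum>l<k. coldet k (u(l := x)) / coldet k u * u l r)}"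
  have lin: "coldet k (u(l := \<lambda>r. a * y r + b * z r)) = a * coldet k (u(l := y)) + b * coldet k (u(l := z))"
    if "l < k" for l a b y z using that by (rule coldet_linear)
  have "cv.subspace ?S"
  proof (rule cv.subspaceI)
    have "coldet k (u(l := 0)) = 0" if "l < k" for l
      using lin[OF that, of 0 0 0 0] by (simp add: zero_fun_def)
    then show "0 \<in> ?S" by simp
  next
    fix y z assume "y \<in> ?S" "z \<in> ?S"
    moreover have "coldet k (u(l := y + z)) = coldet k (u(l := y)) + coldet k (u(l := z))" if "l < k" for l
      using lin[OF that, of 1 y 1 z] by (simp add: plus_fun_def)
    ultimately show "y + z \<in> ?S"
      by (simp add: add_divide_distrib distrib_right sum.distrib)
  next
    fix c y assume "y \<in> ?S"
    moreover have "coldet k (u(l := \<lambda>r. c * y r)) = c * coldet k (u(l := y))" if "l < k" for l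
      using lin[OF that, of c y 0 y] by simp
    ultimately show "(\<lambda>r. c * y r) \<in> ?S"
      by (simp add: sum_distrib_left mult.assoc)
  qed
  moreover have "u m \<in> ?S" if m: "m < k" for m
  proof (intro CollectI allI)
    fix r
    have "coldet k (u(l := u m)) / coldet k u * u l r = (if l = m then u m r else 0)" if l: "l < k" for l
    proof (cases "l = m")
      case True
      then show ?thesis using D by simp
    next
      case False
      then have "coldet k (u(l := u m)) = 0" using l m by (intro coldet_dup[of l k m]) auto
      then show ?thesis using False by simp
    qed
    then show "u m r = (\<Sum>l<k. coldet k (u(l := u m)) / coldet k u * u l r)"
      using m by simp
  qed
  then have "u ` {..<k} \<subseteq> ?S" by blast
  ultimately have "cv.span (u ` {..<k}) \<subseteq> ?S" by (rule cv.span_minimal[rotated])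
  then have "\<forall>r. x r = (\<Sum>l<k. coldet k (u(l := x)) / coldet k u * u l r)" using x by blast
  then show ?thesis by (auto simp: fun_eq_iff sum_fun_apply)
qed

section \<open>The Gale order\<close>

lemma cyc_pos_inj: "inj_on (cyc_pos n j) {1..int n}"
proof (rule inj_onI)
  fix a b assume ab: "a \<in> {1..int n}" "b \<in> {1..int n}" "cyc_pos n j a = cyc_pos n j b"
  then have "int n dvd (a - j) - (b - j)" unfolding cyc_pos_def by (simp add: mod_eq_dvd_iff)
  then have "residue n a = residue n b" unfolding residue_eq_iff by (simp add: mod_eq_dvd_iff)
  then show "a = b" using ab by (simp add: residue_id)
qed

context linorder
begin

text \<open>Relative to a set because the key \<open>cyc_pos n j\<close> is injective on one period,
  not on all integers.\<close>

lemma sorted_key_list_of_set_inj_on: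
  assumes "inj_on f S" "A \<subseteq> S" "finite A"
  shows "set (sorted_key_list_of_set f A) = A" "sorted (map f (sorted_key_list_of_set f A))"
    "distinct (map f (sorted_key_list_of_set f A))" "length (sorted_key_list_of_set f A) = card A"
proof -
  interpret folding_insort_key "(\<le>)" "(<)" S f by unfold_locales (rule assms(1))
  show "set (sorted_key_list_of_set f A) = A" "sorted (map f (sorted_key_list_of_set f A))"
    "distinct (map f (sorted_key_list_of_set f A))" "length (sorted_key_list_of_set f A) = card A"
    using assms(2,3) by simp_all
qed

end

lemma gale_list:
  assumes "J \<subseteq> {1..int n}"
  shows "set (sorted_key_list_of_set (cyc_pos n j) J) = J"
    "sorted (map (cyc_pos n j) (sorted_key_list_of_set (cyc_pos n j) J))"
    "distinct (map (cyc_pos n j) (sorted_key_list_of_set (cyc_pos n j) J))"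
    "length (sorted_key_list_of_set (cyc_pos n j) J) = card J"
proof -
  have "finite J" using assms finite_subset by blast
  from sorted_key_list_of_set_inj_on[OF cyc_pos_inj assms this]
  show "set (sorted_key_list_of_set (cyc_pos n j) J) = J"
    "sorted (map (cyc_pos n j) (sorted_key_list_of_set (cyc_pos n j) J))"
    "distinct (map (cyc_pos n j) (sorted_key_list_of_set (cyc_pos n j) J))"
    "length (sorted_key_list_of_set (cyc_pos n j) J) = card J" by blast+
qed

text \<open>A coarse invariant, but enough to refute a comparison: replacing an element by an
  earlier one lowers the sum of the positions.\<close>

lemma gale_le_sum:
  assumes "I \<subseteq> {1..int n}" "J \<subseteq> {1..int n}" "gale_le n j I J"
  shows "(\<Sum>a\<in>I. cyc_pos n j a) \<le> (\<Sum>a\<in>J. cyc_pos n j a)"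
proof -
  have sum: "(\<Sum>a\<in>K. cyc_pos n j a) = sum_list (map (cyc_pos n j) (sorted_key_list_of_set (cyc_pos n j) K))"
    if "K \<subseteq> {1..int n}" for K
    using gale_list[OF that, of j] distinct_map
    by (metis sum_list_distinct_conv_sum_set)
  have "sum_list (map (cyc_pos n j) xs) \<le> sum_list (map (cyc_pos n j) ys)"
    if "list_all2 (cyc_le n j) xs ys" for xs ys
    using that by (induction rule: list_all2_induct) (auto simp: cyc_le_def)
  then show ?thesis using assms sum unfolding gale_le_def by simp
qed

lemma not_gale_le_exchange:
  assumes B: "B \<subseteq> {1..int n}" and y: "y \<in> B" and x: "x \<in> {1..int n}" "x \<notin> B"
    and xy: "cyc_pos n j x < cyc_pos n j y"
  shows "\<not> gale_le n j B (insert x (B - {y}))"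
proof
  assume "gale_le n j B (insert x (B - {y}))"
  moreover have "insert x (B - {y}) \<subseteq> {1..int n}" using B x by auto
  ultimately have "(\<Sum>a\<in>B. cyc_pos n j a) \<le> (\<Sum>a\<in>insert x (B - {y}). cyc_pos n j a)"
    using gale_le_sum B by blast
  moreover have "finite B" using B finite_subset by blast
  ultimately show False using x y xy by (simp add: sum.remove[of B y])
qed

text \<open>Counting from 0: if the l-th element of J came before the l-th element of I, the initial
  segment ending at its position would contain at least l + 1 elements of J and at most l elements
  of I.\<close>

lemma gale_le_of_counts:
  assumes I: "I \<subseteq> {1..int n}" and J: "J \<subseteq> {1..int n}" and card: "card I = card J"
    and le: "\<And>m. card {y \<in> J. cyc_pos n j y \<le> m} \<le> card {x \<in> I. cyc_pos n j x \<le> m}"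
  shows "gale_le n j I J"
  unfolding gale_le_def list_all2_conv_all_nth
proof (intro conjI allI impI)
  let ?k = "cyc_pos n j"
  let ?xs = "sorted_key_list_of_set ?k I" and ?ys = "sorted_key_list_of_set ?k J"
  note x = gale_list[OF I, of j] and y = gale_list[OF J, of j]
  show "length ?xs = length ?ys" using x y card by simp
  fix l assume l: "l < length ?xs"
  show "cyc_le n j (?xs ! l) (?ys ! l)"
  proof (rule ccontr)
    assume "\<not> cyc_le n j (?xs ! l) (?ys ! l)"
    then have lt: "?k (?ys ! l) < ?k (?xs ! l)" by (simp add: cyc_le_def)
    let ?m = "?k (?ys ! l)"
    have fin: "finite I" "finite J" using I J finite_subset by blast+
    have dy: "distinct ?ys" using y(3) by (simp add: distinct_map)
    have ly: "l < length ?ys" using l x y card by simp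
    have "set (take (Suc l) ?ys) \<subseteq> {b \<in> J. ?k b \<le> ?m}"
    proof
      fix b assume "b \<in> set (take (Suc l) ?ys)"
      then obtain m where m: "m \<le> l" "b = ?ys ! m" using ly by (auto simp: in_set_conv_nth less_Suc_eq_le)
      then have "?k b \<le> ?m" using sorted_nth_mono[OF y(2), of m l] ly by simp
      moreover have "b \<in> J" using m ly y(1) nth_mem[of m ?ys] by simp
      ultimately show "b \<in> {b \<in> J. ?k b \<le> ?m}" by simp
    qed
    then have "card (set (take (Suc l) ?ys)) \<le> card {b \<in> J. ?k b \<le> ?m}"
      using fin by (intro card_mono) auto
    moreover have "card (set (take (Suc l) ?ys)) = Suc l"
      using distinct_card[OF distinct_take[OF dy]] ly by simp
    moreover have "{a \<in> I. ?k a \<le> ?m} \<subseteq> set (take l ?xs)"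
    proof
      fix a assume a: "a \<in> {a \<in> I. ?k a \<le> ?m}"
      then obtain m where m: "m < length ?xs" "a = ?xs ! m" using x(1) by (metis (no_types, lifting) in_set_conv_nth mem_Collect_eq)
      have "m < l"
      proof (rule ccontr)
        assume "\<not> m < l"
        then have "?k (?xs ! l) \<le> ?k a" using sorted_nth_mono[OF x(2), of l m] m l by simp
        then show False using a lt by simp
      qed
      then show "a \<in> set (take l ?xs)" using m by (auto simp: in_set_conv_nth)
    qed
    then have "card {a \<in> I. ?k a \<le> ?m} \<le> card (set (take l ?xs))"
      by (intro card_mono) auto
    moreover have "card (set (take l ?xs)) \<le> l" using card_length[of "take l ?xs"] by simp
    ultimately show False using le[of ?m] by simp
  qed
qed

section \<open>Open positroid varieties in terms of spans of cyclic intervals\<close>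

lemma bounded_affine_inv:
  assumes f: "f \<in> bounded_affine k n"
  shows "inv_into UNIV f (f a) = a" "f (inv_into UNIV f b) = b" "inv_into UNIV f (b + int n) = inv_into UNIV f b + int n"
    "b - int n \<le> inv_into UNIV f b" "inv_into UNIV f b \<le> b" "f (a + int n) = f a + int n" "bij f"
proof -
  have bij: "bij f" and per: "\<And>a. f (a + int n) = f a + int n"
    and bd: "\<And>a. a \<le> f a" "\<And>a. f a \<le> a + int n"
    using f by (auto simp: bounded_affine_def affine_permutation_def)
  show "bij f" "f (a + int n) = f a + int n" by fact+
  show 1: "inv_into UNIV f (f a) = a" for a using bij by (simp add: bij_is_inj)
  show 2: "f (inv_into UNIV f b) = b" for b using bij by (simp add: bij_is_surj surj_f_inv_f)
  show "inv_into UNIV f (b + int n) = inv_into UNIV f b + int n" using 1[of "inv_into UNIV f b + int n"] per[of "inv_into UNIV f b"] 2[of b] by simp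
  show "b - int n \<le> inv_into UNIV f b" "inv_into UNIV f b \<le> b" using bd[of "inv_into UNIV f b"] 2[of b] by auto
qed

context
  fixes k n :: nat and f :: "int \<Rightarrow> int"
  assumes n: "n > 0" and f: "f \<in> bounded_affine k n"
begin

text \<open>The target necklace lifted to the window starting at \<open>j\<close>, where the order
  from \<open>j\<close> on becomes the usual order of integers. For a configuration belonging to f
  it is the greedy basis: the positions whose vector is not in the span of the preceding vectors of
  the window.\<close>

definition basis_lift :: "int \<Rightarrow> int set" where
  "basis_lift j = {b \<in> {j..<j + int n}. inv_into UNIV f b < j}"

lemma necklace_lift: "necklace n f j = residue n ` basis_lift j"
proof -
  have "{f a |a. a < j \<and> f a \<ge> j} = basis_lift j"
  proof (intro equalityI subsetI)
    fix b assume "b \<in> {f a |a. a < j \<and> f a \<ge> j}"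
    then obtain a where "b = f a" "a < j" "f a \<ge> j" by blast
    then show "b \<in> basis_lift j"
      using bounded_affine_inv(1)[OF f, of a] bounded_affine_inv(4)[OF f, of b] by (auto simp: basis_lift_def)
  next
    fix b assume "b \<in> basis_lift j"
    then show "b \<in> {f a |a. a < j \<and> f a \<ge> j}"
      using bounded_affine_inv(2)[OF f, of b] by (auto simp: basis_lift_def intro!: exI[of _ "inv_into UNIV f b"])
  qed
  then show ?thesis by (simp add: necklace_def)
qed

lemma necklace_range: "necklace n f j \<subseteq> {1..int n}"
  unfolding necklace_lift using residue_range[OF n] by blast

lemma residue_inj_window: "inj_on (residue n) {j..<j + int n}"
proof (rule inj_onI)
  fix a b assume ab: "a \<in> {j..<j + int n}" "b \<in> {j..<j + int n}" "residue n a = residue n b"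
  then have "(a - j) mod int n = (b - j) mod int n"
    unfolding residue_eq_iff by (metis mod_diff_left_eq)
  then show "a = b" using ab by simp
qed

lemma cyc_pos_residue:
  assumes "b \<in> {j..<j + int n}"
  shows "cyc_pos n j (residue n b) = b - j"
proof -
  have "(residue n b - j) mod int n = (b - j) mod int n"
    using residue_mod[of n b] by (metis mod_diff_left_eq)
  then show ?thesis using assms by (simp add: cyc_pos_def)
qed

lemma lift_exists:
  assumes "a \<in> {1..int n}"
  obtains b where "b \<in> {j..<j + int n}" "residue n b = a"
proof -
  let ?b = "j + (a - j) mod int n"
  have "?b mod int n = a mod int n" by (simp add: mod_add_right_eq)
  then have "residue n ?b = a" using residue_eq_iff[of n ?b a] residue_id[OF assms] by simp
  moreover have "?b \<in> {j..<j + int n}" using n by simp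
  ultimately show ?thesis using that by blast
qed

text \<open>The positroid conditions refer to \<open>j\<close> in one period, whereas intervals of
  integers may start anywhere.\<close>

lemma necklace_shift:
  shows "necklace n f (j + m * int n) = necklace n f j" "gale_le n (j + m * int n) = gale_le n j"
proof -
  have "basis_lift (j + m * int n) = (\<lambda>b. b + m * int n) ` basis_lift j"
  proof (intro equalityI subsetI)
    fix b assume "b \<in> basis_lift (j + m * int n)"
    moreover have "inv_into UNIV f (b - m * int n) = inv_into UNIV f b - m * int n"
      using shift_equivariant[of "inv_into UNIV f" n b "- m", OF bounded_affine_inv(3)[OF f]] by simp
    ultimately have "b - m * int n \<in> basis_lift j" by (auto simp: basis_lift_def)
    then show "b \<in> (\<lambda>b. b + m * int n) ` basis_lift j" by (rule rev_image_eqI) simp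
  next
    fix b assume "b \<in> (\<lambda>b. b + m * int n) ` basis_lift j"
    then show "b \<in> basis_lift (j + m * int n)"
      using shift_equivariant[of "inv_into UNIV f" n _ m, OF bounded_affine_inv(3)[OF f]] by (auto simp: basis_lift_def)
  qed
  moreover have "residue n (b + m * int n) = residue n b" for b by (simp add: residue_eq_iff)
  ultimately show "necklace n f (j + m * int n) = necklace n f j"
    unfolding necklace_lift by (simp add: image_image)
  have "cyc_pos n (j + m * int n) a = cyc_pos n j a" for a
  proof -
    have "a - (j + m * int n) = a - j + (- m) * int n" by simp
    then show ?thesis unfolding cyc_pos_def by (metis mod_mult_self1)
  qed
  then have "cyc_pos n (j + m * int n) = cyc_pos n j" by blast
  then show "gale_le n (j + m * int n) = gale_le n j"
    by (intro ext) (simp add: gale_le_def cyc_le_def[abs_def])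
qed

text \<open>Expand \<open>v b\<close> in the necklace basis at \<open>j\<close> by Cramer's rule.
  When \<open>b\<close> is not in the lifted basis, a nonzero coefficient at a later basis element
  would give a nonzero minor for the set in which that element is exchanged for \<open>b\<close>;
  this contradicts Gale minimality. So such a column depends on earlier basis columns, while a basis
  column is independent of everything before it in the window.\<close>

lemma config_of_gale_minimal:
  assumes A: "A \<in> carrier_mat k n"
    and nz: "\<And>j. j \<in> {1..int n} \<Longrightarrow> minor A (necklace n f j) \<noteq> 0"
    and min: "\<And>j J. j \<in> {1..int n} \<Longrightarrow> J \<in> ksubsets k n \<Longrightarrow> minor A J \<noteq> 0 \<Longrightarrow>
      gale_le n j (necklace n f j) J"
  shows "cv.config n (inv_into UNIV f) (columns A)"
proof -
  let ?v = "columns A"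
  have vp: "?v (a + int n) = ?v a" for a by (rule columns_periodic[OF A])
  have vres: "?v (residue n a) = ?v a" for a by (rule residue_periodic) (rule vp)
  have nz': "minor A (necklace n f j) \<noteq> 0"
    and min': "J \<in> ksubsets k n \<Longrightarrow> minor A J \<noteq> 0 \<Longrightarrow> gale_le n j (necklace n f j) J" for j J
  proof -
    obtain m where m: "residue n j = j + m * int n" using mod_eq_shift[OF residue_mod] by blast
    show "minor A (necklace n f j) \<noteq> 0"
      "J \<in> ksubsets k n \<Longrightarrow> minor A J \<noteq> 0 \<Longrightarrow> gale_le n j (necklace n f j) J"
      using nz[OF residue_range[OF n, of j]] min[OF residue_range[OF n, of j], of J] necklace_shift[of j m]
      unfolding m by auto
  qed
  have main: "?v b \<in> cv.span (?v ` {j..<b}) \<longleftrightarrow> j \<le> inv_into UNIV f b" if b: "b \<in> {j..<j + int n}" for j b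
  proof -
    let ?B = "necklace n f j"
    have B: "?B \<in> ksubsets k n" by (rule minor_nonzero_ksubset[OF A necklace_range nz'])
    let ?u = "\<lambda>l. ?v (enum ?B l)"
    have D: "coldet k ?u \<noteq> 0" using nz'[of j] minor_coldet[OF A B] by simp
    have bij: "bij_betw (enum ?B) {..<k} ?B" by (rule enum_bij[OF B])
    have up: "?v b \<in> cv.span (?v ` {y \<in> basis_lift j. y < b})" if b: "b \<in> {j..<j + int n}" "j \<le> inv_into UNIV f b" for b
    proof -
      have notin: "residue n b \<notin> ?B"
      proof
        assume "residue n b \<in> ?B"
        then obtain b' where "b' \<in> basis_lift j" "residue n b = residue n b'"
          unfolding necklace_lift by blast
        then have "b = b'" using residue_inj_window[of j] b(1) by (auto simp: inj_on_def basis_lift_def)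
        then show False using \<open>b' \<in> basis_lift j\<close> b(2) by (simp add: basis_lift_def)
      qed
      have "?v b \<in> cv.span (?u ` {..<k})"
        by (rule coldet_nonzero_span[OF D]) (simp_all add: columns_supp[OF A])
      note exp = cramer[OF D this]
      have "(\<lambda>r. coldet k (?u(l := ?v b)) / coldet k ?u * ?u l r)
          \<in> cv.span (?v ` {y \<in> basis_lift j. y < b})" if l: "l < k" for l
      proof -
        have "enum ?B l \<in> ?B" using bij l by (auto simp: bij_betw_def)
        then obtain y where y: "y \<in> basis_lift j" "enum ?B l = residue n y"
          unfolding necklace_lift by blast
        show ?thesis
        proof (cases "y < b")
          case True
          then have "?u l \<in> ?v ` {y \<in> basis_lift j. y < b}" using y vres[of y] by auto
          then show ?thesis by (intro cv.span_scale cv.span_base)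
        next
          case False
          moreover have "y \<noteq> b" using y b by (auto simp: basis_lift_def)
          ultimately have lt: "cyc_pos n j (residue n b) < cyc_pos n j (enum ?B l)"
            using y b cyc_pos_residue[of b j] cyc_pos_residue[of y j] by (auto simp: basis_lift_def)
          let ?J = "insert (residue n b) (?B - {enum ?B l})"
          have "card ?J = k"
            using B notin card_Suc_Diff1[OF ksubsets_finite[OF B] \<open>enum ?B l \<in> ?B\<close>] ksubsets_finite[OF B]
            by (simp add: ksubsets_def)
          then have J: "?J \<in> ksubsets k n"
            using necklace_range residue_range[OF n, of b] by (auto simp: ksubsets_def)
          have "\<not> gale_le n j ?B ?J"
            by (rule not_gale_le_exchange[OF necklace_range \<open>enum ?B l \<in> ?B\<close> residue_range[OF n] notin lt])
          then have mJ: "minor A ?J = 0" using min'[OF J] by blast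
          let ?c = "(enum ?B)(l := residue n b)"
          have im: "?c ` {..<k} = ?J"
          proof -
            have "?c ` {..<k} = insert (residue n b) (enum ?B ` ({..<k} - {l}))" using l by auto
            also have "enum ?B ` ({..<k} - {l}) = ?B - {enum ?B l}"
              using bij l by (auto simp: bij_betw_def inj_on_def)
            finally show ?thesis .
          qed
          have "?c m \<in> {1..int n}" if "m < k" for m
          proof -
            have "?c m \<in> ?c ` {..<k}" using that by (intro imageI) simp
            then have "?c m \<in> ?J" unfolding im .
            moreover have "?J \<subseteq> {1..int n}" using J by (simp only: ksubsets_def mem_Collect_eq)
            ultimately show ?thesis by (rule subsetD[rotated])
          qed
          then have rc: "residue n (?c m) = ?c m" if "m < k" for m using that residue_id by blast
          have "card (?c ` {..<k}) = card {..<k}" using im \<open>card ?J = k\<close> by simp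
          then have "inj_on ?c {..<k}" by (simp add: eq_card_imp_inj_on)
          then have inj: "inj_on (\<lambda>m. residue n (?c m)) {..<k}" using rc by (auto simp: inj_on_def)
          have im': "(\<lambda>m. residue n (?c m)) ` {..<k} = ?J" using im rc by auto
          obtain s :: complex where s: "\<And>w. (\<And>a. w (a + int n) = w a) \<Longrightarrow>
            coldet k (\<lambda>m. w (?c m)) = s * coldet k (\<lambda>m. w (enum ?J m))"
            using coldet_reorder[OF J inj im'] by blast
          have "coldet k (?u(l := ?v b)) = coldet k (\<lambda>m. ?v (?c m))"
            by (rule coldet_cong) (simp add: vres)
          also have "\<dots> = 0" using s[of ?v, OF vp] mJ minor_coldet[OF A J] by simp
          finally show ?thesis using cv.span_zero by (simp add: zero_fun_def)
        qed
      qed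
      then have "(\<Sum>l<k. (\<lambda>r. coldet k (?u(l := ?v b)) / coldet k ?u * ?u l r))
          \<in> cv.span (?v ` {y \<in> basis_lift j. y < b})"
        by (intro cv.span_sum) auto
      then show ?thesis using exp by simp
    qed
    show ?thesis
    proof
      assume "j \<le> inv_into UNIV f b"
      then have "?v b \<in> cv.span (?v ` {y \<in> basis_lift j. y < b})" using up b by blast
      then show "?v b \<in> cv.span (?v ` {j..<b})"
        by (rule cv.span_image_mono) (auto simp: basis_lift_def)
    next
      assume sp: "?v b \<in> cv.span (?v ` {j..<b})"
      show "j \<le> inv_into UNIV f b"
      proof (rule ccontr)
        assume "\<not> j \<le> inv_into UNIV f b"
        then have bB: "b \<in> basis_lift j" using b by (simp add: basis_lift_def)
        let ?S = "{y \<in> basis_lift j. y < b}"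
        \<comment> \<open>Every column of the interval reduces to basis columns before
          \<open>b\<close>, so a dependence of \<open>v b\<close> on the interval would be a
          dependence inside the basis.\<close>
        have "?v ` {j..<b} \<subseteq> cv.span (?v ` ?S)"
        proof
          fix x assume "x \<in> ?v ` {j..<b}"
          then obtain y where y: "j \<le> y" "y < b" "x = ?v y" by auto
          show "x \<in> cv.span (?v ` ?S)"
          proof (cases "j \<le> inv_into UNIV f y")
            case True
            have "y \<in> {j..<j + int n}" using y b by auto
            from up[OF this True] have "?v y \<in> cv.span (?v ` {z \<in> basis_lift j. z < y})" .
            then show ?thesis unfolding y(3) by (rule cv.span_image_mono) (use y in auto)
          next
            case False
            then have "y \<in> ?S" using y b by (auto simp: basis_lift_def)
            then show ?thesis unfolding y(3) by (intro cv.span_base imageI)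
          qed
        qed
        then have "cv.span (?v ` {j..<b}) \<subseteq> cv.span (?v ` ?S)"
          by (rule cv.span_minimal[OF _ cv.subspace_span])
        then have in_S: "?v b \<in> cv.span (?v ` ?S)" using sp by (rule subsetD)
        have "residue n b \<in> ?B" using bB necklace_lift by blast
        then obtain l where l: "l < k" "enum ?B l = residue n b"
          using bij unfolding bij_betw_def by (metis imageE lessThan_iff)
        have "?v ` ?S \<subseteq> ?u ` ({..<k} - {l})"
        proof
          fix x assume "x \<in> ?v ` ?S"
          then obtain y where y: "y \<in> basis_lift j" "y < b" "x = ?v y" by blast
          then have "residue n y \<in> ?B" using necklace_lift by blast
          then obtain m where m: "m < k" "enum ?B m = residue n y"
            using bij unfolding bij_betw_def by (metis imageE lessThan_iff)
          have "residue n y \<noteq> residue n b"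
          proof
            assume "residue n y = residue n b"
            then have "y = b"
              by (rule inj_onD[OF residue_inj_window[of j]]) (use y(1) bB in \<open>auto simp: basis_lift_def\<close>)
            then show False using y(2) by simp
          qed
          then have "m \<noteq> l" using m l by auto
          moreover have "x = ?u m" using m y vres by simp
          ultimately show "x \<in> ?u ` ({..<k} - {l})" using m by blast
        qed
        then have "cv.span (?v ` ?S) \<subseteq> cv.span (?u ` ({..<k} - {l}))" by (rule cv.span_mono)
        then have "?v b \<in> cv.span (?u ` ({..<k} - {l}))" using in_S by (rule subsetD)
        then have "?u l \<in> cv.span (?u ` ({..<k} - {l}))" using l vres[of b] by simp
        then show False using coldet_nonzero_notin_span[OF D l(1)] by simp
      qed
    qed
  qed
  have "?v b \<in> cv.span (?v ` {j..<b}) \<longleftrightarrow> j \<le> inv_into UNIV f b" if jb: "j \<le> b" for j b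
  proof (cases "b < j + int n")
    case True
    then show ?thesis using main jb by simp
  next
    case False
    have "?v b = ?v (b - int n)" using vp[of "b - int n"] by simp
    then have "?v b \<in> ?v ` {j..<b}" using False n by auto
    then have "?v b \<in> cv.span (?v ` {j..<b})" by (rule cv.span_base)
    then show ?thesis using False bounded_affine_inv(4)[OF f, of b] by simp
  qed
  then show ?thesis unfolding cv.config_def using vp by blast
qed

text \<open>The span conditions make \<open>basis_lift j\<close> the greedy basis of the window: its
  members are new to the columns before them, all other columns reduce to earlier ones. A nonzero
  minor provides k independent columns, which forces the basis to have k elements.\<close>

lemma config_basis:
  assumes A: "A \<in> carrier_mat k n" and rank: "\<exists>J \<in> ksubsets k n. minor A J \<noteq> 0"
    and v: "cv.config n (inv_into UNIV f) (columns A)"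
  shows "y \<in> {j..<j + int n} \<Longrightarrow> columns A y \<in> cv.span (columns A ` {z \<in> basis_lift j. z \<le> y})"
    and "necklace n f j \<in> ksubsets k n" and "minor A (necklace n f j) \<noteq> 0"
proof -
  let ?v = "columns A"
  have vp: "?v (a + int n) = ?v a" for a by (rule columns_periodic[OF A])
  have vres: "?v (residue n a) = ?v a" for a by (rule residue_periodic) (rule vp)
  have up: "j \<le> y \<longrightarrow> y < j + int n \<longrightarrow> ?v y \<in> cv.span (?v ` {z \<in> basis_lift j. z \<le> y})" for y
  proof (induction "nat (y - j)" arbitrary: y rule: less_induct)
    case less
    show ?case
    proof (intro impI)
      assume y: "j \<le> y" "y < j + int n"
      show "?v y \<in> cv.span (?v ` {z \<in> basis_lift j. z \<le> y})"
      proof (cases "inv_into UNIV f y < j")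
        case True
        then have "y \<in> {z \<in> basis_lift j. z \<le> y}" using y by (simp add: basis_lift_def)
        then show ?thesis by (intro cv.span_base imageI)
      next
        case False
        then have "?v y \<in> cv.span (?v ` {j..<y})" using cv.configD[OF v, of j y] y by simp
        moreover have "?v ` {j..<y} \<subseteq> cv.span (?v ` {z \<in> basis_lift j. z \<le> y})"
        proof
          fix x assume "x \<in> ?v ` {j..<y}"
          then obtain z where z: "j \<le> z" "z < y" "x = ?v z" by auto
          have "?v z \<in> cv.span (?v ` {z' \<in> basis_lift j. z' \<le> z})"
            using less.hyps[of z] z y by simp
          then show "x \<in> cv.span (?v ` {z \<in> basis_lift j. z \<le> y})"
            unfolding z(3) by (rule cv.span_image_mono) (use z in auto)
        qed
        then have "cv.span (?v ` {j..<y}) \<subseteq> cv.span (?v ` {z \<in> basis_lift j. z \<le> y})"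
          by (rule cv.span_minimal[OF _ cv.subspace_span])
        ultimately show ?thesis by (rule subsetD[rotated])
      qed
    qed
  qed
  then show "y \<in> {j..<j + int n} \<Longrightarrow> ?v y \<in> cv.span (?v ` {z \<in> basis_lift j. z \<le> y})" by simp
  have fin: "finite (basis_lift j)"
    by (rule finite_subset[of _ "{j..<j + int n}"]) (auto simp: basis_lift_def)
  \<comment> \<open>Elements are added in increasing order; each new vector is outside the span of
    the window before it.\<close>
  have ind: "cv.independent (?v ` S) \<and> inj_on ?v S" if "S \<subseteq> basis_lift j" "finite S" for S
    using that(2,1)
  proof (induction S rule: finite_linorder_max_induct)
    case empty
    then show ?case by (simp add: cv.dependent_def)
  next
    case (insert b S)
    then have IH: "cv.independent (?v ` S)" "inj_on ?v S" by auto
    have b: "j \<le> b" "inv_into UNIV f b < j" using insert by (auto simp: basis_lift_def)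
    have "?v b \<notin> cv.span (?v ` {j..<b})" using cv.configD[OF v b(1)] b(2) by simp
    moreover have "S \<subseteq> {j..<b}" using insert by (auto simp: basis_lift_def)
    then have "cv.span (?v ` S) \<subseteq> cv.span (?v ` {j..<b})" by (intro cv.span_mono image_mono)
    ultimately have nb: "?v b \<notin> cv.span (?v ` S)" by blast
    then have "?v b \<notin> ?v ` S" using cv.span_base[of "?v b" "?v ` S"] by argo
    then show ?case using IH nb insert(2) by (auto simp: cv.independent_insert)
  qed
  from ind[OF subset_refl fin] have B: "cv.independent (?v ` basis_lift j)" "inj_on ?v (basis_lift j)" by auto
  have inj: "inj_on (residue n) (basis_lift j)"
    using residue_inj_window[of j] by (rule inj_on_subset) (auto simp: basis_lift_def)
  have "card (?v ` basis_lift j) \<le> k"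
    by (rule independent_supported_card(2)[OF B(1)]) (auto simp: columns_supp[OF A])
  then have le: "card (basis_lift j) \<le> k" using card_image[OF B(2)] by simp
  obtain J where J: "J \<in> ksubsets k n" "minor A J \<noteq> 0" using rank by blast
  then have DJ: "coldet k (\<lambda>l. ?v (enum J l)) \<noteq> 0" using minor_coldet[OF A] by simp
  let ?C = "(\<lambda>l. ?v (enum J l)) ` {..<k}"
  have "?C \<subseteq> cv.span (?v ` basis_lift j)"
  proof
    fix x assume "x \<in> ?C"
    then obtain l where l: "l < k" "x = ?v (enum J l)" by auto
    have "enum J l \<in> J" using bij_betwE[OF enum_bij[OF J(1)]] l(1) by blast
    moreover have "J \<subseteq> {1..int n}" using J(1) by (simp add: ksubsets_def)
    ultimately have "enum J l \<in> {1..int n}" by (rule subsetD[rotated])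
    then obtain b where b: "b \<in> {j..<j + int n}" "residue n b = enum J l" by (rule lift_exists)
    have "?v b \<in> cv.span (?v ` {z \<in> basis_lift j. z \<le> b})" using up b(1) by simp
    then have "?v b \<in> cv.span (?v ` basis_lift j)" by (rule cv.span_image_mono) auto
    then show "x \<in> cv.span (?v ` basis_lift j)" using l b vres[of b] by simp
  qed
  from cv.independent_span_bound[OF _ coldet_nonzero_independent[OF DJ] this]
  have "card ?C \<le> card (?v ` basis_lift j)" using fin by simp
  then have ge: "k \<le> card (basis_lift j)"
    using card_image[OF coldet_nonzero_inj[OF DJ]] card_image[OF B(2)] by simp
  have "card (necklace n f j) = k" using le ge card_image[OF inj] unfolding necklace_lift by simp
  then show N: "necklace n f j \<in> ksubsets k n" using necklace_range by (simp add: ksubsets_def)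
  have vN: "?v ` necklace n f j = ?v ` basis_lift j" unfolding necklace_lift image_image vres ..
  have bij: "bij_betw (enum (necklace n f j)) {..<k} (necklace n f j)" by (rule enum_bij[OF N])
  have "coldet k (\<lambda>l. ?v (enum (necklace n f j) l)) \<noteq> 0"
  proof
    assume "coldet k (\<lambda>l. ?v (enum (necklace n f j) l)) = 0"
    then obtain l where l: "l < k" "?v (enum (necklace n f j) l) \<in>
        cv.span ((\<lambda>l. ?v (enum (necklace n f j) l)) ` ({..<k} - {l}))"
      by (rule coldet_zero_in_span) (simp add: columns_supp[OF A])
    have injN: "inj_on ?v (necklace n f j)"
      unfolding necklace_lift using B(2) vres by (auto simp: inj_on_def)
    have enl: "enum (necklace n f j) l \<in> necklace n f j" using bij l by (auto simp: bij_betw_def)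
    have "(\<lambda>l. ?v (enum (necklace n f j) l)) ` ({..<k} - {l}) =
        ?v ` basis_lift j - {?v (enum (necklace n f j) l)}"
    proof -
      have "enum (necklace n f j) ` ({..<k} - {l}) = necklace n f j - {enum (necklace n f j) l}"
        using bij l by (auto simp: bij_betw_def inj_on_def)
      then have "(\<lambda>l. ?v (enum (necklace n f j) l)) ` ({..<k} - {l}) = ?v ` (necklace n f j - {enum (necklace n f j) l})"
        by (metis image_image)
      also have "\<dots> = ?v ` necklace n f j - ?v ` {enum (necklace n f j) l}"
        using injN enl by (intro inj_on_image_set_diff[of ?v "necklace n f j"]) auto
      finally show ?thesis using vN by simp
    qed
    moreover have "?v (enum (necklace n f j) l) \<in> ?v ` basis_lift j" using enl vN by blast
    ultimately have "cv.dependent (?v ` basis_lift j)"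
      unfolding cv.dependent_def using l(2) by (intro bexI[of _ "?v (enum (necklace n f j) l)"]) simp_all
    then show False using B(1) by simp
  qed
  then show "minor A (necklace n f j) \<noteq> 0" using minor_coldet[OF A N] by simp
qed

text \<open>The columns of J up to cyclic position m are independent and lie in the span of the
  necklace columns up to the same position, so there are at most as many of them.\<close>

lemma gale_minimal_of_config:
  assumes A: "A \<in> carrier_mat k n" and J: "J \<in> ksubsets k n" "minor A J \<noteq> 0"
    and v: "cv.config n (inv_into UNIV f) (columns A)"
  shows "gale_le n j (necklace n f j) J"
proof (rule gale_le_of_counts)
  let ?v = "columns A"
  have vp: "?v (a + int n) = ?v a" for a by (rule columns_periodic[OF A])
  have vres: "?v (residue n a) = ?v a" for a by (rule residue_periodic) (rule vp)
  have rank: "\<exists>J \<in> ksubsets k n. minor A J \<noteq> 0" using J by blast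
  note basis = config_basis[OF A rank v, where j = j]
  show "necklace n f j \<subseteq> {1..int n}" by (rule necklace_range)
  show Jr: "J \<subseteq> {1..int n}" using J by (simp add: ksubsets_def)
  show "card (necklace n f j) = card J" using J basis(2) by (simp add: ksubsets_def)
  fix m
  let ?S = "{y \<in> J. cyc_pos n j y \<le> m}" and ?T = "{x \<in> necklace n f j. cyc_pos n j x \<le> m}"
  have DJ: "coldet k (\<lambda>l. ?v (enum J l)) \<noteq> 0" using minor_coldet[OF A] J by simp
  have bij: "bij_betw (enum J) {..<k} J" by (rule enum_bij[OF J(1)])
  have im: "(\<lambda>l. ?v (enum J l)) ` {..<k} = ?v ` J"
    using bij unfolding bij_betw_def by (metis image_image)
  have indJ: "cv.independent (?v ` J)" using coldet_nonzero_independent[OF DJ] im by simp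
  have "inj_on (?v \<circ> enum J) {..<k}" using coldet_nonzero_inj[OF DJ] by (simp add: comp_def)
  then have injJ: "inj_on ?v J" using bij by (metis bij_betw_def inj_on_imageI)
  have "cv.independent (?v ` ?S)" by (rule cv.independent_mono[OF indJ]) auto
  moreover have "?v ` ?S \<subseteq> cv.span (?v ` ?T)"
  proof
    fix x assume "x \<in> ?v ` ?S"
    then obtain y where y: "y \<in> J" "cyc_pos n j y \<le> m" "x = ?v y" by blast
    have "y \<in> {1..int n}" using y Jr by blast
    then obtain b where b: "b \<in> {j..<j + int n}" "residue n b = y" by (rule lift_exists)
    have "b - j \<le> m" using cyc_pos_residue[OF b(1)] b(2) y(2) by simp
    have "?v ` {z \<in> basis_lift j. z \<le> b} \<subseteq> ?v ` ?T"
    proof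
      fix w assume "w \<in> ?v ` {z \<in> basis_lift j. z \<le> b}"
      then obtain z where z: "z \<in> basis_lift j" "z \<le> b" "w = ?v z" by blast
      have "cyc_pos n j (residue n z) \<le> m"
        using cyc_pos_residue[of z j] z \<open>b - j \<le> m\<close> by (simp add: basis_lift_def)
      then have "residue n z \<in> ?T" using z necklace_lift by blast
      then show "w \<in> ?v ` ?T" using z(3) vres[of z] by (metis imageI)
    qed
    then have "cv.span (?v ` {z \<in> basis_lift j. z \<le> b}) \<subseteq> cv.span (?v ` ?T)" by (rule cv.span_mono)
    moreover have "?v b \<in> cv.span (?v ` {z \<in> basis_lift j. z \<le> b})" by (rule basis(1)[OF b(1)])
    ultimately have "?v b \<in> cv.span (?v ` ?T)" by (rule subsetD)
    then show "x \<in> cv.span (?v ` ?T)" using y(3) b(2) vres[of b] by simp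
  qed
  moreover have finT: "finite ?T" using necklace_range[of j] finite_subset by fastforce
  ultimately have "card (?v ` ?S) \<le> card (?v ` ?T)"
    using cv.independent_span_bound[of "?v ` ?T" "?v ` ?S"] by simp
  also have "\<dots> \<le> card ?T" using finT by (rule card_image_le)
  finally show "card ?S \<le> card ?T"
    using card_image[OF inj_on_subset[OF injJ, of ?S]] by simp
qed

end

section \<open>Points of the Grassmannian\<close>

text \<open>The row vector y^T A. The coefficients are a function, to match the type of
  \<open>columns\<close>; only its values below k enter.\<close>

definition row_comb :: "nat \<Rightarrow> nat \<Rightarrow> complex mat \<Rightarrow> (nat \<Rightarrow> complex) \<Rightarrow> complex vec" where
  "row_comb k n A y = vec n (\<lambda>j. \<Sum>r<k. A $$ (r, j) * y r)"

definition rows_indep :: "nat \<Rightarrow> nat \<Rightarrow> complex mat \<Rightarrow> bool" where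
  "rows_indep k n A \<longleftrightarrow> (\<forall>y. row_comb k n A y = 0\<^sub>v n \<longrightarrow> (\<forall>r<k. y r = 0))"

lemma row_comb_vec:
  assumes "A \<in> carrier_mat k n"
  shows "row_comb k n A y = transpose_mat A *\<^sub>v vec k y"
proof (rule eq_vecI)
  fix j assume "j < dim_vec (transpose_mat A *\<^sub>v vec k y)"
  then show "row_comb k n A y $ j = (transpose_mat A *\<^sub>v vec k y) $ j"
    using assms by (simp add: row_comb_def scalar_prod_def atLeast0LessThan)
qed (use assms in \<open>simp add: row_comb_def\<close>)

lemma row_comb_mult:
  assumes "A \<in> carrier_mat k n" "y \<in> carrier_vec k"
  shows "transpose_mat A *\<^sub>v y = row_comb k n A (($) y)"
proof -
  have "vec k (($) y) = y" using assms(2) by (intro eq_vecI) auto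
  then show ?thesis unfolding row_comb_vec[OF assms(1)] by simp
qed

lemma row_space_row_comb:
  assumes A: "A \<in> carrier_mat k n"
  shows "vec_space.row_space n A = range (row_comb k n A)"
proof -
  interpret vec_space "TYPE(complex)" n .
  have "row_space A = {w\<in>carrier_vec n. \<exists>y\<in>carrier_vec k. transpose_mat A *\<^sub>v y = w}"
    using row_space_eq[OF A] A by simp
  also have "\<dots> = range (row_comb k n A)"
  proof (intro equalityI subsetI)
    fix w assume "w \<in> range (row_comb k n A)"
    then obtain y where y: "w = row_comb k n A y" by blast
    have "w \<in> carrier_vec n" unfolding y row_comb_def by simp
    moreover have "transpose_mat A *\<^sub>v vec k y = w" using row_comb_vec[OF A] y by simp
    ultimately show "w \<in> {w\<in>carrier_vec n. \<exists>y\<in>carrier_vec k. transpose_mat A *\<^sub>v y = w}"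
      by (intro CollectI conjI bexI[of _ "vec k y"]) auto
  next
    fix w assume "w \<in> {w\<in>carrier_vec n. \<exists>y\<in>carrier_vec k. transpose_mat A *\<^sub>v y = w}"
    then obtain y where "y \<in> carrier_vec k" "transpose_mat A *\<^sub>v y = w" by blast
    then have "w = row_comb k n A (($) y)" using row_comb_mult[OF A] by simp
    then show "w \<in> range (row_comb k n A)" by blast
  qed
  finally show ?thesis .
qed

lemma row_comb_columns:
  assumes A: "A \<in> carrier_mat k n" and n: "n > 0"
  shows "row_comb k n A y = 0\<^sub>v n \<longleftrightarrow> (\<forall>a. (\<Sum>r<k. columns A a r * y r) = 0)"
proof
  assume 0: "row_comb k n A y = 0\<^sub>v n"
  show "\<forall>a. (\<Sum>r<k. columns A a r * y r) = 0"
  proof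
    fix a :: int
    let ?j = "nat ((a - 1) mod int n)"
    have j: "?j < n" using n by (simp add: nat_less_iff)
    then have "row_comb k n A y $ ?j = 0" using 0 by simp
    then show "(\<Sum>r<k. columns A a r * y r) = 0"
      using A j by (simp add: row_comb_def columns_def)
  qed
next
  assume 0: "\<forall>a. (\<Sum>r<k. columns A a r * y r) = 0"
  show "row_comb k n A y = 0\<^sub>v n"
  proof (rule eq_vecI)
    fix j assume "j < dim_vec (0\<^sub>v n :: complex vec)"
    then have "j < n" by simp
    then have "(\<Sum>r<k. columns A (int j + 1) r * y r) = (\<Sum>r<k. A $$ (r, j) * y r)"
      using A by (intro sum.cong) (auto simp: columns_def)
    then show "row_comb k n A y $ j = 0\<^sub>v n $ j" using 0 \<open>j < n\<close> by (simp add: row_comb_def)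
  qed (simp add: row_comb_def)
qed

lemma coldet_kernel:
  assumes "coldet k u \<noteq> 0" "\<And>l. l < k \<Longrightarrow> (\<Sum>r<k. u l r * y r) = 0" "r < k"
  shows "y r = 0"
proof (rule ccontr)
  assume "y r \<noteq> 0"
  let ?M = "mat k k (\<lambda>(l, r). u l r)"
  have "vec k y \<noteq> 0\<^sub>v k" using \<open>y r \<noteq> 0\<close> assms(3) by (metis index_vec index_zero_vec(1))
  moreover have "?M *\<^sub>v vec k y = 0\<^sub>v k"
    by (rule eq_vecI) (use assms(2) in \<open>auto simp: scalar_prod_def atLeast0LessThan\<close>)
  ultimately have "det ?M = 0"
    using det_0_iff_vec_prod_zero_field[of ?M k] vec_carrier[of k y] mat_carrier by blast
  then show False using assms(1) by (simp add: coldet_def)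
qed

lemma coldet_zero_kernel:
  assumes "coldet k u = 0"
  shows "\<exists>y. (\<forall>l<k. (\<Sum>r<k. u l r * y r) = 0) \<and> (\<exists>r<k. y r \<noteq> 0)"
proof -
  let ?M = "mat k k (\<lambda>(l, r). u l r)"
  obtain y where y: "y \<in> carrier_vec k" "y \<noteq> 0\<^sub>v k" "?M *\<^sub>v y = 0\<^sub>v k"
    using det_0_iff_vec_prod_zero_field[of ?M k] assms by (auto simp: coldet_def)
  then obtain r where r: "r < k" "y $ r \<noteq> 0"
    by (metis carrier_vecD eq_vecI index_zero_vec(1) index_zero_vec(2))
  have "(\<Sum>r<k. u l r * y $ r) = 0" if "l < k" for l
  proof -
    have "(?M *\<^sub>v y) $ l = (\<Sum>r<k. u l r * y $ r)"
      using that y(1) by (simp add: scalar_prod_def atLeast0LessThan)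
    then show ?thesis using y(3) that by simp
  qed
  then show ?thesis using r by (intro exI[of _ "($) y"]) auto
qed

text \<open>Row rank against column rank. If a maximal independent set of columns has k elements, it
  gives a nonzero minor. If it is smaller, padding with zero vectors gives a singular matrix, and a
  kernel vector of it annihilates all columns, which is a relation among the rows.\<close>

lemma rows_indep_iff_minor:
  assumes A: "A \<in> carrier_mat k n" and n: "n > 0"
  shows "rows_indep k n A \<longleftrightarrow> (\<exists>J \<in> ksubsets k n. minor A J \<noteq> 0)"
proof
  assume "\<exists>J \<in> ksubsets k n. minor A J \<noteq> 0"
  then obtain J where J: "J \<in> ksubsets k n" "minor A J \<noteq> 0" by blast
  show "rows_indep k n A"
    unfolding rows_indep_def row_comb_columns[OF A n]
    using coldet_kernel[OF J(2)[unfolded minor_coldet[OF A J(1)]]] by blast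
next
  assume ind: "rows_indep k n A"
  let ?C = "columns A ` {1..int n}"
  obtain B where B: "B \<subseteq> ?C" "cv.independent B" "?C \<subseteq> cv.span B"
    by (rule cv.maximal_independent_subset)
  have supp: "x r = 0" if "x \<in> B" "k \<le> r" for x r
    using that B(1) columns_supp[OF A] by auto
  have fin: "finite B" and card: "card B \<le> k" using independent_supported_card[of B k, OF B(2)] supp by auto
  obtain e where e: "bij_betw e {..<card B} B"
    using ex_bij_betw_nat_finite[OF fin] by (auto simp: atLeast0LessThan)
  have allC: "columns A a \<in> cv.span B" for a
  proof -
    have "columns A (residue n a) \<in> ?C" using residue_range[OF n] by blast
    then show ?thesis using B(3) residue_periodic[of "columns A" n, OF columns_periodic[OF A]] by auto
  qed
  show "\<exists>J \<in> ksubsets k n. minor A J \<noteq> 0"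
  proof (cases "card B = k")
    case True
    have "\<forall>l\<in>{..<k}. \<exists>a\<in>{1..int n}. e l = columns A a"
      using e B(1) True unfolding bij_betw_def by blast
    then obtain c where c: "\<And>l. l < k \<Longrightarrow> c l \<in> {1..int n} \<and> e l = columns A (c l)"
      by (metis lessThan_iff)
    have einj: "inj_on e {..<k}" "e ` {..<k} = B" using e True by (auto simp: bij_betw_def)
    have nz: "coldet k (\<lambda>l. columns A (c l)) \<noteq> 0"
    proof
      assume "coldet k (\<lambda>l. columns A (c l)) = 0"
      then obtain l where l: "l < k"
        "columns A (c l) \<in> cv.span ((\<lambda>l. columns A (c l)) ` ({..<k} - {l}))"
        by (rule coldet_zero_in_span) (simp add: columns_supp[OF A])
      have "(\<lambda>l. columns A (c l)) ` ({..<k} - {l}) = B - {e l}"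
      proof -
        have "(\<lambda>l. columns A (c l)) ` ({..<k} - {l}) = e ` ({..<k} - {l})"
          using c by (intro image_cong) auto
        also have "\<dots> = e ` {..<k} - e ` {l}" using einj(1) l(1) by (intro inj_on_image_set_diff[of e "{..<k}"]) auto
        finally show ?thesis using einj by simp
      qed
      moreover have "e l \<in> B" using einj l by blast
      ultimately have "\<exists>a\<in>B. a \<in> cv.span (B - {a})" using l c by (intro bexI[of _ "e l"]) simp_all
      then show False using B(2) by (simp add: cv.dependent_def)
    qed
    have inj: "inj_on (\<lambda>l. residue n (c l)) {..<k}"
      using einj(1) c by (auto simp: inj_on_def residue_id)
    let ?J = "(\<lambda>l. residue n (c l)) ` {..<k}"
    have J: "?J \<in> ksubsets k n"
      using residue_range[OF n] card_image[OF inj] by (auto simp: ksubsets_def)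
    from coldet_reorder[OF J inj refl] obtain s :: complex where
      "\<And>w. (\<And>a. w (a + int n) = w a) \<Longrightarrow> coldet k (\<lambda>l. w (c l)) = s * coldet k (\<lambda>l. w (enum ?J l))"
      by blast
    from this[of "columns A", OF columns_periodic[OF A]] have "minor A ?J \<noteq> 0"
      using nz minor_coldet[OF A J] by auto
    then show ?thesis using J by blast
  next
    case False
    define u where "u l = (if l < card B then e l else 0)" for l
    have "coldet k u = 0"
    proof -
      have l: "card B < k" using False card by simp
      have "u = u(card B := \<lambda>r. 0 * (0 :: nat \<Rightarrow> complex) r + 0 * (0 :: nat \<Rightarrow> complex) r)"
        by (auto simp: u_def fun_eq_iff)
      then show ?thesis using coldet_linear[OF l, of u 0 0 0 0] by simp
    qed
    from coldet_zero_kernel[OF this] obtain y r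
      where y: "\<forall>l<k. (\<Sum>r<k. u l r * y r) = 0" "r < k" "y r \<noteq> 0" by auto
    let ?S = "{x :: nat \<Rightarrow> complex. (\<Sum>r<k. x r * y r) = 0}"
    have "B \<subseteq> ?S"
    proof
      fix x assume "x \<in> B"
      then obtain l where "l < card B" "x = e l" using e by (auto simp: bij_betw_def)
      then show "x \<in> ?S" using y(1)[rule_format, of l] card by (simp add: u_def)
    qed
    moreover have "cv.subspace ?S"
      by (rule cv.subspaceI) (simp_all add: distrib_right sum.distrib mult.assoc flip: sum_distrib_left)
    ultimately have "cv.span B \<subseteq> ?S" by (rule cv.span_minimal)
    then have "\<forall>a. columns A a \<in> ?S" using allC by (meson subsetD)
    then have "row_comb k n A y = 0\<^sub>v n" unfolding row_comb_columns[OF A n] by simp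
    then have "y r = 0" using ind y(2) unfolding rows_indep_def by metis
    then show ?thesis using y(3) by simp
  qed
qed

text \<open>Bridge to the carrier-based linear algebra in which the Grassmannian is defined.
  Distinctness appears because the set of rows forgets repetitions.\<close>

lemma rows_indep_iff_lin_indpt:
  assumes A: "A \<in> carrier_mat k n"
  shows "rows_indep k n A \<longleftrightarrow> distinct (rows A) \<and>
    \<not> module.lin_dep class_ring (module_vec TYPE(complex) n) (set (rows A))"
proof -
  interpret vec_space "TYPE(complex)" n .
  have At: "transpose_mat A \<in> carrier_mat n k" using A by simp
  show ?thesis
  proof
    assume ind: "rows_indep k n A"
    have d: "distinct (rows A)"
    proof (rule ccontr)
      assume "\<not> distinct (rows A)"
      then obtain r s where rs: "r < k" "s < k" "r \<noteq> s" "row A r = row A s"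
        using A by (auto simp: distinct_conv_nth)
      define y :: "nat \<Rightarrow> complex" where "y t = (if t = r then 1 else if t = s then -1 else 0)" for t
      have "row_comb k n A y = 0\<^sub>v n"
      proof (rule eq_vecI)
        fix j assume "j < dim_vec (0\<^sub>v n :: complex vec)"
        then have j: "j < n" by simp
        have "A $$ (r, j) = A $$ (s, j)"
          using rs A j by (metis carrier_matD(1) carrier_matD(2) index_row(1))
        moreover have "(\<Sum>t<k. A $$ (t, j) * y t) = (\<Sum>t\<in>{r, s}. A $$ (t, j) * y t)"
          by (rule sum.mono_neutral_right) (use rs(1,2) in \<open>auto simp: y_def\<close>)
        moreover have "(\<Sum>t\<in>{r, s}. A $$ (t, j) * y t) = A $$ (r, j) - A $$ (s, j)"
          using rs(3) by (simp add: y_def)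
        moreover have "row_comb k n A y $ j = (\<Sum>t<k. A $$ (t, j) * y t)"
          using j by (simp add: row_comb_def)
        ultimately show "row_comb k n A y $ j = 0\<^sub>v n $ j" using j by (simp only: index_zero_vec diff_self)
      qed (simp add: row_comb_def)
      then have "y r = 0" using ind rs(1) unfolding rows_indep_def by blast
      then show False by (simp add: y_def)
    qed
    moreover have "\<not> lin_dep (set (rows A))"
    proof
      assume "lin_dep (set (rows A))"
      then obtain v where v: "v \<in> carrier_vec k" "v \<noteq> 0\<^sub>v k" "transpose_mat A *\<^sub>v v = 0\<^sub>v n"
        using lin_depE[OF At] d by (auto simp: cols_transpose)
      then have "\<forall>r<k. v $ r = 0" using ind row_comb_mult[OF A v(1)] unfolding rows_indep_def by simp
      then show False using v(1,2) by auto
    qed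
    ultimately show "distinct (rows A) \<and> \<not> lin_dep (set (rows A))" by blast
  next
    assume *: "distinct (rows A) \<and> \<not> lin_dep (set (rows A))"
    show "rows_indep k n A" unfolding rows_indep_def
    proof (intro allI impI, rule ccontr)
      fix y r assume y: "row_comb k n A y = 0\<^sub>v n" "r < k" "y r \<noteq> 0"
      have "vec k y \<noteq> 0\<^sub>v k" using y(2,3) by (metis index_vec index_zero_vec(1))
      then have "lin_dep (set (cols (transpose_mat A)))"
        by (intro lin_depI[OF At, of "vec k y"]) (use y(1) row_comb_vec[OF A] * in \<open>auto simp: cols_transpose\<close>)
      then show False using * by (simp add: cols_transpose)
    qed
  qed
qed

lemma grassmannian_row_space:
  assumes A: "A \<in> carrier_mat k n" and ind: "rows_indep k n A"
  shows "vec_space.row_space n A \<in> grassmannian k n"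
proof -
  interpret vec_space "TYPE(complex)" n .
  have R: "set (rows A) \<subseteq> carrier_vec n" using A by (auto simp: rows_def)
  have li: "distinct (rows A)" "lin_indpt (set (rows A))"
    using ind rows_indep_iff_lin_indpt[OF A] by auto
  have "subspace class_ring (row_space A) V"
    unfolding row_space_def using span_is_subspace R by simp
  moreover have "vectorspace.dim class_ring (vs (row_space A)) = k"
  proof -
    have "maximal (set (rows A)) (\<lambda>T. T \<subseteq> set (rows A) \<and> lin_indpt T)"
      using li unfolding maximal_def by blast
    from dim_span[OF _ _ this] R have "vectorspace.dim class_ring (vs (row_space A)) = card (set (rows A))"
      unfolding row_space_def by simp
    then show ?thesis using distinct_card[OF li(1)] A by simp
  qed
  ultimately show ?thesis unfolding grassmannian_def by simp
qed

lemma grassmannian_obtain: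
  assumes V: "V \<in> grassmannian k n"
  obtains A where "A \<in> carrier_mat k n" "rows_indep k n A" "vec_space.row_space n A = V"
proof -
  interpret vec_space "TYPE(complex)" n .
  let ?M = "module_vec TYPE(complex) n"
  have sub: "subspace class_ring V ?M" and dim: "vectorspace.dim class_ring (vs V) = k"
    using V unfolding grassmannian_def by auto
  have smod: "submodule class_ring V ?M" using sub by (simp add: subspace_def)
  have VC: "V \<subseteq> carrier_vec n" using smod by (auto simp: submodule_def)
  interpret W: vectorspace class_ring "vs V" using subspace_is_vs[OF sub] .
  have Wli: "W.lin_dep S = lin_dep S" "W.span S = span S" if "S \<subseteq> V" for S
    using span_li_not_depend[OF that smod] by auto
  let ?P = "\<lambda>S. S \<subseteq> V \<and> lin_indpt S"
  have fin: "finite S \<and> card S \<le> n" if "?P S" for S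
    using li_le_dim[of S] that VC dim_is_n by auto
  have "?P {}" by (simp add: lin_dep_def)
  then obtain B where B: "finite B" "maximal B ?P"
    using maximal_exists[of ?P n "{}"] fin by blast
  then have P: "?P B" by (simp add: maximal_def)
  have "maximal B (\<lambda>S. S \<subseteq> carrier (vs V) \<and> W.lin_indpt S)"
    using B(2) Wli(1) unfolding maximal_def by auto
  then have basis: "W.basis B" using W.max_li_is_basis[of B] B(1) P Wli by auto
  then have "card B = k" using W.dim_basis[OF B(1)] dim by simp
  obtain bs where bs: "set bs = B" "distinct bs" using finite_distinct_list[OF B(1)] by blast
  let ?A = "mat_of_rows n bs"
  have A: "?A \<in> carrier_mat k n" using bs \<open>card B = k\<close> distinct_card by fastforce
  have rows: "rows ?A = bs" using rows_mat_of_rows[of bs n] bs P VC by auto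
  have "row_space ?A = span B" unfolding row_space_def rows bs ..
  also have "\<dots> = V" using basis Wli(2)[of B] P unfolding W.basis_def by simp
  finally have "row_space ?A = V" .
  moreover have "rows_indep k n ?A" unfolding rows_indep_iff_lin_indpt[OF A] rows bs using bs P by simp
  ultimately show ?thesis using that A by blast
qed

lemma representative:
  assumes V: "V \<in> grassmannian k n"
  shows "representative k n V \<in> carrier_mat k n" "vec_space.row_space n (representative k n V) = V"
proof -
  obtain A where "A \<in> carrier_mat k n" "vec_space.row_space n A = V"
    using grassmannian_obtain[OF V] by blast
  then have "\<exists>A. A \<in> carrier_mat k n \<and> vec_space.row_space n A = V" by blast
  from someI_ex[OF this] show "representative k n V \<in> carrier_mat k n"
    "vec_space.row_space n (representative k n V) = V"
    unfolding representative_def by auto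
qed

text \<open>The rows of A are combinations of the rows of B, and \<open>l\<close> is the determinant
  of the coefficients. Only an inclusion is assumed, so \<open>l\<close> may be 0; what matters is
  that it is common to all sequences \<open>c\<close>.\<close>

lemma minor_proportional:
  assumes n: "n > 0" and A: "A \<in> carrier_mat k n" and B: "B \<in> carrier_mat k n"
    and sub: "vec_space.row_space n A \<subseteq> vec_space.row_space n B"
  obtains l where "\<And>c. coldet k (\<lambda>m. columns A (c m)) = l * coldet k (\<lambda>m. columns B (c m))"
proof -
  have "\<exists>y. row A r = row_comb k n B y" if r: "r < k" for r
  proof -
    interpret vec_space "TYPE(complex)" n .
    have "row A r \<in> row_space A"
      unfolding row_space_def by (rule span_mem) (use A r in \<open>auto simp: rows_def\<close>)
    then have "row A r \<in> range (row_comb k n B)" using sub row_space_row_comb[OF B] by blast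
    then show ?thesis by blast
  qed
  then obtain g where g: "\<And>r. r < k \<Longrightarrow> row A r = row_comb k n B (g r)" by metis
  let ?G = "mat k k (\<lambda>(s, r). g r s)"
  have entry: "columns A a r = (\<Sum>s<k. columns B a s * g r s)" if r: "r < k" for a r
  proof -
    let ?j = "nat ((a - 1) mod int n)"
    have j: "?j < n" using n by (simp add: nat_less_iff)
    have "columns A a r = row A r $ ?j" using A r j by (simp add: columns_def)
    also have "\<dots> = (\<Sum>s<k. B $$ (s, ?j) * g r s)" using g[OF r] j by (simp add: row_comb_def)
    also have "\<dots> = (\<Sum>s<k. columns B a s * g r s)" using B by (intro sum.cong) (auto simp: columns_def)
    finally show ?thesis .
  qed
  have "coldet k (\<lambda>m. columns A (c m)) = det ?G * coldet k (\<lambda>m. columns B (c m))" for c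
  proof -
    have "mat k k (\<lambda>(m, r). columns A (c m) r) = mat k k (\<lambda>(m, s). columns B (c m) s) * ?G"
      by (rule eq_matI) (auto simp: entry scalar_prod_def atLeast0LessThan)
    then show ?thesis unfolding coldet_def by (simp add: det_mult[of _ k] mult.commute)
  qed
  then show ?thesis using that by blast
qed

section \<open>Rearranging two columns of a point of the Grassmannian\<close>

definition matrix_of :: "nat \<Rightarrow> nat \<Rightarrow> (int \<Rightarrow> nat \<Rightarrow> complex) \<Rightarrow> complex mat" where
  "matrix_of k n v = mat k n (\<lambda>(r, j). v (int j + 1) r)"

lemma matrix_of_carrier [simp]: "matrix_of k n v \<in> carrier_mat k n"
  by (simp add: matrix_of_def)

lemma columns_matrix_of:
  assumes n: "n > 0" and v: "\<And>a. v (a + int n) = v a" and supp: "\<And>a r. k \<le> r \<Longrightarrow> v a r = 0"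
  shows "columns (matrix_of k n v) = v"
proof (intro ext)
  fix a r
  have "int (nat ((a - 1) mod int n)) + 1 = residue n a" using n by (simp add: residue_def)
  then show "columns (matrix_of k n v) a r = v a r"
    using residue_periodic[of v n a, OF v] supp n
    by (auto simp: columns_def matrix_of_def nat_less_iff)
qed

lemma matrix_of_columns:
  assumes "A \<in> carrier_mat k n"
  shows "matrix_of k n (columns A) = A"
  by (rule eq_matI) (use assms in \<open>auto simp: matrix_of_def columns_def\<close>)

abbreviation mtwist :: "nat \<Rightarrow> nat \<Rightarrow> int \<Rightarrow> int \<Rightarrow> complex \<Rightarrow> complex mat \<Rightarrow> complex mat" where
  "mtwist k n i x t A \<equiv> matrix_of k n (cv.twist n i x t (columns A))"

lemma columns_mtwist:
  assumes "n > 0" "A \<in> carrier_mat k n"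
  shows "columns (mtwist k n i x t A) = cv.twist n i x t (columns A)"
proof (rule columns_matrix_of[OF assms(1)])
  show "cv.twist n i x t (columns A) (a + int n) = cv.twist n i x t (columns A) a" for a
    by (rule cv.twist_periodic) (rule columns_periodic[OF assms(2)])
  show "cv.twist n i x t (columns A) a r = 0" if "k \<le> r" for a r
    using columns_supp[OF assms(2) that] by (simp add: cv.twist_def)
qed

text \<open>The column operation as a map of row vectors: in this form it acts on subspaces without
  reference to a matrix.\<close>

definition vtwist :: "nat \<Rightarrow> int \<Rightarrow> int \<Rightarrow> complex \<Rightarrow> complex vec \<Rightarrow> complex vec" where
  "vtwist n i x t y = vec n (\<lambda>j. y $ nat ((simple_refl n i (int j + 1) - 1) mod int n) +
     (if (int j + 1) mod int n = x mod int n then t * y $ j else 0))"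

definition gtwist :: "nat \<Rightarrow> int \<Rightarrow> int \<Rightarrow> complex \<Rightarrow> complex vec set \<Rightarrow> complex vec set" where
  "gtwist n i x t V = vtwist n i x t ` V"

lemma row_space_mtwist:
  assumes n: "n > 0" and A: "A \<in> carrier_mat k n"
  shows "vec_space.row_space n (mtwist k n i x t A) = gtwist n i x t (vec_space.row_space n A)"
proof -
  have "row_comb k n (mtwist k n i x t A) y = vtwist n i x t (row_comb k n A y)" for y
  proof (rule eq_vecI)
    fix j assume "j < dim_vec (vtwist n i x t (row_comb k n A y))"
    then have j: "j < n" by (simp add: vtwist_def)
    have col: "row_comb k n A y $ nat ((a - 1) mod int n) = (\<Sum>r<k. columns A a r * y r)" for a
    proof -
      have "nat ((a - 1) mod int n) < n" using n by (simp add: nat_less_iff)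
      then show ?thesis using A by (simp add: row_comb_def columns_def)
    qed
    have "row_comb k n (mtwist k n i x t A) y $ j =
        (\<Sum>r<k. cv.twist n i x t (columns A) (int j + 1) r * y r)"
      using j by (simp add: row_comb_def matrix_of_def)
    also have "\<dots> = (\<Sum>r<k. columns A (simple_refl n i (int j + 1)) r * y r) +
        (if (int j + 1) mod int n = x mod int n then t * (\<Sum>r<k. columns A (int j + 1) r * y r) else 0)"
      by (simp add: cv.twist_def distrib_right sum.distrib sum_distrib_left mult.assoc)
    also have "\<dots> = vtwist n i x t (row_comb k n A y) $ j"
      using j col[of "simple_refl n i (int j + 1)"] col[of "int j + 1"] by (simp add: vtwist_def)
    finally show "row_comb k n (mtwist k n i x t A) y $ j = vtwist n i x t (row_comb k n A y) $ j" .
  qed (simp add: row_comb_def vtwist_def)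
  then show ?thesis
    unfolding gtwist_def row_space_row_comb[OF A] row_space_row_comb[OF matrix_of_carrier] image_image
    by simp
qed

lemma mtwist_mtwist:
  assumes n: "n \<ge> 2" and A: "A \<in> carrier_mat k n"
  shows "mtwist k n i i t (mtwist k n i (i + 1) (- t) A) = A"
    and "mtwist k n i (i + 1) (- t) (mtwist k n i i t A) = A"
  using n by (simp_all add: columns_mtwist[OF _ A] cv.twist_twist[OF n] matrix_of_columns[OF A])

lemma gtwist_gtwist:
  assumes n: "n \<ge> 2" and V: "V \<in> grassmannian k n"
  shows "gtwist n i i t (gtwist n i (i + 1) (- t) V) = V"
    and "gtwist n i (i + 1) (- t) (gtwist n i i t V) = V"
proof -
  note A = representative[OF V]
  have n0: "n > 0" using n by simp
  show "gtwist n i i t (gtwist n i (i + 1) (- t) V) = V" "gtwist n i (i + 1) (- t) (gtwist n i i t V) = V"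
    using row_space_mtwist[OF n0 A(1)] row_space_mtwist[OF n0 matrix_of_carrier, of k]
      mtwist_mtwist[OF n A(1)] A(2) by metis+
qed

lemma rows_indep_representative:
  assumes n: "n > 0" and V: "V \<in> grassmannian k n"
  shows "rows_indep k n (representative k n V)"
proof -
  obtain A where A: "A \<in> carrier_mat k n" "rows_indep k n A" "vec_space.row_space n A = V"
    using grassmannian_obtain[OF V] by blast
  note R = representative[OF V]
  obtain l where l: "\<And>c. coldet k (\<lambda>m. columns A (c m)) =
      l * coldet k (\<lambda>m. columns (representative k n V) (c m))"
    using minor_proportional[OF n A(1) R(1)] A(3) R(2) by auto
  obtain J where J: "J \<in> ksubsets k n" "minor A J \<noteq> 0"
    using A(2) rows_indep_iff_minor[OF A(1) n] by blast
  then have "minor (representative k n V) J \<noteq> 0"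
    using l[of "enum J"] minor_coldet[OF A(1) J(1)] minor_coldet[OF R(1) J(1)] by auto
  then show ?thesis using rows_indep_iff_minor[OF R(1) n] J(1) by blast
qed

lemma representative_proportional:
  assumes n: "n > 0" and B: "B \<in> carrier_mat k n" "rows_indep k n B" "vec_space.row_space n B = V"
  obtains l where "l \<noteq> 0"
    "\<And>c. coldet k (\<lambda>m. columns (representative k n V) (c m)) = l * coldet k (\<lambda>m. columns B (c m))"
proof -
  have V: "V \<in> grassmannian k n" using grassmannian_row_space B by blast
  note R = representative[OF V]
  obtain l where l: "\<And>c. coldet k (\<lambda>m. columns (representative k n V) (c m)) =
      l * coldet k (\<lambda>m. columns B (c m))"
    using minor_proportional[OF n R(1) B(1)] B(3) R(2) by auto
  obtain J where J: "J \<in> ksubsets k n" "minor (representative k n V) J \<noteq> 0"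
    using rows_indep_representative[OF n V] rows_indep_iff_minor[OF R(1) n] by blast
  then have "l \<noteq> 0" using l[of "enum J"] minor_coldet[OF R(1) J(1)] by auto
  then show ?thesis using that l by blast
qed

lemma rows_indep_mtwist:
  assumes n: "n \<ge> 2" and A: "A \<in> carrier_mat k n" "rows_indep k n A" and x: "x = i \<or> x = i + 1"
  shows "rows_indep k n (mtwist k n i x t A)"
proof -
  have n0: "n > 0" using n by simp
  let ?w = "cv.twist n i x t (columns A)"
  \<comment> \<open>\<open>x'\<close> is the other one of i and i + 1: the inverse twist writes the
    old columns as combinations of the new ones, so a relation among the new rows is one among the
    old rows.\<close>
  obtain x' where x': "columns A = cv.twist n i x' (- t) ?w"
    using x cv.twist_twist[OF n, of i t] cv.twist_twist[OF n, of i "- t"] by (metis minus_minus)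
  show ?thesis
    unfolding rows_indep_def row_comb_columns[OF matrix_of_carrier n0] columns_mtwist[OF n0 A(1)]
  proof (intro allI impI)
    fix y r assume 0: "\<forall>a. (\<Sum>r<k. ?w a r * y r) = 0" and r: "r < k"
    have "(\<Sum>r<k. columns A a r * y r) = 0" for a
    proof -
      have "(\<Sum>r<k. columns A a r * y r) = (\<Sum>r<k. ?w (simple_refl n i a) r * y r) +
        (if a mod int n = x' mod int n then - t * (\<Sum>r<k. ?w a r * y r) else 0)"
        by (subst x') (simp add: cv.twist_def[of n i x'] distrib_right sum.distrib sum_distrib_left mult.assoc
          sum_negf)
      then show ?thesis using 0 by simp
    qed
    then show "y r = 0" using A(2) r unfolding rows_indep_def row_comb_columns[OF A(1) n0] by blast
  qed
qed

text \<open>The representative of the new subspace is chosen independently of that of V. Matrices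
  with the same row space and independent rows differ by an invertible row operation, whence a
  factor that depends on V and t but is common to all coordinates.\<close>

lemma gtwist_grassmannian:
  assumes n: "n \<ge> 2" and V: "V \<in> grassmannian k n" and x: "x = i \<or> x = i + 1"
  shows "gtwist n i x t V \<in> grassmannian k n"
    and "\<exists>l. l \<noteq> 0 \<and> (\<forall>c. coldet k (\<lambda>m. columns (representative k n (gtwist n i x t V)) (c m)) =
      l * coldet k (\<lambda>m. cv.twist n i x t (columns (representative k n V)) (c m)))"
proof -
  have n0: "n > 0" using n by simp
  note R = representative[OF V]
  let ?B = "mtwist k n i x t (representative k n V)"
  have ind: "rows_indep k n ?B"
    by (rule rows_indep_mtwist[OF n R(1) rows_indep_representative[OF n0 V] x])
  have rs: "vec_space.row_space n ?B = gtwist n i x t V" using row_space_mtwist[OF n0 R(1)] R(2) by simp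
  show "gtwist n i x t V \<in> grassmannian k n" using grassmannian_row_space[OF matrix_of_carrier ind] rs by simp
  show "\<exists>l. l \<noteq> 0 \<and> (\<forall>c. coldet k (\<lambda>m. columns (representative k n (gtwist n i x t V)) (c m)) =
      l * coldet k (\<lambda>m. cv.twist n i x t (columns (representative k n V)) (c m)))"
    using representative_proportional[OF n0 matrix_of_carrier ind rs] columns_mtwist[OF n0 R(1)] by metis
qed

text \<open>The positions have distinct residues, so at most one slot is congruent to x. Linearity
  in that slot leaves a single correction term.\<close>

lemma coldet_twist:
  assumes inj: "inj_on (\<lambda>m. residue n (c m)) {..<k}"
  shows "(\<forall>m<k. c m mod int n \<noteq> x mod int n) \<Longrightarrow>
      coldet k (\<lambda>m. cv.twist n i x t v (c m)) = coldet k (\<lambda>m. v (simple_refl n i (c m)))"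
    and "m\<^sub>0 < k \<Longrightarrow> c m\<^sub>0 mod int n = x mod int n \<Longrightarrow>
      coldet k (\<lambda>m. cv.twist n i x t v (c m)) = coldet k (\<lambda>m. v (simple_refl n i (c m))) +
        t * coldet k (\<lambda>m. v (if m = m\<^sub>0 then c m else simple_refl n i (c m)))"
proof -
  assume "\<forall>m<k. c m mod int n \<noteq> x mod int n"
  then show "coldet k (\<lambda>m. cv.twist n i x t v (c m)) = coldet k (\<lambda>m. v (simple_refl n i (c m)))"
    by (intro coldet_cong) (simp add: cv.twist_def)
next
  assume m0: "m\<^sub>0 < k" "c m\<^sub>0 mod int n = x mod int n"
  have other: "c m mod int n \<noteq> x mod int n" if "m < k" "m \<noteq> m\<^sub>0" for m
  proof
    assume "c m mod int n = x mod int n"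
    then have "residue n (c m) = residue n (c m\<^sub>0)" using m0 by (simp add: residue_eq_iff)
    then show False using inj m0(1) that by (auto simp: inj_on_def)
  qed
  let ?u = "\<lambda>m. v (simple_refl n i (c m))"
  have "coldet k (\<lambda>m. cv.twist n i x t v (c m)) =
      coldet k (?u(m\<^sub>0 := \<lambda>r. 1 * ?u m\<^sub>0 r + t * v (c m\<^sub>0) r))"
    by (intro coldet_cong) (use other m0 in \<open>auto simp: cv.twist_def\<close>)
  also have "\<dots> = 1 * coldet k (?u(m\<^sub>0 := ?u m\<^sub>0)) + t * coldet k (?u(m\<^sub>0 := v (c m\<^sub>0)))"
    by (rule coldet_linear[OF m0(1)])
  also have "?u(m\<^sub>0 := ?u m\<^sub>0) = ?u" by (auto simp: fun_eq_iff)
  also have "?u(m\<^sub>0 := v (c m\<^sub>0)) = (\<lambda>m. v (if m = m\<^sub>0 then c m else simple_refl n i (c m)))"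
    by (auto simp: fun_eq_iff)
  finally show "coldet k (\<lambda>m. cv.twist n i x t v (c m)) = coldet k (\<lambda>m. v (simple_refl n i (c m))) +
        t * coldet k (\<lambda>m. v (if m = m\<^sub>0 then c m else simple_refl n i (c m)))" by simp
qed

lemma enum_residue_inj:
  assumes "J \<in> ksubsets k n"
  shows "inj_on (\<lambda>m. residue n (enum J m)) {..<k}"
proof -
  have "residue n (enum J m) = enum J m" if "m < k" for m
  proof -
    have "enum J m \<in> J" using enum_bij[OF assms] that by (auto simp: bij_betw_def)
    then show ?thesis using assms by (auto simp: ksubsets_def intro: residue_id)
  qed
  moreover have "inj_on (enum J) {..<k}" using enum_bij[OF assms] by (simp add: bij_betw_def)
  ultimately show ?thesis by (auto simp: inj_on_def)
qed

text \<open>The constants and subsets are chosen before A and t. This is what makes the coordinates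
  of the twisted point, up to a common factor, regular in the point and the parameter.\<close>

lemma twisted_minor_form:
  assumes kn: "k \<le> n" "n > 0" and J: "J \<in> ksubsets k n"
  shows "\<exists>s\<^sub>1 J\<^sub>1 s\<^sub>2 J\<^sub>2. J\<^sub>1 \<in> ksubsets k n \<and> J\<^sub>2 \<in> ksubsets k n \<and>
    (\<forall>A t. A \<in> carrier_mat k n \<longrightarrow> coldet k (\<lambda>m. cv.twist n i x t (columns A) (enum J m)) =
      s\<^sub>1 * minor A J\<^sub>1 + t * (s\<^sub>2 * minor A J\<^sub>2))"
proof -
  from coldet_columns_form[OF kn, where c = "\<lambda>m. simple_refl n i (enum J m)"]
  obtain s1 J1 where 1: "J1 \<in> ksubsets k n" "\<And>A. A \<in> carrier_mat k n \<Longrightarrow>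
    coldet k (\<lambda>m. columns A (simple_refl n i (enum J m))) = s1 * minor A J1" by blast
  note tw = coldet_twist[OF enum_residue_inj[OF J]]
  show ?thesis
  proof (cases "\<forall>m<k. enum J m mod int n \<noteq> x mod int n")
    case True
    then show ?thesis
      by (intro exI[of _ s1] exI[of _ J1] exI[of _ 0] exI[of _ J1]) (use 1 tw(1) in auto)
  next
    case False
    then obtain m0 where m0: "m0 < k" "enum J m0 mod int n = x mod int n" by blast
    from coldet_columns_form[OF kn,
        where c = "\<lambda>m. if m = m0 then enum J m else simple_refl n i (enum J m)"]
    obtain s2 J2 where 2: "J2 \<in> ksubsets k n" "\<And>A. A \<in> carrier_mat k n \<Longrightarrow>
      coldet k (\<lambda>m. columns A (if m = m0 then enum J m else simple_refl n i (enum J m))) = s2 * minor A J2"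
      by blast
    show ?thesis
      by (intro exI[of _ s1] exI[of _ J1] exI[of _ s2] exI[of _ J2]) (use 1 2 tw(2)[OF m0] in auto)
  qed
qed

lemma plucker_coldet:
  assumes "V \<in> grassmannian k n" "J \<in> ksubsets k n"
  shows "plucker k n J V = coldet k (\<lambda>m. columns (representative k n V) (enum J m))"
  unfolding plucker_def by (rule minor_coldet[OF representative(1)[OF assms(1)] assms(2)])

lemma plucker_gtwist_form:
  assumes n: "n \<ge> 2" and k: "k \<le> n" and x: "x = i \<or> x = i + 1"
  shows "\<exists>s\<^sub>1 J\<^sub>1 s\<^sub>2 J\<^sub>2. \<forall>J \<in> ksubsets k n. J\<^sub>1 J \<in> ksubsets k n \<and> J\<^sub>2 J \<in> ksubsets k n \<and>
    (\<forall>A t. A \<in> carrier_mat k n \<longrightarrow> coldet k (\<lambda>m. cv.twist n i x t (columns A) (enum J m)) =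
      s\<^sub>1 J * minor A (J\<^sub>1 J) + t * (s\<^sub>2 J * minor A (J\<^sub>2 J)))"
proof -
  have "\<forall>J \<in> ksubsets k n. \<exists>s\<^sub>1 J\<^sub>1 s\<^sub>2 J\<^sub>2. J\<^sub>1 \<in> ksubsets k n \<and> J\<^sub>2 \<in> ksubsets k n \<and>
    (\<forall>A t. A \<in> carrier_mat k n \<longrightarrow> coldet k (\<lambda>m. cv.twist n i x t (columns A) (enum J m)) =
      s\<^sub>1 * minor A J\<^sub>1 + t * (s\<^sub>2 * minor A J\<^sub>2))"
    using twisted_minor_form[OF k] n by auto
  then show ?thesis by (simp only: bchoice_iff) 
qed

text \<open>If i is not in I, there is no correction term. If i is in I, then so is i + 1, and in
  the correction term both slots contain the vector at i, so it vanishes. What remains is the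
  coordinate of \<open>refl_set n i I\<close>, up to a sign and the common factor.\<close>

lemma plucker_gtwist_nonzero:
  assumes n: "n \<ge> 2" and V: "V \<in> grassmannian k n" and I: "I \<in> ksubsets k n"
    and i: "i \<in> {1..int n}" and iI: "i \<in> I \<longrightarrow> residue n (i + 1) \<in> I"
  shows "refl_set n i I \<in> ksubsets k n"
    and "plucker k n I (gtwist n i i t V) \<noteq> 0 \<longleftrightarrow> plucker k n (refl_set n i I) V \<noteq> 0"
proof -
  have n0: "n > 0" using n by simp
  let ?s = "simple_refl n i" and ?v = "columns (representative k n V)"
  note R = representative[OF V]
  have vp: "?v (a + int n) = ?v a" for a by (rule columns_periodic[OF R(1)])
  have bij: "bij_betw (enum I) {..<k} I" by (rule enum_bij[OF I])
  have mods: "residue n (?s (residue n a)) = residue n (?s a)" for a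
    by (rule residue_periodic[where w = "\<lambda>a. residue n (?s a)"])
      (simp add: simple_refl_shift residue_eq_iff)
  have sinj: "residue n a = residue n b" if "residue n (?s a) = residue n (?s b)" for a b
    using that mods[of "?s a"] mods[of "?s b"] n by simp
  have inj: "inj_on (\<lambda>m. residue n (?s (enum I m))) {..<k}"
    using enum_residue_inj[OF I] sinj unfolding inj_on_def by blast
  have im: "(\<lambda>m. residue n (?s (enum I m))) ` {..<k} = refl_set n i I"
    using bij unfolding refl_set_def bij_betw_def by (metis image_image)
  show J: "refl_set n i I \<in> ksubsets k n"
    unfolding im[symmetric] using residue_range[OF n0] card_image[OF inj] by (auto simp: ksubsets_def)
  obtain s :: complex where s: "s \<noteq> 0" "\<And>w. (\<And>a. w (a + int n) = w a) \<Longrightarrow>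
    coldet k (\<lambda>m. w (?s (enum I m))) = s * coldet k (\<lambda>m. w (enum (refl_set n i I) m))"
    using coldet_reorder[OF J inj im] by blast
  have "coldet k (\<lambda>m. cv.twist n i i t ?v (enum I m)) = coldet k (\<lambda>m. ?v (?s (enum I m)))"
  proof (cases "\<forall>m<k. enum I m mod int n \<noteq> i mod int n")
    case True
    then show ?thesis by (rule coldet_twist(1)[OF enum_residue_inj[OF I]])
  next
    case False
    then obtain m0 where m0: "m0 < k" "enum I m0 mod int n = i mod int n" by blast
    have "enum I m0 \<in> I" using bij m0 by (auto simp: bij_betw_def)
    then have "enum I m0 = i" using m0(2) residue_eq_iff[of n "enum I m0" i] residue_id i I
      by (auto simp: ksubsets_def)
    then have "residue n (i + 1) \<in> I" using \<open>enum I m0 \<in> I\<close> iI by simp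
    then obtain m1 where m1: "m1 < k" "enum I m1 = residue n (i + 1)"
      using bij unfolding bij_betw_def by (metis imageE lessThan_iff)
    have "m1 \<noteq> m0" using m0(2) m1(2) residue_mod[of n "i + 1"] Suc_mod_neq[OF n, of i] by auto
    have eq: "?v (if m1 = m0 then enum I m1 else ?s (enum I m1)) = ?v (if m0 = m0 then enum I m0 else ?s (enum I m0))"
    proof -
      have "?v (?s (residue n (i + 1))) = ?v (?s (i + 1))"
        by (rule residue_periodic[where w = "\<lambda>a. ?v (?s a)"]) (simp add: simple_refl_shift vp)
      then show ?thesis using \<open>m1 \<noteq> m0\<close> m1 \<open>enum I m0 = i\<close> n by simp
    qed
    have "coldet k (\<lambda>m. ?v (if m = m0 then enum I m else ?s (enum I m))) = 0"
      by (rule coldet_dup[OF m1(1) m0(1) \<open>m1 \<noteq> m0\<close>]) (use eq in simp)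
    then show ?thesis using coldet_twist(2)[OF enum_residue_inj[OF I] m0, of i t ?v] by simp
  qed
  moreover obtain l where "l \<noteq> 0" "\<And>c. coldet k (\<lambda>m. columns (representative k n (gtwist n i i t V)) (c m)) =
      l * coldet k (\<lambda>m. cv.twist n i i t ?v (c m))"
    using gtwist_grassmannian(2)[OF n V, of i i t] by blast
  ultimately show "plucker k n I (gtwist n i i t V) \<noteq> 0 \<longleftrightarrow> plucker k n (refl_set n i I) V \<noteq> 0"
    using plucker_coldet[OF gtwist_grassmannian(1)[OF n V] I, of i i t] plucker_coldet[OF V J]
      s(1) s(2)[of ?v, OF vp] by simp
qed

section \<open>Regular functions on the Grassmannian\<close>

lemma function_sheaf_Gr: "function_sheaf (Gr k n)"
  and topspace_Gr: "topspace (zariski (Gr k n)) = grassmannian k n"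
proof -
  let ?F = "{(P, Q). \<exists>d. plucker_form k n d P \<and> plucker_form k n d Q}"
  have 1: "(\<lambda>_. c, \<lambda>_. 1) \<in> ?F" for c by (auto intro: plucker_form.const)
  have 2: "(\<lambda>x. p x * q' x + p' x * q x, \<lambda>x. q x * q' x) \<in> ?F \<and> (\<lambda>x. p x * p' x, \<lambda>x. q x * q' x) \<in> ?F"
    if pq: "(p, q) \<in> ?F" "(p', q') \<in> ?F" for p q p' q'
  proof -
    obtain d d' where d: "plucker_form k n d p" "plucker_form k n d q"
      "plucker_form k n d' p'" "plucker_form k n d' q'" using pq by blast
    have "plucker_form k n (d + d') (\<lambda>x. p' x * q x)"
      using plucker_form.mult[OF d(3,2)] by (simp add: add.commute)
    then show ?thesis
      using plucker_form.add[OF plucker_form.mult[OF d(1,4)]] plucker_form.mult[OF d(1,3)]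
        plucker_form.mult[OF d(2,4)] by auto
  qed
  have 3: "(q, p) \<in> ?F \<and> (q, q) \<in> ?F" if "(p, q) \<in> ?F" for p q using that by blast
  show "function_sheaf (Gr k n)" "topspace (zariski (Gr k n)) = grassmannian k n"
    unfolding Gr_def using fraction_space_sheaf[OF 1 2 3] by auto
qed

lemma openin_Gr_nonzero:
  assumes "plucker_form k n d Q"
  shows "openin (zariski (Gr k n)) {V \<in> grassmannian k n. Q V \<noteq> 0}"
proof -
  have "{V \<in> grassmannian k n. Q V \<noteq> 0} \<in> {{x \<in> grassmannian k n. q x \<noteq> 0} |p q.
      (p, q) \<in> {(P, Q). \<exists>d. plucker_form k n d P \<and> plucker_form k n d Q}}"
    using assms by blast
  then show ?thesis unfolding Gr_def fraction_space_def function_space.simps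
    by (rule topology_generated_by_Basis)
qed

lemma plucker_form_scaled:
  assumes "J \<in> ksubsets k n"
  shows "plucker_form k n 1 (\<lambda>V. s * plucker k n J V)"
  using plucker_form.mult[OF plucker_form.const plucker_form.coord[OF assms], of s] by simp

lemma regular_quotient:
  assumes P: "plucker_form k n d P" and Q: "plucker_form k n d Q"
    and nz: "\<And>V. V \<in> S \<Longrightarrow> Q V \<noteq> 0" and S: "S \<subseteq> grassmannian k n"
  shows "(\<lambda>V. P V / Q V) \<in> regular (subvariety (Gr k n) S) S"
  unfolding subvariety_def function_space.simps mem_Collect_eq
proof
  fix V assume V: "V \<in> S"
  let ?W = "{V \<in> grassmannian k n. Q V \<noteq> 0}"
  have PQ: "(P, Q) \<in> {(P, Q). \<exists>d. plucker_form k n d P \<and> plucker_form k n d Q}" using P Q by blast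
  have "(\<lambda>V. P V / Q V) \<in> regular (Gr k n) ?W"
    unfolding Gr_def fraction_space_def function_space.simps mem_Collect_eq
    by (intro ballI bexI[OF _ PQ]) auto
  then show "\<exists>W g. openin (zariski (Gr k n)) W \<and> V \<in> W \<and> g \<in> regular (Gr k n) W \<and>
      (\<forall>y \<in> S \<inter> W. P y / Q y = g y)"
    using openin_Gr_nonzero[OF Q] V nz S
    by (intro exI[of _ ?W] exI[of _ "\<lambda>V. P V / Q V"]) auto
qed

text \<open>A form of degree d scales by the d-th power of \<open>l\<close>, which cancels in
  quotients of forms of equal degree. So it is enough that the coordinates of the image are regular
  up to one common factor.\<close>

lemma (in function_sheaf) morphism_into_Gr:
  assumes im: "\<psi> ` topspace (zariski X) \<subseteq> grassmannian k n"
    and m: "\<And>J. J \<in> ksubsets k n \<Longrightarrow> m J \<in> regular X (topspace (zariski X))"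
    and l: "\<And>x. x \<in> topspace (zariski X) \<Longrightarrow> l x \<noteq> 0"
    and pl: "\<And>x J. x \<in> topspace (zariski X) \<Longrightarrow> J \<in> ksubsets k n \<Longrightarrow> plucker k n J (\<psi> x) = l x * m J x"
  shows "morphism X (Gr k n) \<psi>"
proof -
  let ?T = "topspace (zariski X)"
  note sheaf_const = const and sheaf_add = add and sheaf_mult = mult
  have form: "\<exists>M \<in> regular X ?T. \<forall>x \<in> ?T. P (\<psi> x) = l x ^ d * M x" if "plucker_form k n d P" for d P
    using that
  proof induction
    case (const c)
    have "(\<lambda>_. c) \<in> regular X ?T" by (rule sheaf_const) simp
    then show ?case by (rule bexI[rotated]) simp
  next
    case (coord J)
    show ?case by (rule bexI[OF _ m[OF coord]]) (simp add: pl[OF _ coord])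
  next
    case (add d P Q)
    then obtain M N where 1: "M \<in> regular X ?T" "\<forall>x \<in> ?T. P (\<psi> x) = l x ^ d * M x"
      "N \<in> regular X ?T" "\<forall>x \<in> ?T. Q (\<psi> x) = l x ^ d * N x" by blast
    have "(\<lambda>x. M x + N x) \<in> regular X ?T" by (rule sheaf_add) (use 1 in auto)
    then show ?case by (rule bexI[rotated]) (use 1 in \<open>simp add: distrib_left\<close>)
  next
    case (mult d P e Q)
    then obtain M N where 1: "M \<in> regular X ?T" "\<forall>x \<in> ?T. P (\<psi> x) = l x ^ d * M x"
      "N \<in> regular X ?T" "\<forall>x \<in> ?T. Q (\<psi> x) = l x ^ e * N x" by blast
    have "(\<lambda>x. M x * N x) \<in> regular X ?T" by (rule sheaf_mult) (use 1 in auto)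
    then show ?case by (rule bexI[rotated]) (use 1 in \<open>simp add: power_add\<close>)
  qed
  show ?thesis unfolding Gr_def
  proof (rule morphism_into_fraction_space[OF im])
    show "(\<lambda>_. 1, \<lambda>_. 1) \<in> {(P, Q). \<exists>d. plucker_form k n d P \<and> plucker_form k n d Q}"
      by (auto intro: plucker_form.const)
    fix p q assume "(p, q) \<in> {(P, Q). \<exists>d. plucker_form k n d P \<and> plucker_form k n d Q}"
    then obtain d where d: "plucker_form k n d p" "plucker_form k n d q" by blast
    obtain M N where "M \<in> regular X ?T" "\<forall>x \<in> ?T. p (\<psi> x) = l x ^ d * M x"
      "N \<in> regular X ?T" "\<forall>x \<in> ?T. q (\<psi> x) = l x ^ d * N x" using form[OF d(1)] form[OF d(2)] by blast
    then show "\<exists>l P Q. P \<in> regular X ?T \<and> Q \<in> regular X ?T \<and>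
      (\<forall>x \<in> ?T. l x \<noteq> 0 \<and> p (\<psi> x) = l x * P x \<and> q (\<psi> x) = l x * Q x)"
      using l by (intro exI[of _ "\<lambda>x. l x ^ d"] exI[of _ M] exI[of _ N]) auto
  qed
qed

text \<open>Separates the factor \<open>l V t\<close>, due to the choice of representatives, from an
  expression whose constants depend neither on V nor on t.\<close>

lemma plucker_gtwist:
  assumes n: "n \<ge> 2" and k: "k \<le> n" and x: "x = i \<or> x = i + 1"
  shows "\<exists>l s\<^sub>1 J\<^sub>1 s\<^sub>2 J\<^sub>2. (\<forall>J \<in> ksubsets k n. J\<^sub>1 J \<in> ksubsets k n \<and> J\<^sub>2 J \<in> ksubsets k n) \<and>
    (\<forall>V \<in> grassmannian k n. \<forall>t. l V t \<noteq> 0 \<and> (\<forall>J \<in> ksubsets k n. plucker k n J (gtwist n i x t V) =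
      l V t * (s\<^sub>1 J * plucker k n (J\<^sub>1 J) V + t * (s\<^sub>2 J * plucker k n (J\<^sub>2 J) V))))"
proof -
  obtain s1 J1 s2 J2 where J: "\<forall>J \<in> ksubsets k n. J1 J \<in> ksubsets k n \<and> J2 J \<in> ksubsets k n \<and>
    (\<forall>A t. A \<in> carrier_mat k n \<longrightarrow> coldet k (\<lambda>m. cv.twist n i x t (columns A) (enum J m)) =
      s1 J * minor A (J1 J) + t * (s2 J * minor A (J2 J)))"
    using plucker_gtwist_form[OF n k x] by blast
  have "\<forall>V t. \<exists>l. V \<in> grassmannian k n \<longrightarrow> l \<noteq> 0 \<and>
      (\<forall>c. coldet k (\<lambda>m. columns (representative k n (gtwist n i x t V)) (c m)) =
      l * coldet k (\<lambda>m. cv.twist n i x t (columns (representative k n V)) (c m)))"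
    using gtwist_grassmannian(2)[OF n _ x] by blast
  then obtain l where l: "\<And>V t. V \<in> grassmannian k n \<Longrightarrow> l V t \<noteq> 0"
    "\<And>V t c. V \<in> grassmannian k n \<Longrightarrow> coldet k (\<lambda>m. columns (representative k n (gtwist n i x t V)) (c m)) =
      l V t * coldet k (\<lambda>m. cv.twist n i x t (columns (representative k n V)) (c m))"
    by metis
  show ?thesis
  proof (rule exI[of _ l], rule exI[of _ s1], rule exI[of _ J1], rule exI[of _ s2], rule exI[of _ J2],
      intro conjI ballI allI)
    show "J1 J \<in> ksubsets k n" "J2 J \<in> ksubsets k n" if "J \<in> ksubsets k n" for J using J that by blast+
    show "l V t \<noteq> 0" if "V \<in> grassmannian k n" for V t using l(1) that .
    show "plucker k n J (gtwist n i x t V) =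
      l V t * (s1 J * plucker k n (J1 J) V + t * (s2 J * plucker k n (J2 J) V))"
      if V: "V \<in> grassmannian k n" and JJ: "J \<in> ksubsets k n" for V t J
    proof -
      have "coldet k (\<lambda>m. cv.twist n i x t (columns (representative k n V)) (enum J m)) =
        s1 J * plucker k n (J1 J) V + t * (s2 J * plucker k n (J2 J) V)"
        using J JJ representative(1)[OF V] by (simp add: plucker_def)
      then show ?thesis
        using plucker_coldet[OF gtwist_grassmannian(1)[OF n V x] JJ] l(2)[OF V, of t "enum J"] by simp
    qed
  qed
qed

text \<open>The isomorphism is \<open>V \<mapsto> (V', c V + e V')\<close>, where \<open>V'\<close> is obtained from \<open>V\<close> by the column
  operation with parameter \<open>c V\<close>.\<close>

lemma chart_isomorphism:
  fixes S T :: "complex vec set set" and Y :: "complex function_space" and c e :: "complex vec set \<Rightarrow> complex"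
  assumes n: "n \<ge> 2" and k: "k \<le> n"
    and S: "S \<subseteq> grassmannian k n" and T: "T \<subseteq> grassmannian k n"
    and S0: "S\<^sub>0 \<in> ksubsets k n" "\<And>V. V \<in> S \<Longrightarrow> plucker k n S\<^sub>0 V \<noteq> 0"
    and T0: "T\<^sub>0 \<in> ksubsets k n" "\<And>V. V \<in> T \<Longrightarrow> plucker k n T\<^sub>0 V \<noteq> 0"
    and c: "c \<in> regular (subvariety (Gr k n) S) S" and e: "e \<in> regular (subvariety (Gr k n) T) T"
    and Y: "function_sheaf Y" "(\<lambda>t. t) \<in> regular Y (topspace (zariski Y))"
    and intoY: "\<And>(X :: complex vec set function_space) g. function_sheaf X \<Longrightarrow>
      g \<in> regular X (topspace (zariski X)) \<Longrightarrow> g ` topspace (zariski X) \<subseteq> topspace (zariski Y) \<Longrightarrow> morphism X Y g"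
    and forth: "\<And>V. V \<in> S \<Longrightarrow> gtwist n i (i + 1) (- c V) V \<in> T"
      "\<And>V. V \<in> S \<Longrightarrow> c V + e (gtwist n i (i + 1) (- c V) V) \<in> topspace (zariski Y)"
    and inverse_map: "\<And>W t. W \<in> T \<Longrightarrow> t \<in> topspace (zariski Y) \<Longrightarrow> gtwist n i i (t - e W) W \<in> S"
      "\<And>W t. W \<in> T \<Longrightarrow> t \<in> topspace (zariski Y) \<Longrightarrow> c (gtwist n i i (t - e W) W) = t - e W"
  shows "subvariety (Gr k n) S \<cong>\<^sub>v subvariety (Gr k n) T \<times>\<^sub>v Y"
proof -
  let ?XS = "subvariety (Gr k n) S" and ?XT = "subvariety (Gr k n) T"
  interpret XS: function_sheaf ?XS by (rule function_sheaf_subvariety[OF function_sheaf_Gr])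
  interpret XT: function_sheaf ?XT by (rule function_sheaf_subvariety[OF function_sheaf_Gr])
  have tS: "topspace (zariski ?XS) = S" and tT: "topspace (zariski ?XT) = T"
    using S T by (auto simp: topspace_Gr)
  have oS: "openin (zariski ?XS) S" using openin_topspace[of "zariski ?XS"] tS by simp
  have oT: "openin (zariski ?XT) T" using openin_topspace[of "zariski ?XT"] tT by simp
  interpret P: sheaf_pair ?XT Y using Y(1) XT.function_sheaf_axioms by (simp add: sheaf_pair_def)
  interpret XP: function_sheaf "?XT \<times>\<^sub>v Y" by (rule P.function_sheaf_product)
  define \<phi> where "\<phi> V = gtwist n i (i + 1) (- c V) V" for V
  define \<psi> where "\<psi> z = gtwist n i i (snd z - e (fst z)) (fst z)" for z
  have \<phi>: "morphism ?XS ?XT \<phi>"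
  proof (rule XS.morphism_into_subvariety[OF function_sheaf_Gr])
    show "\<phi> ` topspace (zariski ?XS) \<subseteq> T" using forth(1) tS by (auto simp: \<phi>_def)
    obtain l s1 J1 s2 J2 where
      J: "\<forall>J \<in> ksubsets k n. J1 J \<in> ksubsets k n \<and> J2 J \<in> ksubsets k n" and
      lpl: "\<forall>V \<in> grassmannian k n. \<forall>t. l V t \<noteq> 0 \<and>
        (\<forall>J \<in> ksubsets k n. plucker k n J (gtwist n i (i + 1) t V) =
          l V t * (s1 J * plucker k n (J1 J) V + t * (s2 J * plucker k n (J2 J) V)))"
      using plucker_gtwist[OF n k, of "i + 1" i, simplified] by (elim exE conjE) (rule that, assumption+)
    have l: "l V t \<noteq> 0" if "V \<in> grassmannian k n" for V t using lpl that by auto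
    have pl: "plucker k n J (gtwist n i (i + 1) t V) =
        l V t * (s1 J * plucker k n (J1 J) V + t * (s2 J * plucker k n (J2 J) V))"
      if "V \<in> grassmannian k n" "J \<in> ksubsets k n" for V t J using lpl that by auto
    \<comment> \<open>Dividing by a coordinate without zeros on S makes the terms regular; the
      divisor is moved into the common factor.\<close>
    let ?m = "\<lambda>J V. s1 J * plucker k n (J1 J) V / plucker k n S\<^sub>0 V +
      (0 - c V) * (s2 J * plucker k n (J2 J) V / plucker k n S\<^sub>0 V)"
    show "morphism ?XS (Gr k n) \<phi>"
    proof (rule XS.morphism_into_Gr[where m = ?m and l = "\<lambda>V. l V (- c V) * plucker k n S\<^sub>0 V"])
      show "\<phi> ` topspace (zariski ?XS) \<subseteq> grassmannian k n" using forth(1) tS T by (auto simp: \<phi>_def)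
      have q: "(\<lambda>V. s * plucker k n J V / plucker k n S\<^sub>0 V) \<in> regular ?XS S" if "J \<in> ksubsets k n" for s J
        by (rule regular_quotient[OF plucker_form_scaled[OF that] plucker_form.coord[OF S0(1)] S0(2) S])
      show "?m J \<in> regular ?XS (topspace (zariski ?XS))" if "J \<in> ksubsets k n" for J
        unfolding tS by (intro XS.add XS.mult XS.minus oS q c XS.const) (use J[rule_format, OF that] in auto)
      show "l V (- c V) * plucker k n S\<^sub>0 V \<noteq> 0" if "V \<in> topspace (zariski ?XS)" for V
        using that tS S l S0(2) by auto
      show "plucker k n J (\<phi> V) = l V (- c V) * plucker k n S\<^sub>0 V * ?m J V"
        if "V \<in> topspace (zariski ?XS)" "J \<in> ksubsets k n" for V J
      proof -
        have V: "V \<in> grassmannian k n" "plucker k n S\<^sub>0 V \<noteq> 0" using that(1) tS S S0(2) by auto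
        show ?thesis unfolding \<phi>_def pl[OF V(1) that(2)] using V(2) by (simp add: field_simps)
      qed
    qed
  qed
  have "e \<circ> \<phi> \<in> regular ?XS {x \<in> topspace (zariski ?XS). \<phi> x \<in> T}"
    using \<phi> oT e unfolding morphism_def by blast
  moreover have "{x \<in> topspace (zariski ?XS). \<phi> x \<in> T} = S" using forth(1) tS by (auto simp: \<phi>_def)
  ultimately have e\<phi>: "(\<lambda>V. e (\<phi> V)) \<in> regular ?XS S" by (simp add: comp_def)
  have "morphism ?XS Y (\<lambda>V. c V + e (\<phi> V))"
  proof (rule intoY[OF XS.function_sheaf_axioms])
    show "(\<lambda>V. c V + e (\<phi> V)) \<in> regular ?XS (topspace (zariski ?XS))"
      unfolding tS by (rule XS.add[OF oS c e\<phi>])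
    show "(\<lambda>V. c V + e (\<phi> V)) ` topspace (zariski ?XS) \<subseteq> topspace (zariski Y)"
      using forth(2) tS by (auto simp: \<phi>_def)
  qed
  then have 1: "morphism ?XS (?XT \<times>\<^sub>v Y) (\<lambda>V. (\<phi> V, c V + e (\<phi> V)))"
    by (rule XS.morphism_pair[OF XT.function_sheaf_axioms Y(1) \<phi>])
  have 2: "morphism (?XT \<times>\<^sub>v Y) ?XS \<psi>"
  proof (rule XP.morphism_into_subvariety[OF function_sheaf_Gr])
    have tP: "topspace (zariski (?XT \<times>\<^sub>v Y)) = T \<times> topspace (zariski Y)" using tT by simp
    show "\<psi> ` topspace (zariski (?XT \<times>\<^sub>v Y)) \<subseteq> S" using inverse_map(1) tP by (auto simp: \<psi>_def)
    obtain l s1 J1 s2 J2 where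
      J: "\<forall>J \<in> ksubsets k n. J1 J \<in> ksubsets k n \<and> J2 J \<in> ksubsets k n" and
      lpl: "\<forall>V \<in> grassmannian k n. \<forall>t. l V t \<noteq> 0 \<and>
        (\<forall>J \<in> ksubsets k n. plucker k n J (gtwist n i i t V) =
          l V t * (s1 J * plucker k n (J1 J) V + t * (s2 J * plucker k n (J2 J) V)))"
      using plucker_gtwist[OF n k, of i i, simplified] by (elim exE conjE) (rule that, assumption+)
    have l: "l V t \<noteq> 0" if "V \<in> grassmannian k n" for V t using lpl that by auto
    have pl: "plucker k n J (gtwist n i i t V) =
        l V t * (s1 J * plucker k n (J1 J) V + t * (s2 J * plucker k n (J2 J) V))"
      if "V \<in> grassmannian k n" "J \<in> ksubsets k n" for V t J using lpl that by auto
    let ?t = "\<lambda>z. snd z - e (fst z)"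
    let ?m = "\<lambda>J z. s1 J * plucker k n (J1 J) (fst z) / plucker k n T\<^sub>0 (fst z) +
      ?t z * (s2 J * plucker k n (J2 J) (fst z) / plucker k n T\<^sub>0 (fst z))"
    show "morphism (?XT \<times>\<^sub>v Y) (Gr k n) \<psi>"
    proof (rule XP.morphism_into_Gr[where m = ?m and l = "\<lambda>z. l (fst z) (?t z) * plucker k n T\<^sub>0 (fst z)"])
      show "\<psi> ` topspace (zariski (?XT \<times>\<^sub>v Y)) \<subseteq> grassmannian k n"
        using inverse_map(1) tP S by (auto simp: \<psi>_def)
      have q: "(\<lambda>V. s * plucker k n J V / plucker k n T\<^sub>0 V) \<in> regular ?XT (topspace (zariski ?XT))"
        if "J \<in> ksubsets k n" for s J
        unfolding tT
        by (rule regular_quotient[OF plucker_form_scaled[OF that] plucker_form.coord[OF T0(1)] T0(2) T])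
      have e': "e \<in> regular ?XT (topspace (zariski ?XT))" using e tT by simp
      show "?m J \<in> regular (?XT \<times>\<^sub>v Y) (topspace (zariski (?XT \<times>\<^sub>v Y)))" if "J \<in> ksubsets k n" for J
      proof -
        have "J1 J \<in> ksubsets k n" "J2 J \<in> ksubsets k n" using J[rule_format, OF that] by auto
        note qs = P.regular_product_fst[OF q[OF this(1), of "s1 J"]] P.regular_product_fst[OF q[OF this(2), of "s2 J"]]
        show ?thesis
          by (intro XP.add XP.mult XP.minus openin_topspace qs P.regular_product_fst[OF e']
            P.regular_product_snd[OF Y(2)])
      qed
      show "l (fst z) (?t z) * plucker k n T\<^sub>0 (fst z) \<noteq> 0" if "z \<in> topspace (zariski (?XT \<times>\<^sub>v Y))" for z
        using that tP T l T0(2) by auto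
      show "plucker k n J (\<psi> z) = l (fst z) (?t z) * plucker k n T\<^sub>0 (fst z) * ?m J z"
        if "z \<in> topspace (zariski (?XT \<times>\<^sub>v Y))" "J \<in> ksubsets k n" for z J
      proof -
        have V: "fst z \<in> grassmannian k n" "plucker k n T\<^sub>0 (fst z) \<noteq> 0" using that(1) tP T T0(2) by auto
        show ?thesis unfolding \<psi>_def pl[OF V(1) that(2)] using V(2) by (simp add: field_simps)
      qed
    qed
  qed
  show ?thesis unfolding isomorphic_varieties_def
  proof (intro exI[of _ "\<lambda>V. (\<phi> V, c V + e (\<phi> V))"] exI[of _ \<psi>] conjI 1 2 ballI)
    fix V assume "V \<in> topspace (zariski ?XS)"
    then have "V \<in> grassmannian k n" using tS S by auto
    then show "\<psi> (\<phi> V, c V + e (\<phi> V)) = V"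
      using gtwist_gtwist(1)[OF n, of V k i "c V"] by (simp add: \<psi>_def \<phi>_def)
  next
    fix z assume "z \<in> topspace (zariski (?XT \<times>\<^sub>v Y))"
    then have z: "fst z \<in> T" "snd z \<in> topspace (zariski Y)" "fst z \<in> grassmannian k n" using tT T by auto
    \<comment> \<open>The new point remembers the parameter of the twist: \<open>c\<close> reads it
      off, so the forward map undoes exactly this twist.\<close>
    have c: "c (\<psi> z) = snd z - e (fst z)" unfolding \<psi>_def by (rule inverse_map(2)[OF z(1,2)])
    have "\<phi> (\<psi> z) = fst z"
      unfolding \<phi>_def c unfolding \<psi>_def by (rule gtwist_gtwist(2)[OF n z(3)])
    then show "(\<phi> (\<psi> z), c (\<psi> z) + e (\<phi> (\<psi> z))) = z" using c by (simp add: prod_eq_iff)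
  qed
qed

section \<open>Length and simple reflections\<close>

definition inversions :: "nat \<Rightarrow> (int \<Rightarrow> int) \<Rightarrow> (int \<times> int) set" where
  "inversions n g = {(a, b). a \<in> {1..int n} \<and> a < b \<and> g a > g b}"

lemma aff_length_inversions: "aff_length n g = card (inversions n g)"
  by (simp add: aff_length_def inversions_def)

lemma finite_inversions:
  assumes "g \<in> bounded_affine k n"
  shows "finite (inversions n g)"
proof (rule finite_subset)
  have bd: "a \<le> g a" "g a \<le> a + int n" for a using assms by (auto simp: bounded_affine_def)
  show "inversions n g \<subseteq> {1..int n} \<times> {1..2 * int n}"
  proof (rule subsetI)
    fix z assume "z \<in> inversions n g"
    then obtain a b where z: "z = (a, b)" "a \<in> {1..int n}" "a < b" "g a > g b"
      by (auto simp: inversions_def)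
    then show "z \<in> {1..int n} \<times> {1..2 * int n}" using bd(2)[of a] bd(1)[of b] by auto
  qed
qed simp

text \<open>The reflection moves numbers by at most one, so it can reverse only neighbours, and only
  those that it exchanges.\<close>

lemma simple_refl_strict:
  assumes n: "n \<ge> 2" and ab: "a < b"
  shows "simple_refl n i a < simple_refl n i b \<or> (a mod int n = i mod int n \<and> b = a + 1)"
proof (cases "b = a + 1")
  case True
  show ?thesis
  proof (cases "a mod int n = i mod int n")
    case False
    have "simple_refl n i a \<le> a" using False by (simp add: simple_refl_def)
    moreover have "b mod int n \<noteq> (i + 1) mod int n"
      using False True pred_cong[of b n i] by auto
    then have "b \<le> simple_refl n i b" by (simp add: simple_refl_def)
    ultimately show ?thesis using ab by simp
  qed (use True in simp)
next
  case False
  have "simple_refl n i a \<noteq> simple_refl n i b"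
    using simple_refl_invol[OF n, of i a] simple_refl_invol[OF n, of i b] ab by auto
  then show ?thesis
    using simple_refl_bounds(2)[of n i a] simple_refl_bounds(1)[of b n i] False ab by linarith
qed

text \<open>Reflect both positions of a pair and shift it so that the first lies in one period. Away
  from (i, i + 1) this preserves the order of the positions, so inversions are carried injectively
  to inversions; the pair (i, i + 1) itself accounts for the change of length.\<close>

lemma aff_length_left:
  assumes n: "n \<ge> 2" and i: "i \<in> {1..int n}"
    and g: "g \<in> bounded_affine k n" and sg: "simple_refl n i \<odot>\<^sub>a g \<in> bounded_affine k n"
  shows "aff_length n (simple_refl n i \<odot>\<^sub>a g) \<le> aff_length n g + 1"
    and "g (i + 1) < g i \<Longrightarrow> aff_length n (simple_refl n i \<odot>\<^sub>a g) + 1 \<le> aff_length n g"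
proof -
  let ?s = "simple_refl n i" and ?z = "(i, i + 1)"
  let ?sg = "?s \<odot>\<^sub>a g"
  define \<Phi> where "\<Phi> = (\<lambda>(a, b). (residue n (?s a), ?s b + (residue n (?s a) - ?s a)))"
  have res: "\<exists>m. residue n a = a + m * int n" for a by (rule mod_eq_shift[OF residue_mod])
  have s_shift: "?s (a + m * int n) = ?s a + m * int n" for a m
    by (rule shift_equivariant) (rule simple_refl_shift)
  have g_shift: "g (a + m * int n) = g a + m * int n" for a m
    by (rule shift_equivariant) (use g in \<open>auto simp: bounded_affine_def affine_permutation_def\<close>)
  have invol: "\<Phi> (\<Phi> (a, b)) = (a, b)" if "a \<in> {1..int n}" for a b
  proof -
    obtain m where m: "residue n (?s a) = ?s a + m * int n" using res by blast
    have "residue n (a + m * int n) = a"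
      using residue_id[OF that] by (simp add: residue_def) (metis add_diff_eq diff_add_eq mod_mult_self1)
    then show ?thesis by (simp add: \<Phi>_def m s_shift n)
  qed
  have maps: "\<Phi> ` (inversions n ?sg - {?z}) \<subseteq> inversions n g - {?z}"
  proof
    fix z assume "z \<in> \<Phi> ` (inversions n ?sg - {?z})"
    then obtain a b where ab: "z = \<Phi> (a, b)" "a \<in> {1..int n}" "a < b" "g (?s b) < g (?s a)" "(a, b) \<noteq> ?z"
      by (auto simp: inversions_def aff_mult_def)
    obtain m where m: "residue n (?s a) = ?s a + m * int n" using res by blast
    have z: "z = (?s a + m * int n, ?s b + m * int n)" by (simp add: ab(1) \<Phi>_def m)
    have "\<not> (a mod int n = i mod int n \<and> b = a + 1)"
    proof
      assume *: "a mod int n = i mod int n \<and> b = a + 1"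
      then have "a = i" using residue_eq_iff[of n a i] residue_id[OF ab(2)] residue_id[OF i] by simp
      then show False using * ab(5) by simp
    qed
    then have "?s a < ?s b" using simple_refl_strict[OF n ab(3), of i] by blast
    moreover have "?s a + m * int n \<in> {1..int n}" using residue_range[of n "?s a"] m n by simp
    \<comment> \<open>\<open>\<Phi>\<close> undoes itself and sends (i, i + 1) to a descending pair,
      so no admissible pair is mapped to (i, i + 1).\<close>
    moreover have "z \<noteq> ?z"
    proof
      assume "z = ?z"
      then have "(a, b) = \<Phi> ?z" using ab(1) invol[OF ab(2), of b] by metis
      then have "b < a" using n by (simp add: \<Phi>_def)
      then show False using ab(3) by simp
    qed
    ultimately show "z \<in> inversions n g - {?z}" using ab(4) by (simp add: z inversions_def g_shift)
  qed
  have "inj_on \<Phi> (inversions n ?sg - {?z})"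
  proof (rule inj_on_inverseI[where g = \<Phi>])
    fix z assume "z \<in> inversions n ?sg - {?z}"
    then show "\<Phi> (\<Phi> z) = z" using invol by (cases z) (simp add: inversions_def)
  qed
  then have le: "card (inversions n ?sg - {?z}) \<le> card (inversions n g - {?z})"
    by (rule card_inj_on_le[OF _ maps]) (use finite_inversions[OF g] in simp)
  have "card (inversions n ?sg) \<le> card (inversions n ?sg - {?z}) + 1"
    by (simp add: card_Diff_singleton_if) arith
  also have "\<dots> \<le> card (inversions n g) + 1"
    using le card_mono[OF finite_inversions[OF g], of "inversions n g - {?z}"] by auto
  finally show "aff_length n ?sg \<le> aff_length n g + 1" by (simp add: aff_length_inversions)
  assume gi: "g (i + 1) < g i"
  then have z: "?z \<in> inversions n g" "?z \<notin> inversions n ?sg"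
    using i n by (auto simp: inversions_def aff_mult_def)
  then have "card (inversions n ?sg) \<le> card (inversions n g - {?z})" using le by simp
  then show "aff_length n ?sg + 1 \<le> aff_length n g"
    using card_Suc_Diff1[OF finite_inversions[OF g] z(1)] by (simp add: aff_length_inversions)
qed

text \<open>Now the positions stay and the values are reflected. Two values change their order only
  if they are i and i + 1 up to a common multiple of n, and only one pair with first position in one
  period has such values.\<close>

lemma aff_length_right:
  assumes n: "n \<ge> 2" and g: "g \<in> bounded_affine k n"
  defines "h \<equiv> inv_into UNIV g"
  shows "aff_length n (g \<odot>\<^sub>a simple_refl n i) \<le> aff_length n g + 1"
    and "h (i + 1) < h i \<Longrightarrow> aff_length n (g \<odot>\<^sub>a simple_refl n i) + 1 \<le> aff_length n g"
proof -
  let ?s = "simple_refl n i"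
  let ?gs = "g \<odot>\<^sub>a ?s"
  have h: "h (g a) = a" "g (h b) = b" for a b
    unfolding h_def using bounded_affine_inv(1,2)[OF g] by auto
  have h_shift: "h (a + m * int n) = h a + m * int n" for a m
    unfolding h_def by (rule shift_equivariant) (rule bounded_affine_inv(3)[OF g])
  have g_shift: "g (a + m * int n) = g a + m * int n" for a m
    by (rule shift_equivariant) (rule bounded_affine_inv(6)[OF g])
  have s_shift: "?s (a + m * int n) = ?s a + m * int n" for a m
    by (rule shift_equivariant) (rule simple_refl_shift)
  \<comment> \<open>The shift that brings \<open>h i\<close> into one period; \<open>?p\<close> is
    the one pair that can become an inversion.\<close>
  let ?m = "residue n (h i) - h i"
  let ?p = "(h i + ?m, h (i + 1) + ?m)"
  have sub: "z \<in> inversions n g \<or> (z = ?p \<and> h i < h (i + 1))" if zi: "z \<in> inversions n ?gs" for z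
  proof -
    obtain a b where z: "z = (a, b)" "a \<in> {1..int n}" "a < b" "?s (g b) < ?s (g a)"
      using zi by (auto simp: inversions_def aff_mult_def)
    show ?thesis
    proof (cases "g b < g a")
      case True
      then show ?thesis using z by (simp add: inversions_def)
    next
      case False
      moreover have "g a \<noteq> g b" using h(1)[of a] h(1)[of b] z(3) by auto
      ultimately have "g a < g b" by simp
      then have eq: "g a mod int n = i mod int n" "g b = g a + 1"
        using simple_refl_strict[OF n, of "g a" "g b" i] z(4) by auto
      obtain m where m: "g a = i + m * int n" using mod_eq_shift[OF eq(1)] by blast
      have a: "a = h i + m * int n" using h(1)[of a] m h_shift by simp
      have b: "b = h (i + 1) + m * int n" using h(1)[of b] h_shift[of "i + 1" m] m eq(2)
        by (simp add: algebra_simps)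
      have "residue n (h i) = residue n a" unfolding a residue_eq_iff by simp
      then have "?m = m * int n" using residue_id[OF z(2)] a by simp
      then show ?thesis using z a b by simp
    qed
  qed
  then have "inversions n ?gs \<subseteq> insert ?p (inversions n g)" by blast
  then have "card (inversions n ?gs) \<le> card (insert ?p (inversions n g))"
    using finite_inversions[OF g] by (intro card_mono) auto
  also have "\<dots> \<le> card (inversions n g) + 1"
    using card_insert_le_m1[of "card (inversions n g) + 1" "inversions n g" ?p] by simp
  finally show "aff_length n ?gs \<le> aff_length n g + 1" by (simp add: aff_length_inversions)
  assume lt: "h (i + 1) < h i"
  obtain m where m: "residue n (h (i + 1)) = h (i + 1) + m * int n"
    using mod_eq_shift[OF residue_mod] by blast
  let ?z = "(h (i + 1) + m * int n, h i + m * int n)"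
  have "h (i + 1) + m * int n \<in> {1..int n}" using residue_range[of n "h (i + 1)"] m n by simp
  then have z: "?z \<in> inversions n g" using lt by (simp add: inversions_def g_shift h)
  have "?z \<notin> inversions n ?gs" using n by (simp add: inversions_def aff_mult_def g_shift h s_shift)
  then have "inversions n ?gs \<subseteq> inversions n g - {?z}" using sub lt by fastforce
  then have "card (inversions n ?gs) \<le> card (inversions n g - {?z})"
    using finite_inversions[OF g] by (intro card_mono) auto
  then show "aff_length n ?gs + 1 \<le> aff_length n g"
    using card_Suc_Diff1[OF finite_inversions[OF g] z] by (simp add: aff_length_inversions)
qed

lemma inverse_aff_mult:
  assumes n: "n \<ge> 2" and f: "f \<in> bounded_affine k n"
  shows "inv_into UNIV (simple_refl n i \<odot>\<^sub>a f) = (\<lambda>b. simple_refl n i (inv_into UNIV f b))"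
    and "inv_into UNIV (simple_refl n i \<odot>\<^sub>a f \<odot>\<^sub>a simple_refl n i) =
      (\<lambda>b. simple_refl n i (inv_into UNIV f (simple_refl n i b)))"
  by (rule inv_equality; use n bounded_affine_inv(1,2)[OF f] in \<open>simp add: aff_mult_def\<close>)+

text \<open>Each reflection adds at most one to the length, so a gain of two excludes a loss at
  either step; this orders \<open>f i\<close>, \<open>f (i + 1)\<close> and \<open>h i\<close>,
  \<open>h (i + 1)\<close>. The remaining strict bounds come from boundedness of the reflected
  permutations.\<close>

lemma exchange_setting:
  fixes f :: "int \<Rightarrow> int"
  assumes n: "n \<ge> 2" and i: "i \<in> {1..int n}"
    and f: "f \<in> bounded_affine k n"
    and sf: "simple_refl n i \<odot>\<^sub>a f \<in> bounded_affine k n"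
    and fs: "f \<odot>\<^sub>a simple_refl n i \<in> bounded_affine k n"
    and sfs: "simple_refl n i \<odot>\<^sub>a f \<odot>\<^sub>a simple_refl n i \<in> bounded_affine k n"
    and len: "aff_length n (simple_refl n i \<odot>\<^sub>a f \<odot>\<^sub>a simple_refl n i) = aff_length n f + 2"
  defines "h \<equiv> inv_into UNIV f"
  shows "exchange (\<lambda>(c :: complex) (x :: nat \<Rightarrow> complex) r. c * x r) n i (f i) (f (i + 1)) (h i) (h (i + 1)) h"
proof -
  let ?s = "simple_refl n i"
  note inv = bounded_affine_inv[OF f, folded h_def]
  have assoc: "?s \<odot>\<^sub>a f \<odot>\<^sub>a ?s = ?s \<odot>\<^sub>a (f \<odot>\<^sub>a ?s)" by (simp add: aff_mult_def)
  have "f i \<noteq> f (i + 1)" using inv(1)[of i] inv(1)[of "i + 1"] by auto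
  moreover have "\<not> f (i + 1) < f i"
  proof
    assume "f (i + 1) < f i"
    then have "aff_length n (?s \<odot>\<^sub>a f) + 1 \<le> aff_length n f" by (rule aff_length_left(2)[OF n i f sf])
    moreover have "aff_length n (?s \<odot>\<^sub>a f \<odot>\<^sub>a ?s) \<le> aff_length n (?s \<odot>\<^sub>a f) + 1"
      by (rule aff_length_right(1)[OF n sf])
    ultimately show False using len by simp
  qed
  ultimately have pq: "f i < f (i + 1)" by simp
  have "h i \<noteq> h (i + 1)" using inv(2)[of i] inv(2)[of "i + 1"] by auto
  moreover have "\<not> h (i + 1) < h i"
  proof
    assume "h (i + 1) < h i"
    then have "aff_length n (f \<odot>\<^sub>a ?s) + 1 \<le> aff_length n f"
      using aff_length_right(2)[OF n f] by (simp add: h_def)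
    moreover have "aff_length n (?s \<odot>\<^sub>a (f \<odot>\<^sub>a ?s)) \<le> aff_length n (f \<odot>\<^sub>a ?s) + 1"
      by (rule aff_length_left(1)[OF n i fs]) (use sfs assoc in simp)
    ultimately show False using len assoc by simp
  qed
  ultimately have ab: "h i < h (i + 1)" by simp
  have bd: "a \<le> g a" "g a \<le> a + int n" if "g \<in> bounded_affine k n" for g a
    using that by (auto simp: bounded_affine_def)
  \<comment> \<open>At i + 1 and i the left multiple takes the values \<open>f i\<close> and
    \<open>f (i + 1)\<close>, so each value is bounded with respect to the other position.\<close>
  have sf_bd: "i + 1 \<le> f i" "f (i + 1) \<le> i + int n"
    using bd(1)[OF sf, of "i + 1"] bd(2)[OF sf, of i] n by (simp_all add: aff_mult_def)
  have sfs_bd: "i + 1 \<le> ?s (f i)" "?s (f (i + 1)) \<le> i + int n"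
    using bd(1)[OF sfs, of "i + 1"] bd(2)[OF sfs, of i] n by (simp_all add: aff_mult_def)
  \<comment> \<open>If \<open>f i\<close> were i + 1, the reflection of values would send it to i,
    below the bound i + 1.\<close>
  have fi: "f i \<noteq> i + 1" using sfs_bd(1) n by auto
  have fS: "f (i + 1) \<noteq> i + int n"
  proof
    assume "f (i + 1) = i + int n"
    then have "?s (f (i + 1)) = i + 1 + int n" by (simp add: simple_refl_shift)
    then show False using sfs_bd(2) by simp
  qed
  have fs_bd: "i + 1 \<le> h i + int n" "h (i + 1) \<le> i"
    using bd(2)[OF fs, of "h i"] bd(1)[OF fs, of "h (i + 1)"] n inv(2) by (simp_all add: aff_mult_def)
  have hi: "h i \<noteq> i + 1 - int n"
  proof
    assume "h i = i + 1 - int n"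
    then have "f (i + 1) = i + int n" using inv(6)[of "i + 1 - int n"] inv(2)[of i] by simp
    then show False using fS by simp
  qed
  have hS: "h (i + 1) \<noteq> i" using fi inv(2)[of "i + 1"] by auto
  show ?thesis
  proof unfold_locales
    show "h b = i \<longleftrightarrow> b = f i" "h b = i + 1 \<longleftrightarrow> b = f (i + 1)" for b
      using inv(1)[of i] inv(1)[of "i + 1"] inv(2)[of b] by auto
    show "f (i + 1) < i + int n" using sf_bd fS by simp
    show "i + 2 \<le> f i" using sf_bd fi by simp
    show "i + 2 - int n \<le> h i" using fs_bd hi by simp
    show "h (i + 1) < i" using fs_bd hS by simp
  qed (use n pq ab inv in auto)
qed

section \<open>Expansion coefficients as regular functions\<close>

text \<open>Stated for any matrix with row space V, because a twisted matrix is not the chosen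
  representative. The defining conditions say that each necklace is a Gale-minimal basis;
  \<open>config_of_gale_minimal\<close> and \<open>gale_minimal_of_config\<close> translate this
  into spans.\<close>

lemma open_positroid_config:
  assumes n: "n > 0" and f: "f \<in> bounded_affine k n"
    and B: "B \<in> carrier_mat k n" "rows_indep k n B" "vec_space.row_space n B = V"
  shows "V \<in> open_positroid k n f \<longleftrightarrow> cv.config n (inv_into UNIV f) (columns B)"
proof -
  have V: "V \<in> grassmannian k n" using grassmannian_row_space B by blast
  obtain l where l: "l \<noteq> 0"
    "\<And>c. coldet k (\<lambda>m. columns (representative k n V) (c m)) = l * coldet k (\<lambda>m. columns B (c m))"
    using representative_proportional[OF n B] by blast
  have pl: "plucker k n J V = l * minor B J" if "J \<in> ksubsets k n" for J
    using plucker_coldet[OF V that] minor_coldet[OF B(1) that] l(2) by simp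
  have rank: "\<exists>J \<in> ksubsets k n. minor B J \<noteq> 0" using rows_indep_iff_minor[OF B(1) n] B(2) by blast
  show ?thesis
  proof
    assume "V \<in> open_positroid k n f"
    then have zero: "\<And>J. J \<in> ksubsets k n - positroid k n f \<Longrightarrow> plucker k n J V = 0"
      and nz: "\<And>j. j \<in> {1..int n} \<Longrightarrow> plucker k n (necklace n f j) V \<noteq> 0"
      by (auto simp: open_positroid_def)
    have N: "necklace n f j \<in> ksubsets k n" if "j \<in> {1..int n}" for j
      using minor_nonzero_ksubset[OF representative(1)[OF V] necklace_range[OF n f]] nz[OF that]
      by (simp add: plucker_def)
    show "cv.config n (inv_into UNIV f) (columns B)"
    proof (rule config_of_gale_minimal[OF n f B(1)])
      show "minor B (necklace n f j) \<noteq> 0" if "j \<in> {1..int n}" for j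
        using nz[OF that] pl[OF N[OF that]] by simp
      show "gale_le n j (necklace n f j) J"
        if "j \<in> {1..int n}" "J \<in> ksubsets k n" "minor B J \<noteq> 0" for j J
      proof -
        have "plucker k n J V \<noteq> 0" using pl[OF that(2)] that(3) l(1) by simp
        then have "J \<in> positroid k n f" using zero that(2) by blast
        then show ?thesis using that(1) by (simp add: positroid_def)
      qed
    qed
  next
    assume c: "cv.config n (inv_into UNIV f) (columns B)"
    have "plucker k n J V = 0" if J: "J \<in> ksubsets k n - positroid k n f" for J
    proof (rule ccontr)
      assume "plucker k n J V \<noteq> 0"
      then have "minor B J \<noteq> 0" using pl[of J] J by auto
      then have "\<forall>j. gale_le n j (necklace n f j) J"
        using gale_minimal_of_config[OF n f B(1) _ _ c, of J] J by blast
      then show False using J by (auto simp: positroid_def)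
    qed
    moreover have "plucker k n (necklace n f j) V \<noteq> 0" for j
      using config_basis(2,3)[OF n f B(1) rank c, of j] pl[of "necklace n f j"] l(1) by simp
    ultimately show "V \<in> open_positroid k n f" using V by (simp add: open_positroid_def)
  qed
qed

text \<open>The coefficient of \<open>v m\<close> in the expansion of \<open>v a\<close> in the basis given by the necklace at \<open>j\<close>,
  by Cramer's rule.\<close>

definition coefficient :: "nat \<Rightarrow> nat \<Rightarrow> (int \<Rightarrow> int) \<Rightarrow> int \<Rightarrow> int \<Rightarrow> int \<Rightarrow> complex vec set \<Rightarrow> complex" where
  "coefficient k n f j m a V =
     (let B = necklace n f j; l\<^sub>0 = (SOME l. l < k \<and> enum B l = residue n m); v = columns (representative k n V)
      in coldet k (\<lambda>l. v (if l = l\<^sub>0 then a else enum B l)) / coldet k (\<lambda>l. v (enum B l)))"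

text \<open>Putting a vector in the place of \<open>v m\<close> in the basis determinant annihilates
  the other basis vectors and, by induction along the interval, every \<open>v y\<close> in it: such
  a vector is another basis vector or depends on earlier vectors of the interval. Of
  \<open>v a\<close> only the multiple of \<open>v m\<close> survives.\<close>

lemma coefficient_eqI:
  assumes n: "n > 0" and f: "f \<in> bounded_affine k n"
    and A: "A \<in> carrier_mat k n" "rows_indep k n A" "vec_space.row_space n A = V"
    and v: "cv.config n (inv_into UNIV f) (columns A)"
    and m: "j \<le> m" "m < j + int n" "inv_into UNIV f m < j"
    and interval: "\<And>y. u \<le> y \<Longrightarrow> y < x \<Longrightarrow> j \<le> y \<and> y < j + int n \<and> y \<noteq> m \<and>
      (inv_into UNIV f y < j \<or> u \<le> inv_into UNIV f y)"
    and c: "columns A a - (\<lambda>r. c * columns A m r) \<in> cv.span (columns A ` {u..<x})"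
  shows "coefficient k n f j m a V = c"
proof -
  let ?v = "columns A" and ?B = "necklace n f j"
  have vp: "?v (a + int n) = ?v a" for a by (rule columns_periodic[OF A(1)])
  have vres: "?v (residue n a) = ?v a" for a by (rule residue_periodic) (rule vp)
  have rank: "\<exists>J \<in> ksubsets k n. minor A J \<noteq> 0" using rows_indep_iff_minor[OF A(1) n] A(2) by blast
  have B: "?B \<in> ksubsets k n" and D: "minor A ?B \<noteq> 0"
    using config_basis(2,3)[OF n f A(1) rank v] by auto
  let ?u = "\<lambda>l. ?v (enum ?B l)"
  have D': "coldet k ?u \<noteq> 0" using D minor_coldet[OF A(1) B] by simp
  have lifted: "\<exists>l<k. enum ?B l = residue n y" if "j \<le> y" "y < j + int n" "inv_into UNIV f y < j" for y
  proof -
    have "y \<in> basis_lift n f j" using that by (simp add: basis_lift_def[OF n f])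
    then have "residue n y \<in> ?B" unfolding necklace_lift[OF n f] by blast
    then show ?thesis using enum_bij[OF B] unfolding bij_betw_def by (metis imageE lessThan_iff)
  qed
  define l0 where "l0 = (SOME l. l < k \<and> enum ?B l = residue n m)"
  have l0: "l0 < k" "enum ?B l0 = residue n m"
    using someI_ex[OF lifted[OF m]] by (simp_all add: l0_def)
  have zero: "u \<le> y \<longrightarrow> y < x \<longrightarrow> coldet k (?u(l0 := ?v y)) = 0" for y
  proof (induction "nat (y - u)" arbitrary: y rule: less_induct)
    case less
    show ?case
    proof (intro impI)
      assume y: "u \<le> y" "y < x"
      note iv = interval[OF y]
      show "coldet k (?u(l0 := ?v y)) = 0"
      proof (cases "inv_into UNIV f y < j")
        case True
        then obtain l where l: "l < k" "enum ?B l = residue n y" using lifted iv by blast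
        have "residue n y \<noteq> residue n m"
        proof
          assume "residue n y = residue n m"
          then have "y = m"
            by (rule inj_onD[OF residue_inj_window[OF n f, of j]]) (use iv m in auto)
          then show False using iv by simp
        qed
        then have "l \<noteq> l0" using l l0 by auto
        then show ?thesis using l l0 vres[of y] by (intro coldet_dup[of l0 k l]) auto
      next
        case False
        then have "u \<le> inv_into UNIV f y" using iv by blast
        then have "?v y \<in> cv.span (?v ` {u..<y})" using cv.configD[OF v y(1)] by simp
        then show ?thesis
        proof (rule coldet_span[OF l0(1)])
          fix w assume "w \<in> ?v ` {u..<y}"
          then obtain y' where "u \<le> y'" "y' < y" "w = ?v y'" by auto
          then show "coldet k (?u(l0 := w)) = 0" using less.hyps[of y'] y by simp
        qed
      qed
    qed
  qed
  let ?z = "?v a - (\<lambda>r. c * ?v m r)"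
  have "coldet k (?u(l0 := ?z)) = 0"
    by (rule coldet_span[OF l0(1) c]) (use zero in auto)
  moreover have "?v a = (\<lambda>r. 1 * ?z r + c * ?v m r)" by (simp add: fun_eq_iff)
  then have "coldet k (?u(l0 := ?v a)) = 1 * coldet k (?u(l0 := ?z)) + c * coldet k (?u(l0 := ?v m))"
    using coldet_linear[OF l0(1), of ?u 1 ?z c "?v m"] by simp
  moreover have "?u(l0 := ?v m) = ?u" using l0(2) vres[of m] by (auto simp: fun_eq_iff)
  ultimately have num: "coldet k (?u(l0 := ?v a)) = c * coldet k ?u" by simp
  have upd: "(\<lambda>l. ?v (if l = l0 then a else enum ?B l)) = ?u(l0 := ?v a)" by (auto simp: fun_eq_iff)
  obtain s where s: "s \<noteq> 0"
    "\<And>c. coldet k (\<lambda>m. columns (representative k n V) (c m)) = s * coldet k (\<lambda>m. ?v (c m))"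
    using representative_proportional[OF n A] by blast
  show ?thesis
    unfolding coefficient_def Let_def l0_def[symmetric] s(2) upd num using s(1) D' by simp
qed

text \<open>For every integer \<open>j\<close>: the necklace at the preimage of i + 1 will be
  needed, and this preimage may lie outside one period.\<close>

lemma open_positroid_nonvanishing:
  assumes n: "n > 0" and f: "f \<in> bounded_affine k n" and V: "V \<in> open_positroid k n f"
  shows "necklace n f j \<in> ksubsets k n" "plucker k n (necklace n f j) V \<noteq> 0"
proof -
  have G: "V \<in> grassmannian k n" using V by (simp add: open_positroid_def)
  note R = representative[OF G]
  note ind = rows_indep_representative[OF n G]
  have "\<exists>J \<in> ksubsets k n. minor (representative k n V) J \<noteq> 0"
    using rows_indep_iff_minor[OF R(1) n] ind by blast
  moreover have "cv.config n (inv_into UNIV f) (columns (representative k n V))"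
    using open_positroid_config[OF n f R(1) ind R(2)] V by blast
  ultimately show "necklace n f j \<in> ksubsets k n" "plucker k n (necklace n f j) V \<noteq> 0"
    using config_basis(2,3)[OF n f R(1)] by (auto simp: plucker_def)
qed

text \<open>That the necklace has k elements is deduced from a point, so for the empty set an
  arbitrary subset is taken.\<close>

lemma open_positroid_chart_coordinate:
  assumes n: "n > 0" and k: "k \<le> n" and f: "f \<in> bounded_affine k n" and S: "S \<subseteq> open_positroid k n f"
  shows "\<exists>J \<in> ksubsets k n. \<forall>V \<in> S. plucker k n J V \<noteq> 0"
proof (cases "S = {}")
  case True
  then show ?thesis using ksubsets_nonempty[OF k] by blast
next
  case False
  then show ?thesis using open_positroid_nonvanishing[OF n f, where j = 0] S by blast
qed

lemma coefficient_regular: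
  assumes n: "n > 0" and k: "k \<le> n" and f: "f \<in> bounded_affine k n" and S: "S \<subseteq> open_positroid k n f"
  shows "coefficient k n f j m a \<in> regular (subvariety (Gr k n) S) S"
proof (cases "S = {}")
  case True
  then show ?thesis by (simp add: subvariety_def)
next
  case False
  let ?B = "necklace n f j"
  have B: "?B \<in> ksubsets k n" using open_positroid_nonvanishing(1)[OF n f] S False by blast
  have SG: "S \<subseteq> grassmannian k n" using S by (auto simp: open_positroid_def)
  define l0 where "l0 = (SOME l. l < k \<and> enum ?B l = residue n m)"
  from coldet_columns_form[OF k n, where c = "\<lambda>l. if l = l0 then a else enum ?B l"]
  obtain s J where J: "J \<in> ksubsets k n" "\<And>A. A \<in> carrier_mat k n \<Longrightarrow>
    coldet k (\<lambda>l. columns A (if l = l0 then a else enum ?B l)) = s * minor A J" by blast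
  have reg: "(\<lambda>V. s * plucker k n J V / plucker k n ?B V) \<in> regular (subvariety (Gr k n) S) S"
    by (rule regular_quotient[OF plucker_form_scaled[OF J(1)] plucker_form.coord[OF B] _ SG])
      (use open_positroid_nonvanishing(2)[OF n f] S in blast)
  interpret function_sheaf "subvariety (Gr k n) S"
    by (rule function_sheaf_subvariety[OF function_sheaf_Gr])
  have "topspace (zariski (subvariety (Gr k n) S)) = S" using SG by (auto simp: topspace_Gr)
  then have o: "openin (zariski (subvariety (Gr k n) S)) S"
    using openin_topspace[of "zariski (subvariety (Gr k n) S)"] by simp
  show ?thesis
  proof (rule cong[OF o reg])
    fix V assume "V \<in> S"
    then have G: "V \<in> grassmannian k n" using SG by blast
    have "coldet k (\<lambda>l. columns (representative k n V) (if l = l0 then a else enum ?B l)) = s * plucker k n J V"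
      using J(2)[OF representative(1)[OF G]] by (simp add: plucker_def)
    moreover have "coldet k (\<lambda>l. columns (representative k n V) (enum ?B l)) = plucker k n ?B V"
      using plucker_coldet[OF G B] by simp
    ultimately show "coefficient k n f j m a V = s * plucker k n J V / plucker k n ?B V"
      by (simp add: coefficient_def Let_def flip: l0_def)
  qed
qed

lemma function_sheaf_punctured_line: "function_sheaf punctured_line"
  and topspace_punctured_line: "topspace (zariski punctured_line) = UNIV - {0}"
  and regular_punctured_line_id: "(\<lambda>t. t) \<in> regular punctured_line (UNIV - {0})"
  unfolding punctured_line_def
  using function_sheaf_subvariety[OF function_sheaf_affine_line]
    regular_subvariety[of "\<lambda>t. t" affine_line "UNIV - {0}"] regular_affine_line_id by auto

lemma (in function_sheaf) morphism_punctured_line: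
  assumes "h \<in> regular X (topspace (zariski X))" "h ` topspace (zariski X) \<subseteq> UNIV - {0}"
  shows "morphism X punctured_line h"
  unfolding punctured_line_def
  by (rule morphism_into_subvariety[OF function_sheaf_affine_line morphism_affine_line[OF assms(1)] assms(2)])

theorem corollary6p7:
  fixes n k :: nat and i :: int and I :: "int set" and f :: "int \<Rightarrow> int"
  assumes "n \<ge> 2" and "k \<le> n"
    and "i \<in> {1..int n}" and "I \<in> ksubsets k n"
    and "f \<in> bounded_affine k n"
    and "simple_refl n i \<odot>\<^sub>a f \<in> bounded_affine k n"
    and "f \<odot>\<^sub>a simple_refl n i \<in> bounded_affine k n"
    and "simple_refl n i \<odot>\<^sub>a f \<odot>\<^sub>a simple_refl n i \<in> bounded_affine k n"
    and "aff_length n (simple_refl n i \<odot>\<^sub>a f \<odot>\<^sub>a simple_refl n i) = aff_length n f + 2"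
    and "i \<in> I \<longrightarrow> residue n (i + 1) \<in> I"
  shows "\<exists>Z U.
      open_positroid_chart k n f I = Z \<union> U \<and> Z \<inter> U = {} \<and>
      closedin (subtopology (zariski (Gr k n)) (open_positroid_chart k n f I)) Z \<and>
      openin (subtopology (zariski (Gr k n)) (open_positroid_chart k n f I)) U \<and>
      subvariety (Gr k n) Z \<cong>\<^sub>v
        subvariety (Gr k n) (open_positroid_chart k n (simple_refl n i \<odot>\<^sub>a f \<odot>\<^sub>a simple_refl n i)
            (refl_set n i I))
          \<times>\<^sub>v affine_line \<and>
      subvariety (Gr k n) U \<cong>\<^sub>v
        subvariety (Gr k n) (open_positroid_chart k n (simple_refl n i \<odot>\<^sub>a f) (refl_set n i I))
          \<times>\<^sub>v punctured_line"
proof -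
  note n = assms(1) and k = assms(2) and i = assms(3) and I = assms(4) and f = assms(5)
    and sf = assms(6) and sfs = assms(8) and iI = assms(10)
  have n0: "n > 0" using n by simp
  let ?sf = "simple_refl n i \<odot>\<^sub>a f"
  let ?sfs = "simple_refl n i \<odot>\<^sub>a f \<odot>\<^sub>a simple_refl n i"
  let ?I = "refl_set n i I"
  define h where "h = inv_into UNIV f"
  define b where "b = h (i + 1)"
  interpret E: exchange "\<lambda>(c :: complex) (x :: nat \<Rightarrow> complex) r. c * x r" n i "f i" "f (i + 1)" "h i" b h
    unfolding h_def b_def by (rule exchange_setting[OF n i f sf assms(7) sfs assms(9)])
  have inv_sf: "inv_into UNIV ?sf = E.swap_left" and inv_sfs: "inv_into UNIV ?sfs = E.swap_both"
    unfolding inverse_aff_mult[OF n f, of i] h_def[symmetric]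
    by (simp_all add: E.swap_left_def E.swap_both_def fun_eq_iff)

  let ?C = "open_positroid_chart k n f I"
  let ?CZ = "open_positroid_chart k n ?sfs ?I" and ?CU = "open_positroid_chart k n ?sf ?I"
  \<comment> \<open>The necklace basis at i + 1 contains column i + 1, since its preimage
    \<open>b\<close> is smaller than i; c is the coefficient of column i along it. For d and e the
    basis at \<open>b\<close> is used, which contains column i because
    \<open>h i < b\<close>.\<close>
  define c where "c = coefficient k n f (i + 1) (i + 1) i"
  define d where "d = coefficient k n f b i (i + 1)"
  define e where "e = coefficient k n ?sf b i (i + 1)"
  define Z where "Z = {V \<in> ?C. d V = 0}"
  define U where "U = {V \<in> ?C. d V \<noteq> 0}"

  have C: "?C \<subseteq> open_positroid k n f" and CZ: "?CZ \<subseteq> open_positroid k n ?sfs"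
    and CU: "?CU \<subseteq> open_positroid k n ?sf" by (auto simp: open_positroid_chart_def)
  have gr: "open_positroid k n g \<subseteq> grassmannian k n" for g by (auto simp: open_positroid_def)

  have c_eq: "c V = t"
    if A: "A \<in> carrier_mat k n" "rows_indep k n A" "vec_space.row_space n A = V"
      and v: "cv.config n h (columns A)"
      and t: "columns A i - (\<lambda>r. t * columns A (i + 1) r) \<in> cv.span (columns A ` {i + 2..<f i + 1})"
    for A V t
    unfolding c_def
  proof (rule coefficient_eqI[OF n0 f A v[unfolded h_def] _ _ _ _ t])
    show "inv_into UNIV f (i + 1) < i + 1" using E.ab E.h_Suc by (simp add: h_def)
    \<comment> \<open>\<open>h y = i + 1\<close> holds only for \<open>y = f (i + 1)\<close>, which
      lies beyond \<open>f i\<close>. So a column of the interval either belongs to the basis at i +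
      1 or depends on vectors from i + 2 on.\<close>
    show "i + 1 \<le> y \<and> y < i + 1 + int n \<and> y \<noteq> i + 1 \<and>
        (inv_into UNIV f y < i + 1 \<or> i + 2 \<le> inv_into UNIV f y)"
      if "i + 2 \<le> y" "y < f i + 1" for y
      using E.h_q[of y] E.pq that by (auto simp: h_def)
  qed (use n in auto)
  \<comment> \<open>One computation for d and e, as both permutations have the same preimage of i.
    The interval starts at \<open>b\<close>, where the basis is taken, so the alternative required
    of its elements is automatic.\<close>
  have coef_b: "coefficient k n g b i (i + 1) V = t"
    if g: "g \<in> bounded_affine k n" "inv_into UNIV g i = h i"
      and A: "A \<in> carrier_mat k n" "rows_indep k n A" "vec_space.row_space n A = V"
      and v: "cv.config n (inv_into UNIV g) (columns A)"
      and t: "columns A (i + 1) - (\<lambda>r. t * columns A i r) \<in> cv.span (columns A ` {b..<i})"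
    for g A V t
    by (rule coefficient_eqI[OF n0 g(1) A v _ _ _ _ t]) (use E.ab E.h_i g(2) in auto)
  have coef_exists: "\<exists>t. v (i + 1) - (\<lambda>r. t * v i r) \<in> cv.span (v ` {b..<i})"
    if "cv.config n g v" "g (i + 1) = b" for g and v :: "int \<Rightarrow> nat \<Rightarrow> complex"
  proof -
    have "v (i + 1) \<in> cv.span (v ` {b..<i + 1})" using cv.configD[OF that(1), of b "i + 1"] that(2) E.ab by simp
    then show ?thesis using E.interval_Suc[of b] E.ab by (simp add: cv.span_breakdown_eq)
  qed
  have d_eq: "d V = 0 \<longleftrightarrow> columns A (i + 1) \<in> cv.span (columns A ` {b..<i})"
    if A: "A \<in> carrier_mat k n" "rows_indep k n A" "vec_space.row_space n A = V"
      and v: "cv.config n h (columns A)" for A V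
  proof
    obtain t where t: "columns A (i + 1) - (\<lambda>r. t * columns A i r) \<in> cv.span (columns A ` {b..<i})"
      using coef_exists[OF v] b_def by blast
    have dt: "d V = t" unfolding d_def
      by (rule coef_b[OF f _ A v[unfolded h_def] t]) (simp add: h_def)
    assume "d V = 0"
    then show "columns A (i + 1) \<in> cv.span (columns A ` {b..<i})" using t dt by (simp flip: zero_fun_def)
  next
    assume "columns A (i + 1) \<in> cv.span (columns A ` {b..<i})"
    then show "d V = 0" unfolding d_def
      by (intro coef_b[OF f _ A v[unfolded h_def]]) (simp_all add: h_def flip: zero_fun_def)
  qed

  have twisted: "mtwist k n i x t A \<in> carrier_mat k n" "rows_indep k n (mtwist k n i x t A)"
      "vec_space.row_space n (mtwist k n i x t A) = gtwist n i x t V"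
      "columns (mtwist k n i x t A) = cv.twist n i x t (columns A)"
    if A: "A \<in> carrier_mat k n" "rows_indep k n A" "vec_space.row_space n A = V" and x: "x = i \<or> x = i + 1"
    for A V x t
    using rows_indep_mtwist[OF n A(1,2) x] row_space_mtwist[OF n0 A(1)] A(3) columns_mtwist[OF n0 A(1)]
    by simp_all
  have rep: "representative k n V \<in> carrier_mat k n" "rows_indep k n (representative k n V)"
      "vec_space.row_space n (representative k n V) = V" if "V \<in> grassmannian k n" for V
    using representative[OF that] rows_indep_representative[OF n0 that] by auto

  have forth: "if d V = 0 then gtwist n i (i + 1) (- c V) V \<in> ?CZ
      else gtwist n i (i + 1) (- c V) V \<in> ?CU \<and> c V + e (gtwist n i (i + 1) (- c V) V) \<noteq> 0"
    if V: "V \<in> ?C" for V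
  proof -
    have VP: "V \<in> open_positroid k n f" and VI: "plucker k n I V \<noteq> 0" using V by (auto simp: open_positroid_chart_def)
    have VG: "V \<in> grassmannian k n" using VP gr by blast
    note A = rep[OF VG]
    let ?A = "representative k n V"
    let ?v = "columns ?A" and ?W = "gtwist n i (i + 1) (- c V) V"
    have v: "cv.config n h ?v" using open_positroid_config[OF n0 f A] VP by (simp add: h_def)
    obtain t where t: "?v i - (\<lambda>r. t * ?v (i + 1) r) \<in> cv.span (?v ` {i + 2..<f i + 1})"
      using E.coefficient_c[OF v] by blast
    have ct: "c V = t" by (rule c_eq[OF A v t])
    have x: "i + 1 = i \<or> i + 1 = i + 1" by simp
    note tw = twisted[OF A x, of "- t"]
    have WG: "?W \<in> grassmannian k n" by (rule gtwist_grassmannian(1)[OF n VG]) simp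
    \<comment> \<open>\<open>V\<close> is recovered from the new point by the twist at
      \<open>i\<close> with parameter \<open>c V\<close>, and it is for this direction that the
      coordinates are compared.\<close>
    have WI: "plucker k n ?I ?W \<noteq> 0"
      using plucker_gtwist_nonzero(2)[OF n WG I i iI, of "c V"] gtwist_gtwist(1)[OF n VG, of i "c V"] VI by simp
    show ?thesis
    proof (cases "d V = 0")
      case True
      then have "?v (i + 1) \<in> cv.span (?v ` {b..<i})" using d_eq[OF A v] by simp
      from E.config_swap_both[OF v t this]
      have "?W \<in> open_positroid k n ?sfs"
        using open_positroid_config[OF n0 sfs tw(1-3)] unfolding tw(4) inv_sfs ct by simp
      then show ?thesis using True WI by (simp add: open_positroid_chart_def)
    next
      case False
      then have "?v (i + 1) \<notin> cv.span (?v ` {b..<i})" using d_eq[OF A v] by simp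
      from E.config_swap_left[OF v t this]
      have w: "cv.config n E.swap_left (cv.twist n i (i + 1) (- t) ?v)" .
      then have "?W \<in> open_positroid k n ?sf"
        using open_positroid_config[OF n0 sf tw(1-3)] unfolding tw(4) inv_sf ct by simp
      moreover have "c V + e ?W \<noteq> 0"
      proof -
        let ?w = "cv.twist n i (i + 1) (- t) ?v"
        obtain t' where t': "?w (i + 1) - (\<lambda>r. t' * ?w i r) \<in> cv.span (?w ` {b..<i})"
          using coef_exists[OF w E.swap_left_values(2)] by blast
        have "e ?W = t'" unfolding e_def ct
          by (rule coef_b[OF sf _ tw(1-3)]) (use t' w E.swap_left_values in \<open>simp_all add: tw(4) inv_sf\<close>)
        then show ?thesis using E.coefficient_e_neq[OF v t'] ct by simp
      qed
      ultimately show ?thesis using False WI by (simp add: open_positroid_chart_def)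
    qed
  qed

  have backZ: "gtwist n i i t W \<in> Z \<and> c (gtwist n i i t W) = t" if W: "W \<in> ?CZ" for W t
  proof -
    have WP: "W \<in> open_positroid k n ?sfs" and WI: "plucker k n ?I W \<noteq> 0" using W by (auto simp: open_positroid_chart_def)
    have WG: "W \<in> grassmannian k n" using WP gr by blast
    note A = rep[OF WG]
    let ?A = "representative k n W"
    let ?w = "columns ?A"
    have x: "i = i \<or> i = i + 1" by simp
    note tw = twisted[OF A x, of t]
    have "cv.config n E.swap_both ?w" using open_positroid_config[OF n0 sfs A] WP inv_sfs by simp
    note co = E.config_of_swap_both[OF this, of t]
    have v: "cv.config n h (columns (mtwist k n i i t ?A))" using co(1) tw(4) by simp
    have "gtwist n i i t W \<in> open_positroid k n f"
      using open_positroid_config[OF n0 f tw(1-3)] v by (simp add: h_def)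
    moreover have "plucker k n I (gtwist n i i t W) \<noteq> 0"
      using plucker_gtwist_nonzero(2)[OF n WG I i iI] WI by simp
    moreover have "d (gtwist n i i t W) = 0" using d_eq[OF tw(1-3) v] co(3) tw(4) by simp
    moreover have "c (gtwist n i i t W) = t" by (rule c_eq[OF tw(1-3) v]) (use co(2) tw(4) in simp)
    ultimately show ?thesis by (simp add: Z_def open_positroid_chart_def)
  qed

  have backU: "gtwist n i i t W \<in> U \<and> c (gtwist n i i t W) = t" if W: "W \<in> ?CU" and te: "t + e W \<noteq> 0" for W t
  proof -
    have WP: "W \<in> open_positroid k n ?sf" and WI: "plucker k n ?I W \<noteq> 0" using W by (auto simp: open_positroid_chart_def)
    have WG: "W \<in> grassmannian k n" using WP gr by blast
    note A = rep[OF WG]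
    let ?A = "representative k n W"
    let ?w = "columns ?A"
    have x: "i = i \<or> i = i + 1" by simp
    note tw = twisted[OF A x, of t]
    have w: "cv.config n E.swap_left ?w" using open_positroid_config[OF n0 sf A] WP inv_sf by simp
    obtain t' where t': "?w (i + 1) - (\<lambda>r. t' * ?w i r) \<in> cv.span (?w ` {b..<i})"
      using coef_exists[OF w E.swap_left_values(2)] by blast
    have "e W = t'" unfolding e_def
      by (rule coef_b[OF sf _ A _ t']) (use w E.swap_left_values inv_sf in simp_all)
    then have "t + t' \<noteq> 0" using te by simp
    note co = E.config_of_swap_left[OF w t' this]
    have v: "cv.config n h (columns (mtwist k n i i t ?A))" using co(1) tw(4) by simp
    have "gtwist n i i t W \<in> open_positroid k n f"
      using open_positroid_config[OF n0 f tw(1-3)] v by (simp add: h_def)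
    moreover have "plucker k n I (gtwist n i i t W) \<noteq> 0"
      using plucker_gtwist_nonzero(2)[OF n WG I i iI] WI by simp
    moreover have "d (gtwist n i i t W) \<noteq> 0" using d_eq[OF tw(1-3) v] co(3) tw(4) by simp
    moreover have "c (gtwist n i i t W) = t" by (rule c_eq[OF tw(1-3) v]) (use co(2) tw(4) in simp)
    ultimately show ?thesis by (simp add: U_def open_positroid_chart_def)
  qed

  have ZC: "Z \<subseteq> ?C" and UC: "U \<subseteq> ?C" by (auto simp: Z_def U_def)
  have ZP: "Z \<subseteq> open_positroid k n f" and UP: "U \<subseteq> open_positroid k n f" using ZC UC C by auto
  have ZG: "Z \<subseteq> grassmannian k n" and UG: "U \<subseteq> grassmannian k n" and CG: "?C \<subseteq> grassmannian k n"
    and CZG: "?CZ \<subseteq> grassmannian k n" and CUG: "?CU \<subseteq> grassmannian k n"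
    using ZP UP C CZ CU gr by blast+

  interpret X: function_sheaf "subvariety (Gr k n) ?C"
    by (rule function_sheaf_subvariety[OF function_sheaf_Gr])
  have tC: "topspace (zariski (subvariety (Gr k n) ?C)) = ?C" using CG by (auto simp: topspace_Gr)
  have zC: "zariski (subvariety (Gr k n) ?C) = subtopology (zariski (Gr k n)) ?C" by (simp add: subvariety_def)
  have oC: "openin (zariski (subvariety (Gr k n) ?C)) ?C"
    using openin_topspace[of "zariski (subvariety (Gr k n) ?C)"] tC by simp
  have "openin (zariski (subvariety (Gr k n) ?C)) {V \<in> ?C. d V \<noteq> 0}"
    unfolding d_def by (rule X.open_nonzero[OF oC coefficient_regular[OF n0 k f C]])
  then have oU: "openin (subtopology (zariski (Gr k n)) ?C) U" by (simp add: U_def zC)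
  have "?C - Z = U" by (auto simp: Z_def U_def)
  then have cZ: "closedin (subtopology (zariski (Gr k n)) ?C) Z"
    unfolding closedin_def using oU ZC tC zC by simp

  have isoZ: "subvariety (Gr k n) Z \<cong>\<^sub>v subvariety (Gr k n) ?CZ \<times>\<^sub>v affine_line"
  proof -
    obtain S0 where S0: "S0 \<in> ksubsets k n" "\<And>V. V \<in> Z \<Longrightarrow> plucker k n S0 V \<noteq> 0"
      using open_positroid_chart_coordinate[OF n0 k f ZP] by blast
    obtain T0 where T0: "T0 \<in> ksubsets k n" "\<And>V. V \<in> ?CZ \<Longrightarrow> plucker k n T0 V \<noteq> 0"
      using open_positroid_chart_coordinate[OF n0 k sfs CZ] by blast
    interpret T: function_sheaf "subvariety (Gr k n) ?CZ"
      by (rule function_sheaf_subvariety[OF function_sheaf_Gr])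
    have "topspace (zariski (subvariety (Gr k n) ?CZ)) = ?CZ" using CZG by (auto simp: topspace_Gr)
    then have oT: "openin (zariski (subvariety (Gr k n) ?CZ)) ?CZ"
      using openin_topspace[of "zariski (subvariety (Gr k n) ?CZ)"] by simp
    show ?thesis
    \<comment> \<open>On the closed locus the coordinate on the line is c itself, so the translation
      is by 0.\<close>
    proof (rule chart_isomorphism[OF n k ZG CZG S0 T0, where c = c and e = "\<lambda>_. 0" and i = i])
      show "c \<in> regular (subvariety (Gr k n) Z) Z" unfolding c_def by (rule coefficient_regular[OF n0 k f ZP])
      show "(\<lambda>_. 0) \<in> regular (subvariety (Gr k n) ?CZ) ?CZ" by (rule T.const[OF oT])
      show "gtwist n i (i + 1) (- c V) V \<in> ?CZ" if "V \<in> Z" for V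
        using forth[of V] that by (simp add: Z_def)
      show "gtwist n i i (t - 0) W \<in> Z" "c (gtwist n i i (t - 0) W) = t - 0" if "W \<in> ?CZ" for W t
        using backZ[OF that] by simp_all
    qed (simp_all add: function_sheaf_affine_line regular_affine_line_id function_sheaf.morphism_affine_line)
  qed

  have isoU: "subvariety (Gr k n) U \<cong>\<^sub>v subvariety (Gr k n) ?CU \<times>\<^sub>v punctured_line"
  proof -
    obtain S0 where S0: "S0 \<in> ksubsets k n" "\<And>V. V \<in> U \<Longrightarrow> plucker k n S0 V \<noteq> 0"
      using open_positroid_chart_coordinate[OF n0 k f UP] by blast
    obtain T0 where T0: "T0 \<in> ksubsets k n" "\<And>V. V \<in> ?CU \<Longrightarrow> plucker k n T0 V \<noteq> 0"
      using open_positroid_chart_coordinate[OF n0 k sf CU] by blast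
    show ?thesis
    proof (rule chart_isomorphism[OF n k UG CUG S0 T0, where c = c and e = e and i = i])
      show "c \<in> regular (subvariety (Gr k n) U) U" unfolding c_def by (rule coefficient_regular[OF n0 k f UP])
      show "e \<in> regular (subvariety (Gr k n) ?CU) ?CU" unfolding e_def by (rule coefficient_regular[OF n0 k sf CU])
      show "gtwist n i (i + 1) (- c V) V \<in> ?CU"
        "c V + e (gtwist n i (i + 1) (- c V) V) \<in> topspace (zariski punctured_line)" if "V \<in> U" for V
        using forth[of V] that by (simp_all add: U_def topspace_punctured_line)
      \<comment> \<open>With \<open>t\<close> the coordinate on the punctured line, the twist has
        parameter \<open>t - e W\<close>; adding \<open>e W\<close> gives back \<open>t\<close>, and
        \<open>t \<noteq> 0\<close> is the condition of \<open>backU\<close>.\<close>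
      show "gtwist n i i (t - e W) W \<in> U" "c (gtwist n i i (t - e W) W) = t - e W"
        if "W \<in> ?CU" "t \<in> topspace (zariski punctured_line)" for W t
        using backU[OF that(1), of "t - e W"] that(2) by (simp_all add: topspace_punctured_line)
    qed (simp_all add: function_sheaf_punctured_line regular_punctured_line_id topspace_punctured_line
        function_sheaf.morphism_punctured_line)
  qed

  show ?thesis
    by (intro exI[of _ Z] exI[of _ U] conjI cZ oU isoZ isoU) (auto simp: Z_def U_def)
qed

end
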